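(* Let $F$ be a field of characteristic $p>0$, let $n\in\mathbb{N}$, and let $\varphi_1,\ldots,\varphi_r$ be $p$-forms over $F$, normalized and ordered as described in the context, with associated data $a_{ij}$, $n_i$, $k_i$, $T_i$, $M$ and $s\le r$. Then $$\mathrm{d}\{a_{11},\ldots,a_{1k_1}\}\wedge\ldots\wedge \mathrm{d}\{a_{s1},\ldots,a_{sk_s}\}\neq\{0\}$$ and $$\begin{aligned}\Omega^n(F(\varphi_1,\ldots,\varphi_r)/F)&=\Omega^n(F(\varphi_1,\ldots,\varphi_s)/F)\\&=\operatorname{Ann}\Omega^n_F\big(\mathrm{d}\{a_{11},\ldots,a_{1k_1}\}\wedge\ldots\wedge \mathrm{d}\{a_{s1},\ldots,a_{sk_s}\}\big)\\&=\operatorname{Ann}\Omega^n_F\big(\mathrm{d}N_F(\varphi_1)\wedge\ldots\wedge \mathrm{d}N_F(\varphi_s)\big),\end{aligned}$$ as well as $$\begin{aligned}\nu_n(F(\varphi_1,\ldots,\varphi_r)/F)&=\nu_n(F(\varphi_1,\ldots,\varphi_s)/F)\\&=\operatorname{Ann}\nu^n_F\big(\mathrm{d}\{a_{11},\ldots,a_{1k_1}\}\wedge\ldots\wedge \mathrm{d}\{a_{s1},\ldots,a_{sk_s}\}\big)\\&=\operatorname{Ann}\nu^n_F\big(\mathrm{d}N_F(\varphi_1)\wedge\ldots\wedge \mathrm{d}N_F(\varphi_s)\big).\end{aligned}$$ In particular, the kernels $\Omega^n(F(\varphi_1,\ldots,\varphi_r)/F)$ and $\nu_n(F(\varphi_1,\ldots,\varphi_r)/F)$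 depend only on the norm fields of $\varphi_1,\ldots,\varphi_s$ and not on the forms themselves.
   Context: $p$-forms: a $p$-form on a finite-dimensional $F$-vector space $V$ is a map $\varphi:V\to F$ with $\varphi(\lambda v)=\lambda^p\varphi(v)$ and $\varphi(u+v)=\varphi(u)+\varphi(v)$. If $v_1,\ldots,v_m$ is a basis of $V$ and $c_i=\varphi(v_i)$, write $\varphi=\langle c_1,\ldots,c_m\rangle_p$; it corresponds to the polynomial $\varphi(X_1,\ldots,X_m)=\sum c_iX_i^p$. Set $D_F(\varphi)=\{\varphi(v)\neq 0\mid v\in V\}$. The norm field is $N_F(\varphi)=F^p(a/b\mid a,b\in D_F(\varphi))$ and the norm degree is $\operatorname{ndeg}_F(\varphi)=[N_F(\varphi):F^p]$, a power of $p$; for $\varphi=\langle 1,c_1,\ldots,c_m\rangle_p$ one has $N_F(\varphi)=F^p(c_1,\ldots,c_m)$. For a field extension $E/F$, $\varphi$ is also regarded as a $p$-form over $E$ by scalar extension. Function fields: for a non-zero $p$-form $\varphi=\langle c_1,\ldots,c_m\rangle_p$, $F(\varphi)$ is the quotient field of $F[X_1,\ldots,X_m]/(\varphi(X_1,\ldots,X_m))$ if $\operatorname{ndeg}_F(\varphi)>1$, and $F(\varphi)=F(X_1,\ldots,X_m)$ if $\operatorname{ndeg}_F(\varphi)=1$. The iterated function field $F(\varphi_1,\ldots,\varphi_r)$ is $F_r$, where $F_0=F$ and $F_i=F_{i-1}(\varphi_i)$. Normalization of $\varphi_1,\ldots,\varphi_r$: $\varphi_i$ has dimension $1+n_i$ with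 $n_i\ge 1$ and, after scaling (which changes neither the function field nor the norm field), $\varphi_i=\langle 1,a_{i1},\ldots,a_{in_i}\rangle_p$ with $a_{ij}\in F$. Write $\operatorname{ndeg}_F(\varphi_i)=p^{k_i}$; the $a_{ij}$ are ordered so that $N_F(\varphi_i)=F^p(a_{i1},\ldots,a_{ik_i})$. Let $X_{ij}$ ($1\le i\le r$, $1\le j\le n_i$) be independent variables, $M=F(X_{ij}\mid 1\le i\le r,\ 1\le j\le n_i)$ and $T_i=\sum_{j=1}^{n_i}a_{ij}X_{ij}^p$. The forms $\varphi_1,\ldots,\varphi_r$ are ordered so that, with $[M(\sqrt[p]{T_1},\ldots,\sqrt[p]{T_r}):M]=p^s$, one has $M(\sqrt[p]{T_1},\ldots,\sqrt[p]{T_r})=M(\sqrt[p]{T_1},\ldots,\sqrt[p]{T_s})$. Differential forms: $\Omega^1(F)$ is the $F$-vector space generated by symbols $\mathrm{d}a$ ($a\in F$) with $\mathrm{d}(a+b)=\mathrm{d}a+\mathrm{d}b$, $\mathrm{d}(ab)=a\,\mathrm{d}b+b\,\mathrm{d}a$ (absolute Kähler differentials); $\Omega^n(F)=\bigwedge^n\Omega^1(F)$, $\Omega^0(F)=F$, $\Omega^z(F)=0$ for $z<0$; $\mathrm{d}:\Omega^{n-1}(F)\to\Omega^n(F)$ is the exterior derivative. The Artin–Schreier map $\wp:\Omega^n(F)\to\Omega^n(F)/\mathrm{d}\Omega^{n-1}(F)$ is the additive map with $\wp\big(x\frac{\mathrm{d}a_1}{a_1}\wedge\ldots\wedge\frac{\mathrm{d}a_n}{a_n}\big)=(x^p-x)\frac{\mathrm{d}a_1}{a_1}\wedge\ldots\wedge\frac{\mathrm{d}a_n}{a_n}\bmod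 \mathrm{d}\Omega^{n-1}(F)$, and $\nu_n(F)=\ker\wp$. For a field extension $K/F$, $\Omega^n(K/F)$ is the kernel of $\Omega^n(F)\to\Omega^n(K)$ and $\nu_n(K/F)=\Omega^n(K/F)\cap\nu_n(F)$. Annihilators: for non-empty $U\subset\Omega^m(F)$, $\operatorname{Ann}\Omega^n_F(U)=\{\omega\in\Omega^n(F)\mid\omega\wedge u=0\text{ in }\Omega^{n+m}(F)\text{ for all }u\in U\}$ and $\operatorname{Ann}\nu^n_F(U)=\operatorname{Ann}\Omega^n_F(U)\cap\nu_n(F)$. For $S_1,\ldots,S_m\subset F$, $\mathrm{d}S_1\wedge\ldots\wedge \mathrm{d}S_m=\{\mathrm{d}s_1\wedge\ldots\wedge \mathrm{d}s_m\mid s_i\in S_i\}$; in the degenerate case $m=0$ this set is read as $\{1\}\subset\Omega^0(F)$. The assertion "$\neq\{0\}$" means that the set contains a non-zero element. *)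

theory Defs
  imports
    "HOL-Algebra.Algebra"
    "HOL-Algebra.Algebraic_Closure_Type"
    "HOL-Library.Poly_Mapping"
    "HOL-Library.Product_Lexorder"
    "HOL-Library.Set_Algebras"
begin

section \<open>Free vector spaces and free algebras\<close>

abbreviation type_ring :: "'a::ring_1 ring"
  where "type_ring \<equiv> ring_of_type_algebra"

abbreviation fscale :: "'a::field \<Rightarrow> ('b \<Rightarrow>\<^sub>0 'a) \<Rightarrow> ('b \<Rightarrow>\<^sub>0 'a)"
  where "fscale c \<equiv> Poly_Mapping.map ((*) c)"

lemma lookup_fscale [simp]: "Poly_Mapping.lookup (fscale c f) k = c * Poly_Mapping.lookup f k"
  by (simp add: Poly_Mapping.map.rep_eq when_def)

lemma vector_space_fscale: "vector_space (fscale :: 'a::field \<Rightarrow> ('b \<Rightarrow>\<^sub>0 'a) \<Rightarrow> _)"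
  by unfold_locales (auto intro!: poly_mapping_eqI simp: lookup_add algebra_simps)

interpretation free_vs: vector_space "fscale :: 'a::field \<Rightarrow> ('b \<Rightarrow>\<^sub>0 'a) \<Rightarrow> _"
  by (rule vector_space_fscale)

text \<open>
  Additive extension of a function given on the multiples \<open>c \<cdot> [k]\<close> of the basis vectors.
\<close>

definition pm_sum :: "('b \<Rightarrow> 'a::zero \<Rightarrow> 'c::comm_monoid_add) \<Rightarrow> ('b \<Rightarrow>\<^sub>0 'a) \<Rightarrow> 'c"
  where "pm_sum h f = (\<Sum>k\<in>Poly_Mapping.keys f. h k (Poly_Mapping.lookup f k))"

lemma pm_sum_add:
  assumes "\<And>k. h k 0 = 0" "\<And>k x y. h k (x + y) = h k x + h k y"
  shows "pm_sum h (f + g) = pm_sum h f + pm_sum h (g :: 'b \<Rightarrow>\<^sub>0 'a::monoid_add)"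
  unfolding pm_sum_def by (rule setsum_keys_plus_distrib) (use assms in auto)

lemma pm_sum_zero [simp]: "pm_sum h 0 = 0"
  by (simp add: pm_sum_def)

lemma pm_sum_single:
  assumes "h k 0 = 0"
  shows "pm_sum h (Poly_Mapping.single k c) = h k c"
  using assms by (auto simp: pm_sum_def)

lemma pm_sum_uminus:
  fixes h :: "'b \<Rightarrow> 'a::ab_group_add \<Rightarrow> 'c::ab_group_add"
  assumes "\<And>k. h k 0 = 0" "\<And>k x y. h k (x + y) = h k x + h k y"
  shows "pm_sum h (- f) = - pm_sum h f"
  using pm_sum_add[of h f "- f", OF assms]
  by (simp add: eq_neg_iff_add_eq_0 add.commute)

lemma pm_sum_diff:
  fixes h :: "'b \<Rightarrow> 'a::ab_group_add \<Rightarrow> 'c::ab_group_add"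
  assumes "\<And>k. h k 0 = 0" "\<And>k x y. h k (x + y) = h k x + h k y"
  shows "pm_sum h (f - g) = pm_sum h f - pm_sum h g"
  using pm_sum_add[of h f "- g", OF assms] pm_sum_uminus[of h g, OF assms] by simp

lemma pm_induct [case_names zero add]:
  assumes "P 0" "\<And>k c f. P f \<Longrightarrow> P (Poly_Mapping.single k c + f)"
  shows "P (f :: 'b \<Rightarrow>\<^sub>0 'a::comm_monoid_add)"
proof (induction "card (Poly_Mapping.keys f)" arbitrary: f)
  case 0
  then show ?case using assms(1) by simp
next
  case (Suc n)
  then obtain k where k: "k \<in> Poly_Mapping.keys f"
    by (metis card.empty ex_in_conv nat.distinct(1))
  define g where "g = Poly_Mapping.update k 0 f"
  have "Poly_Mapping.keys g = Poly_Mapping.keys f - {k}"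
    by (auto simp: g_def keys_update)
  hence "n = card (Poly_Mapping.keys g)"
    using k Suc(2) by simp
  hence "P g" by (rule Suc(1))
  moreover have "f = Poly_Mapping.single k (Poly_Mapping.lookup f k) + g"
    by (rule poly_mapping_eqI) (auto simp: g_def lookup_add lookup_update lookup_single when_def)
  ultimately show ?case using assms(2) by metis
qed

text \<open>
  Words form a monoid under concatenation, so that \<open>'v list \<Rightarrow>\<^sub>0 'a\<close> is the free associative
  \<open>'a\<close>-algebra on \<open>'v\<close>.
\<close>

instantiation list :: (type) monoid_add
begin
definition zero_list :: "'a list" where "zero_list = []"
definition plus_list :: "'a list \<Rightarrow> 'a list \<Rightarrow> 'a list" where "plus_list xs ys = xs @ ys"
instance by standard (auto simp: zero_list_def plus_list_def)
end

lemma ring_type_ring: "ring (type_ring :: 'a::ring_1 ring)"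
proof -
  have "\<exists>y. x + y = 0" for x :: 'a
    using add.right_inverse by blast
  thus ?thesis
    unfolding ring_of_type_algebra_def using add.right_inverse
    by unfold_locales (auto simp: algebra_simps Units_def)
qed

lemma type_ring_simps [simp]:
  "carrier type_ring = UNIV" "monoid.mult type_ring = (*)" "monoid.one type_ring = 1"
  "ring.zero type_ring = 0" "add type_ring = (+)"
  by (auto simp: ring_of_type_algebra_def fun_eq_iff)

section \<open>Differential forms\<close>

subsection \<open>Absolute Kaehler differentials\<close>

text \<open>\<open>Poly_Mapping.single a 1\<close> is the symbol \<open>da\<close>.\<close>

definition kaehler_relators :: "('a::field \<Rightarrow>\<^sub>0 'a) set"
  where "kaehler_relators =
    {Poly_Mapping.single (a + b) 1 - (Poly_Mapping.single a 1 + Poly_Mapping.single b 1) | a b. True} \<union>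
    {Poly_Mapping.single (a * b) 1 - (Poly_Mapping.single b a + Poly_Mapping.single a b) | a b. True}"

definition kaehler_rel :: "('a::field \<Rightarrow>\<^sub>0 'a) \<Rightarrow> ('a \<Rightarrow>\<^sub>0 'a) \<Rightarrow> bool"
  where "kaehler_rel f g \<longleftrightarrow> f - g \<in> module.span fscale kaehler_relators"

quotient_type (overloaded) 'a kaehler = "'a::field \<Rightarrow>\<^sub>0 'a" / kaehler_rel
proof (rule equivpI)
  show "reflp (kaehler_rel :: ('a \<Rightarrow>\<^sub>0 'a) \<Rightarrow> _)"
    by (rule reflpI) (simp add: kaehler_rel_def free_vs.span_zero)
  show "symp (kaehler_rel :: ('a \<Rightarrow>\<^sub>0 'a) \<Rightarrow> _)"
    by (rule sympI) (metis kaehler_rel_def free_vs.span_neg minus_diff_eq)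
  show "transp (kaehler_rel :: ('a \<Rightarrow>\<^sub>0 'a) \<Rightarrow> _)"
  proof (rule transpI)
    fix f g h :: "'a \<Rightarrow>\<^sub>0 'a"
    assume "kaehler_rel f g" "kaehler_rel g h"
    hence "(f - g) + (g - h) \<in> module.span fscale kaehler_relators"
      unfolding kaehler_rel_def by (rule free_vs.span_add)
    thus "kaehler_rel f h" by (simp add: kaehler_rel_def)
  qed
qed

instantiation kaehler :: (field) ab_group_add
begin
lift_definition zero_kaehler :: "'a kaehler" is 0 .
lift_definition plus_kaehler :: "'a kaehler \<Rightarrow> 'a kaehler \<Rightarrow> 'a kaehler" is "(+)"
  unfolding kaehler_rel_def by (simp add: add_diff_add free_vs.span_add)
lift_definition uminus_kaehler :: "'a kaehler \<Rightarrow> 'a kaehler" is uminus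
  unfolding kaehler_rel_def minus_diff_minus by (rule free_vs.span_neg)
lift_definition minus_kaehler :: "'a kaehler \<Rightarrow> 'a kaehler \<Rightarrow> 'a kaehler" is "(-)"
proof -
  fix f g f' g' :: "'a \<Rightarrow>\<^sub>0 'a"
  assume "kaehler_rel f g" "kaehler_rel f' g'"
  hence "(f - g) - (f' - g') \<in> module.span fscale kaehler_relators"
    unfolding kaehler_rel_def by (rule free_vs.span_diff)
  moreover have "(f - g) - (f' - g') = (f - f') - (g - g')" by simp
  ultimately show "kaehler_rel (f - f') (g - g')" by (simp only: kaehler_rel_def)
qed
instance
  by standard (transfer, simp add: kaehler_rel_def free_vs.span_zero algebra_simps)+
end

lift_definition kscale :: "'a::field \<Rightarrow> 'a kaehler \<Rightarrow> 'a kaehler" is fscale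
  unfolding kaehler_rel_def by (simp only: free_vs.scale_right_diff_distrib [symmetric] free_vs.span_scale)

lift_definition kdiff :: "'a::field \<Rightarrow> 'a kaehler" is "\<lambda>a. Poly_Mapping.single a 1" .

lemma vector_space_kscale: "vector_space (kscale :: 'a::field \<Rightarrow> _)"
  by unfold_locales
     (transfer, simp add: kaehler_rel_def free_vs.span_zero free_vs.scale_left_distrib free_vs.scale_right_distrib)+

interpretation kaehler: vector_space "kscale :: 'a::field \<Rightarrow> _"
  by (rule vector_space_kscale)

lemma kdiff_add: "kdiff (a + b) = kdiff a + kdiff (b::'a::field)"
  by transfer (auto simp: kaehler_rel_def kaehler_relators_def intro!: free_vs.span_base)

lemma kdiff_mult: "kdiff (a * b) = kscale a (kdiff b) + kscale b (kdiff (a::'a::field))"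
  by transfer (auto simp: kaehler_rel_def kaehler_relators_def map_single intro!: free_vs.span_base)

subsection \<open>The exterior algebra\<close>

text \<open>
  The exterior algebra of \<open>\<Omega>\<^sup>1(F)\<close>: the free algebra on the vectors of \<open>\<Omega>\<^sup>1(F)\<close> modulo linearity
  (which gives the tensor algebra) and \<open>u \<otimes> u = 0\<close>.  The multiplication of \<open>'a dform\<close> is the wedge
  product.
\<close>

definition dform_relators :: "('a::field kaehler list \<Rightarrow>\<^sub>0 'a) set"
  where "dform_relators =
    {Poly_Mapping.single [u + v] 1 - (Poly_Mapping.single [u] 1 + Poly_Mapping.single [v] 1) | u v. True} \<union>
    {Poly_Mapping.single [kscale c u] 1 - Poly_Mapping.single [u] c | c u. True} \<union>
    {Poly_Mapping.single [u, u] 1 | u. True}"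

definition dform_rel :: "('a::field kaehler list \<Rightarrow>\<^sub>0 'a) \<Rightarrow> ('a kaehler list \<Rightarrow>\<^sub>0 'a) \<Rightarrow> bool"
  where "dform_rel f g \<longleftrightarrow> f - g \<in> Idl\<^bsub>type_ring\<^esub> dform_relators"

lemma ideal_dform: "ideal (Idl\<^bsub>type_ring\<^esub> (dform_relators :: ('a::field kaehler list \<Rightarrow>\<^sub>0 'a) set)) type_ring"
  by (rule ring.genideal_ideal[OF ring_type_ring]) simp

lemma ideal_type_ring_iff:
  "ideal I (type_ring :: 'r::ring_1 ring) \<longleftrightarrow>
     0 \<in> I \<and> (\<forall>x\<in>I. \<forall>y\<in>I. x + y \<in> I) \<and> (\<forall>x\<in>I. \<forall>y. y * x \<in> I \<and> x * y \<in> I)"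
    (is "_ \<longleftrightarrow> ?R")
proof
  assume "ideal I (type_ring :: 'r ring)"
  then interpret ideal I "type_ring :: 'r ring" .
  show ?R
    using additive_subgroup.zero_closed[OF is_additive_subgroup]
      additive_subgroup.a_closed[OF is_additive_subgroup] I_l_closed I_r_closed
    by auto
next
  assume R: ?R
  interpret ring "type_ring :: 'r ring" by (rule ring_type_ring)
  have minus: "\<ominus>\<^bsub>type_ring\<^esub> x = - x" for x :: 'r
    by (rule minus_equality) auto
  show "ideal I (type_ring :: 'r ring)"
  proof (intro idealI[OF ring_type_ring] subgroup.intro, goal_cases)
    case (4 x)
    have "- 1 * x \<in> I" using R 4 by blast
    thus ?case using minus[of x] by (simp add: a_inv_def)
  qed (use R in auto)
qed

lemma
  fixes I :: "'r::ring_1 set"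
  assumes "ideal I type_ring"
  shows ideal_0: "0 \<in> I"
    and ideal_add: "x \<in> I \<Longrightarrow> y \<in> I \<Longrightarrow> x + y \<in> I"
    and ideal_mult_left: "x \<in> I \<Longrightarrow> z * x \<in> I"
    and ideal_mult_right: "x \<in> I \<Longrightarrow> x * z \<in> I"
    and ideal_uminus: "x \<in> I \<Longrightarrow> - x \<in> I"
    and ideal_diff: "x \<in> I \<Longrightarrow> y \<in> I \<Longrightarrow> x - y \<in> I"
proof -
  show *: "0 \<in> I" "x \<in> I \<Longrightarrow> y \<in> I \<Longrightarrow> x + y \<in> I" "x \<in> I \<Longrightarrow> z * x \<in> I"
    "x \<in> I \<Longrightarrow> x * z \<in> I" for x y z
    using assms by (auto simp: ideal_type_ring_iff)
  show **: "x \<in> I \<Longrightarrow> - x \<in> I" for x using *(3)[of x "- 1"] by simp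
  show "x \<in> I \<Longrightarrow> y \<in> I \<Longrightarrow> x - y \<in> I" using *(2)[of x "- y"] **[of y] by simp
qed

lemmas dform_ideal = ideal_0[OF ideal_dform] ideal_add[OF ideal_dform] ideal_mult_left[OF ideal_dform]
  ideal_mult_right[OF ideal_dform] ideal_uminus[OF ideal_dform] ideal_diff[OF ideal_dform]

lemma dform_ideal_base: "r \<in> dform_relators \<Longrightarrow> r \<in> Idl\<^bsub>type_ring\<^esub> dform_relators"
  by (auto simp: genideal_def)

text \<open>
  An additive map on the free algebra vanishes on the ideal as soon as it vanishes on the
  two-sided multiples of the relators by words.
\<close>

lemma dform_ideal_additive_0:
  fixes \<phi> :: "('a::field kaehler list \<Rightarrow>\<^sub>0 'a) \<Rightarrow> 'c::ab_group_add"
  assumes add: "\<And>f g. \<phi> (f + g) = \<phi> f + \<phi> g"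
    and rel: "\<And>r xs ys c e. r \<in> dform_relators \<Longrightarrow>
      \<phi> (Poly_Mapping.single xs c * r * Poly_Mapping.single ys e) = 0"
    and f: "f \<in> Idl\<^bsub>type_ring\<^esub> dform_relators"
  shows "\<phi> f = 0"
proof -
  define J where "J = {f. \<forall>g h. \<phi> (g * f * h) = 0}"
  have \<phi>0: "\<phi> 0 = 0" using add[of 0 0] by simp
  have "ideal J type_ring"
    unfolding ideal_type_ring_iff
  proof (intro conjI ballI allI)
    show "0 \<in> J" by (simp add: J_def \<phi>0)
    show "x + y \<in> J" if "x \<in> J" "y \<in> J" for x y
      using that by (simp add: J_def add distrib_left distrib_right)
    show "y * x \<in> J" if "x \<in> J" for x y
      using that by (simp add: J_def mult.assoc [symmetric])
    show "x * y \<in> J" if "x \<in> J" for x y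
      using that by (simp add: J_def mult.assoc)
  qed
  moreover have "dform_relators \<subseteq> J"
  proof
    fix r :: "'a kaehler list \<Rightarrow>\<^sub>0 'a" assume r: "r \<in> dform_relators"
    have 1: "\<phi> (Poly_Mapping.single xs c * r * h) = 0" for xs c h
      by (induction h rule: pm_induct) (simp_all add: \<phi>0 add distrib_left rel[OF r])
    have "\<phi> (g * r * h) = 0" for g h
      by (induction g rule: pm_induct) (simp_all add: \<phi>0 add distrib_right 1)
    thus "r \<in> J" by (simp add: J_def)
  qed
  ultimately have "f \<in> J" using f by (auto simp: genideal_def)
  hence "\<phi> (1 * f * 1) = 0" unfolding J_def by blast
  thus ?thesis by simp
qed

quotient_type (overloaded) 'a dform = "'a::field kaehler list \<Rightarrow>\<^sub>0 'a" / dform_rel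
proof (rule equivpI)
  show "reflp (dform_rel :: ('a kaehler list \<Rightarrow>\<^sub>0 'a) \<Rightarrow> _)"
    by (rule reflpI) (simp add: dform_rel_def dform_ideal)
  show "symp (dform_rel :: ('a kaehler list \<Rightarrow>\<^sub>0 'a) \<Rightarrow> _)"
    by (rule sympI) (metis dform_rel_def dform_ideal(5) minus_diff_eq)
  show "transp (dform_rel :: ('a kaehler list \<Rightarrow>\<^sub>0 'a) \<Rightarrow> _)"
  proof (rule transpI)
    fix f g h :: "'a kaehler list \<Rightarrow>\<^sub>0 'a"
    assume "dform_rel f g" "dform_rel g h"
    hence "(f - g) + (g - h) \<in> Idl\<^bsub>type_ring\<^esub> dform_relators"
      unfolding dform_rel_def by (rule dform_ideal)
    thus "dform_rel f h" by (simp add: dform_rel_def)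
  qed
qed

lemma one_notin_dform_ideal: "(1 :: 'a::field kaehler list \<Rightarrow>\<^sub>0 'a) \<notin> Idl\<^bsub>type_ring\<^esub> dform_relators"
proof
  assume *: "(1 :: 'a kaehler list \<Rightarrow>\<^sub>0 'a) \<in> Idl\<^bsub>type_ring\<^esub> dform_relators"
  have "Poly_Mapping.lookup (1 :: 'a kaehler list \<Rightarrow>\<^sub>0 'a) [] = 0"
    by (rule dform_ideal_additive_0[OF _ _ *])
       (auto simp: lookup_add dform_relators_def distrib_left distrib_right
          left_diff_distrib right_diff_distrib mult_single plus_list_def
          lookup_minus lookup_single when_def)
  thus False by (simp add: lookup_one zero_list_def)
qed

instantiation dform :: (field) ring_1
begin
lift_definition zero_dform :: "'a dform" is 0 .
lift_definition one_dform :: "'a dform" is 1 .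
lift_definition plus_dform :: "'a dform \<Rightarrow> 'a dform \<Rightarrow> 'a dform" is "(+)"
  unfolding dform_rel_def by (simp add: add_diff_add dform_ideal)
lift_definition uminus_dform :: "'a dform \<Rightarrow> 'a dform" is uminus
  unfolding dform_rel_def minus_diff_minus by (rule dform_ideal)
lift_definition minus_dform :: "'a dform \<Rightarrow> 'a dform \<Rightarrow> 'a dform" is "(-)"
proof -
  fix f g f' g' :: "'a kaehler list \<Rightarrow>\<^sub>0 'a"
  assume "dform_rel f g" "dform_rel f' g'"
  hence "(f - g) - (f' - g') \<in> Idl\<^bsub>type_ring\<^esub> dform_relators"
    unfolding dform_rel_def by (rule dform_ideal)
  moreover have "(f - g) - (f' - g') = (f - f') - (g - g')" by simp
  ultimately show "dform_rel (f - f') (g - g')" by (simp only: dform_rel_def)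
qed
lift_definition times_dform :: "'a dform \<Rightarrow> 'a dform \<Rightarrow> 'a dform" is "(*)"
proof -
  fix f g f' g' :: "'a kaehler list \<Rightarrow>\<^sub>0 'a"
  assume "dform_rel f g" "dform_rel f' g'"
  hence "(f - g) * f' + g * (f' - g') \<in> Idl\<^bsub>type_ring\<^esub> dform_relators"
    unfolding dform_rel_def by (intro dform_ideal(2) dform_ideal(3) dform_ideal(4))
  moreover have "(f - g) * f' + g * (f' - g') = f * f' - g * g'" by (simp add: algebra_simps)
  ultimately show "dform_rel (f * f') (g * g')" by (simp only: dform_rel_def)
qed
instance
proof
  show "(0::'a dform) \<noteq> 1"
    by transfer (use one_notin_dform_ideal dform_ideal(5) in \<open>force simp: dform_rel_def\<close>)
qed (transfer, simp add: dform_rel_def dform_ideal algebra_simps)+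
end

lift_definition form0 :: "'a::field \<Rightarrow> 'a dform" is "\<lambda>c. Poly_Mapping.single [] c" .

definition form1 :: "'a::field kaehler \<Rightarrow> 'a dform"
  where "form1 u = abs_dform (Poly_Mapping.single [u] 1)"

lemma form0_simps [simp]: "form0 0 = 0" "form0 1 = 1"
  by (transfer, simp add: dform_rel_def dform_ideal flip: zero_list_def)+

lemma form0_add: "form0 (a + b) = form0 a + form0 b"
  by transfer (simp add: dform_rel_def dform_ideal single_add)

lemma form0_mult: "form0 (a * b) = form0 a * form0 b"
  by transfer (simp add: dform_rel_def dform_ideal mult_single plus_list_def)

lemma form0_commute: "form0 a * \<omega> = \<omega> * form0 a"
proof (transfer, goal_cases)
  case (1 a f)
  have "Poly_Mapping.single [] a * f = f * Poly_Mapping.single [] a"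
    by (induction f rule: pm_induct) (simp_all add: algebra_simps mult_single plus_list_def)
  thus ?case by (simp add: dform_rel_def dform_ideal)
qed

lemma form1_add: "form1 (u + v) = form1 u + form1 v"
  unfolding form1_def plus_dform.abs_eq dform.abs_eq_iff dform_rel_def
  by (rule dform_ideal_base) (auto simp: dform_relators_def)

lemma form1_0: "form1 0 = 0"
  using form1_add[of 0 0] by simp

lemma form1_scale: "form1 (kscale c u) = form0 c * form1 u"
  unfolding form1_def form0.abs_eq times_dform.abs_eq dform.abs_eq_iff dform_rel_def
  by (rule dform_ideal_base) (auto simp: dform_relators_def mult_single plus_list_def)

lemma form1_square: "form1 u * form1 u = 0"
  unfolding form1_def times_dform.abs_eq zero_dform.abs_eq dform.abs_eq_iff dform_rel_def
  by (rule dform_ideal_base) (auto simp: dform_relators_def mult_single plus_list_def)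

definition D :: "'a::field \<Rightarrow> 'a dform"
  where "D a = form1 (kdiff a)"

lemma D_add: "D (a + b) = D a + D b"
  by (simp add: D_def kdiff_add form1_add)

lemma D_mult: "D (a * b) = form0 a * D b + form0 b * D a"
  by (simp add: D_def kdiff_mult form1_add form1_scale)

definition Omega :: "nat \<Rightarrow> 'a::field dform set"
  where "Omega n = abs_dform ` {f. \<forall>us\<in>Poly_Mapping.keys f. length us = n}"

subsection \<open>Maps out of the spaces of differential forms\<close>

lemma kaehler_additive_lift:
  fixes h :: "'a::field \<Rightarrow> 'a \<Rightarrow> 'c::ab_group_add"
  assumes zero: "\<And>k. h k 0 = 0" and add: "\<And>k x y. h k (x + y) = h k x + h k y"
    and rel_add: "\<And>a b c. h (a + b) c = h a c + h b c"
    and rel_mult: "\<And>a b c. h (a * b) c = h b (c * a) + h a (c * b)"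
  shows "pm_sum h (rep_kaehler (abs_kaehler f)) = pm_sum h f"
proof -
  have "pm_sum h g = 0" if "g \<in> module.span fscale kaehler_relators" for g
    using that
  proof (induction rule: free_vs.span_induct_alt)
    case (step c r g)
    have fs: "fscale c (Poly_Mapping.single a b) = Poly_Mapping.single a (c * b)" for a b :: 'a
      by (rule poly_mapping_eqI) (simp add: lookup_single when_def)
    have "pm_sum h (fscale c r) = 0"
      using step(1)
      by (auto simp: kaehler_relators_def fs free_vs.scale_right_diff_distrib
            free_vs.scale_right_distrib pm_sum_diff[OF zero add] pm_sum_add[OF zero add]
            pm_sum_single zero rel_add rel_mult)
    thus ?case using step(2) by (simp add: pm_sum_add[OF zero add])
  qed simp
  moreover have "rep_kaehler (abs_kaehler f) - f \<in> module.span fscale kaehler_relators"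
    using Quotient3_rep_abs[OF Quotient3_kaehler, of f] 
    by (simp add: kaehler_rel_def free_vs.span_zero)
  ultimately have "pm_sum h (rep_kaehler (abs_kaehler f) - f) = 0" .
  thus ?thesis by (simp add: pm_sum_diff[OF zero add])
qed

lemma dform_additive_lift:
  fixes h :: "'a::field kaehler list \<Rightarrow> 'a \<Rightarrow> 'c::ab_group_add"
  assumes zero: "\<And>k. h k 0 = 0" and add: "\<And>k x y. h k (x + y) = h k x + h k y"
    and rel_add: "\<And>xs u v ys c. h (xs @ (u + v) # ys) c = h (xs @ u # ys) c + h (xs @ v # ys) c"
    and rel_scale: "\<And>xs e u ys c. h (xs @ kscale e u # ys) c = h (xs @ u # ys) (c * e)"
    and rel_sq: "\<And>xs u ys c. h (xs @ u # u # ys) c = 0"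
  shows "pm_sum h (rep_dform (abs_dform f)) = pm_sum h f"
proof -
  have "pm_sum h g = 0" if "g \<in> Idl\<^bsub>type_ring\<^esub> dform_relators" for g
    by (rule dform_ideal_additive_0[OF _ _ that])
       (auto simp: pm_sum_add[OF zero add] dform_relators_def distrib_left distrib_right
          left_diff_distrib right_diff_distrib mult_single plus_list_def pm_sum_diff[OF zero add]
          pm_sum_single zero rel_add rel_scale rel_sq ac_simps)
  moreover have "rep_dform (abs_dform f) - f \<in> Idl\<^bsub>type_ring\<^esub> dform_relators"
    using Quotient3_rep_abs[OF Quotient3_dform, of f] 
    by (simp add: dform_rel_def dform_ideal)
  ultimately have "pm_sum h (rep_dform (abs_dform f) - f) = 0" .
  thus ?thesis by (simp add: pm_sum_diff[OF zero add])
qed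

definition wedge_list :: "'a::field kaehler list \<Rightarrow> 'a dform"
  where "wedge_list us = prod_list (map form1 us)"

lemma form0_commute': "x * (form0 a * y) = form0 a * (x * y)"
  by (metis form0_commute mult.assoc)

lemma abs_dform_single: "abs_dform (Poly_Mapping.single us c) = form0 c * wedge_list us"
proof (induction us arbitrary: c)
  case Nil
  show ?case by (simp add: wedge_list_def form0.abs_eq)
next
  case (Cons u us)
  have "abs_dform (Poly_Mapping.single (u # us) c) = form1 u * abs_dform (Poly_Mapping.single us c)"
    unfolding form1_def times_dform.abs_eq by (simp add: mult_single plus_list_def)
  thus ?case using Cons by (simp add: wedge_list_def form0_commute')
qed

lemma abs_dform_conv_pm_sum: "abs_dform f = pm_sum (\<lambda>us c. form0 c * wedge_list us) f"
  by (induction f rule: pm_induct)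
     (simp_all add: pm_sum_add pm_sum_single form0_add distrib_right abs_dform_single
        flip: zero_dform.abs_eq plus_dform.abs_eq)

lemma abs_kaehler_conv_pm_sum: "abs_kaehler f = pm_sum (\<lambda>a c. kscale c (kdiff a)) f"
proof (induction f rule: pm_induct)
  case (add k c f)
  have "abs_kaehler (Poly_Mapping.single k c) = kscale c (kdiff k)"
    unfolding kdiff.abs_eq kscale.abs_eq
    by (rule arg_cong[where f = abs_kaehler]) (auto intro!: poly_mapping_eqI simp: lookup_single when_def)
  thus ?case using add
    by (simp add: pm_sum_add pm_sum_single kaehler.scale_left_distrib flip: plus_kaehler.abs_eq)
qed (simp flip: zero_kaehler.abs_eq)

lemma dform_induct [case_names zero add]:
  assumes "P 0" "\<And>c as \<omega>. P \<omega> \<Longrightarrow> P (form0 c * prod_list (map D as) + \<omega>)"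
  shows "P (\<omega> :: 'a::field dform)"
proof -
  have 1: "P (form0 c * (prod_list (map D as) * wedge_list us) + \<omega>)" if "P \<omega>" for c as us \<omega>
    using that
  proof (induction us arbitrary: c as \<omega>)
    case Nil thus ?case using assms(2) by (simp add: wedge_list_def)
  next
    case (Cons u us)
    obtain f where u: "u = abs_kaehler f" by (rule that[OF Quotient3_abs_rep[OF Quotient3_kaehler, symmetric]])
    show ?case unfolding u using Cons.prems
    proof (induction f arbitrary: \<omega> rule: pm_induct)
      case zero
      thus ?case by (simp add: abs_kaehler_conv_pm_sum wedge_list_def form1_0)
    next
      case (add k e f)
      have "wedge_list (abs_kaehler (Poly_Mapping.single k e + f) # us) =
         form0 e * (D k * wedge_list us) + wedge_list (abs_kaehler f # us)"
        by (simp add: abs_kaehler_conv_pm_sum pm_sum_add pm_sum_single kaehler.scale_left_distrib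
             wedge_list_def form1_add form1_scale distrib_right D_def mult.assoc)
      hence "form0 c * (prod_list (map D as) * wedge_list (abs_kaehler (Poly_Mapping.single k e + f) # us)) + \<omega>
        = form0 (c * e) * (prod_list (map D (as @ [k])) * wedge_list us) +
          (form0 c * (prod_list (map D as) * wedge_list (abs_kaehler f # us)) + \<omega>)"
        by (simp add: distrib_left form0_mult mult.assoc form0_commute'[of "prod_list (map D as)"])
      thus ?case using Cons.IH[OF add.IH[OF add.prems]] by (simp only:)
    qed
  qed
  obtain f where f: "\<omega> = abs_dform f" by (rule that[OF Quotient3_abs_rep[OF Quotient3_dform, symmetric]])
  show ?thesis unfolding f
  proof (induction f rule: pm_induct)
    case zero thus ?case using assms(1) by (simp flip: zero_dform.abs_eq)
  next
    case (add us c f)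
    thus ?case using 1[of "abs_dform f" c "[]" us]
      by (simp add: abs_dform_single flip: plus_dform.abs_eq)
  qed
qed

lemma dform_additive_eqI:
  fixes f g :: "'a::field dform \<Rightarrow> 'c::ab_group_add"
  assumes "\<And>\<omega> \<eta>. f (\<omega> + \<eta>) = f \<omega> + f \<eta>" "\<And>\<omega> \<eta>. g (\<omega> + \<eta>) = g \<omega> + g \<eta>"
    and "\<And>c as. f (form0 c * prod_list (map D as)) = g (form0 c * prod_list (map D as))"
  shows "f \<omega> = g \<omega>"
proof (induction \<omega> rule: dform_induct)
  case zero
  show ?case using assms(1)[of 0 0] assms(2)[of 0 0] by simp
qed (simp add: assms)

subsection \<open>Scalar extension\<close>

text \<open>
  For a field homomorphism \<open>\<iota> : F \<rightarrow> K\<close>, \<open>dform_map \<iota>\<close> is the induced ring homomorphism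
  \<open>\<Omega>(F) \<rightarrow> \<Omega>(K)\<close>, see \<open>dform_map_D\<close> below.
\<close>

definition kaehler_map :: "('a::field \<Rightarrow> 'k::field) \<Rightarrow> 'a kaehler \<Rightarrow> 'k kaehler"
  where "kaehler_map \<iota> u = pm_sum (\<lambda>a c. kscale (\<iota> c) (kdiff (\<iota> a))) (rep_kaehler u)"

definition dform_map :: "('a::field \<Rightarrow> 'k::field) \<Rightarrow> 'a dform \<Rightarrow> 'k dform"
  where "dform_map \<iota> \<omega> =
    pm_sum (\<lambda>us c. form0 (\<iota> c) * wedge_list (map (kaehler_map \<iota>) us)) (rep_dform \<omega>)"

abbreviation field_embedding :: "('a::field \<Rightarrow> 'k::field) \<Rightarrow> bool"
  where "field_embedding \<iota> \<equiv> \<iota> \<in> ring_hom type_ring type_ring"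

lemma field_embeddingD:
  assumes "field_embedding \<iota>"
  shows "\<iota> (x + y) = \<iota> x + \<iota> y" "\<iota> (x * y) = \<iota> x * \<iota> y" "\<iota> 1 = 1" "\<iota> 0 = 0"
proof -
  show *: "\<iota> (x + y) = \<iota> x + \<iota> y" "\<iota> (x * y) = \<iota> x * \<iota> y" "\<iota> 1 = 1" for x y
    using assms by (auto simp: ring_hom_def)
  show "\<iota> 0 = 0" using *(1)[of 0 0] by (metis add_0 add_right_cancel)
qed

context
  fixes \<iota> :: "'a::field \<Rightarrow> 'k::field"
  assumes emb: "field_embedding \<iota>"
begin

private lemma kaehler_map_abs:
  "kaehler_map \<iota> (abs_kaehler f) = pm_sum (\<lambda>a c. kscale (\<iota> c) (kdiff (\<iota> a))) f"
  unfolding kaehler_map_def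
  by (rule kaehler_additive_lift)
     (simp_all add: field_embeddingD[OF emb] kaehler.scale_left_distrib kaehler.scale_right_distrib
        kdiff_add kdiff_mult)

private lemma kaehler_map_add: "kaehler_map \<iota> (u + v) = kaehler_map \<iota> u + kaehler_map \<iota> v"
proof -
  obtain f where f: "u = abs_kaehler f"
    by (rule that[OF Quotient3_abs_rep[OF Quotient3_kaehler, symmetric]])
  obtain g where g: "v = abs_kaehler g"
    by (rule that[OF Quotient3_abs_rep[OF Quotient3_kaehler, symmetric]])
  show ?thesis unfolding f g plus_kaehler.abs_eq kaehler_map_abs
    by (rule pm_sum_add) (simp_all add: field_embeddingD[OF emb] kaehler.scale_left_distrib)
qed

private lemma kaehler_map_scale: "kaehler_map \<iota> (kscale c u) = kscale (\<iota> c) (kaehler_map \<iota> u)"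
proof -
  obtain f where f: "u = abs_kaehler f"
    by (rule that[OF Quotient3_abs_rep[OF Quotient3_kaehler, symmetric]])
  show ?thesis unfolding f kscale.abs_eq kaehler_map_abs
  proof (induction f rule: pm_induct)
    case (add k e f)
    have "fscale c (Poly_Mapping.single k e) = Poly_Mapping.single k (c * e)"
      by (rule poly_mapping_eqI) (simp add: lookup_single when_def)
    with add show ?case
      by (simp add: free_vs.scale_right_distrib pm_sum_add pm_sum_single field_embeddingD[OF emb]
          kaehler.scale_left_distrib kaehler.scale_right_distrib)
  qed simp
qed

private lemma kaehler_map_kdiff: "kaehler_map \<iota> (kdiff a) = kdiff (\<iota> a)"
  by (simp add: kdiff.abs_eq[of a] kaehler_map_abs pm_sum_single field_embeddingD[OF emb])

private lemma dform_map_abs: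
  "dform_map \<iota> (abs_dform f) = pm_sum (\<lambda>us c. form0 (\<iota> c) * wedge_list (map (kaehler_map \<iota>) us)) f"
  unfolding dform_map_def
proof (rule dform_additive_lift, goal_cases)
  case (4 xs e u ys c)
  show ?case
    by (simp add: wedge_list_def kaehler_map_scale form1_scale form0_mult field_embeddingD[OF emb]
        mult.assoc form0_commute'[of "prod_list _"])
next
  case (5 xs u ys c)
  have "form1 v * (form1 v * z) = 0" for v :: "'k kaehler" and z
    by (simp add: form1_square flip: mult.assoc)
  thus ?case by (simp add: wedge_list_def)
qed (simp_all add: wedge_list_def kaehler_map_add form1_add form0_add field_embeddingD[OF emb]
       distrib_left distrib_right)

lemma dform_map_add: "dform_map \<iota> (\<omega> + \<eta>) = dform_map \<iota> \<omega> + dform_map \<iota> \<eta>"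
proof -
  obtain f where f: "\<omega> = abs_dform f"
    by (rule that[OF Quotient3_abs_rep[OF Quotient3_dform, symmetric]])
  obtain g where g: "\<eta> = abs_dform g"
    by (rule that[OF Quotient3_abs_rep[OF Quotient3_dform, symmetric]])
  show ?thesis unfolding f g plus_dform.abs_eq dform_map_abs
    by (rule pm_sum_add) (simp_all add: field_embeddingD[OF emb] form0_add distrib_right)
qed

lemma dform_map_form0: "dform_map \<iota> (form0 a) = form0 (\<iota> a)"
  by (simp add: form0.abs_eq[of a] dform_map_abs pm_sum_single field_embeddingD[OF emb] wedge_list_def)

lemma dform_map_D: "dform_map \<iota> (D a) = D (\<iota> a)"
  by (simp add: D_def form1_def[of "kdiff a"] dform_map_abs pm_sum_single field_embeddingD[OF emb]
      wedge_list_def kaehler_map_kdiff)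

lemma dform_map_mult: "dform_map \<iota> (\<omega> * \<eta>) = dform_map \<iota> \<omega> * dform_map \<iota> \<eta>"
proof -
  obtain f where f: "\<omega> = abs_dform f"
    by (rule that[OF Quotient3_abs_rep[OF Quotient3_dform, symmetric]])
  obtain g where g: "\<eta> = abs_dform g"
    by (rule that[OF Quotient3_abs_rep[OF Quotient3_dform, symmetric]])
  define m where "m = (\<lambda>us c. form0 (\<iota> c) * wedge_list (map (kaehler_map \<iota>) us))"
  have m: "m us 0 = 0" "m us (c + e) = m us c + m us e"
    "m (us @ vs) (c * e) = m us c * m vs e" for us vs c e
    by (simp_all add: m_def field_embeddingD[OF emb] form0_add distrib_right wedge_list_def form0_mult
          mult.assoc form0_commute'[of "prod_list _"])
  have 1: "pm_sum m (Poly_Mapping.single us c * g) = m us c * pm_sum m g" for us c g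
    by (induction g rule: pm_induct)
       (simp_all add: distrib_left pm_sum_add m pm_sum_single mult_single plus_list_def)
  have "pm_sum m (f * g) = pm_sum m f * pm_sum m g"
    by (induction f rule: pm_induct) (simp_all add: distrib_right pm_sum_add m pm_sum_single 1)
  thus ?thesis by (simp add: f g times_dform.abs_eq dform_map_abs m_def)
qed

end

subsection \<open>The exterior derivative\<close>

primrec wedge_d :: "('a::field kaehler \<Rightarrow> 'a dform) \<Rightarrow> 'a kaehler list \<Rightarrow> 'a dform"
  where
    "wedge_d \<delta> [] = 0"
  | "wedge_d \<delta> (u # us) = \<delta> u * wedge_list us - form1 u * wedge_d \<delta> us"

definition kaehler_d :: "'a::field kaehler \<Rightarrow> 'a dform"
  where "kaehler_d u = pm_sum (\<lambda>a c. D c * D a) (rep_kaehler u)"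

text \<open>
  The additive map with \<open>d(c da\<^sub>1 \<and> \<dots> \<and> da\<^sub>n) = dc \<and> da\<^sub>1 \<and> \<dots> \<and> da\<^sub>n\<close>, see \<open>ext_d_unique\<close>.
\<close>

definition ext_d :: "'a::field dform \<Rightarrow> 'a dform"
  where "ext_d \<omega> = pm_sum (\<lambda>us c. D c * wedge_list us + form0 c * wedge_d kaehler_d us) (rep_dform \<omega>)"

lemma D_0 [simp]: "D 0 = 0"
  using D_add[of 0 0] by simp

lemma D_1 [simp]: "D 1 = 0"
  using D_mult[of 1 1] by simp

lemma form1_anticommute: "form1 u * form1 v = - (form1 v * form1 u)"
proof -
  have "0 = form1 (u + v) * form1 (u + v)" by (simp add: form1_square)
  also have "\<dots> = form1 u * form1 v + form1 v * form1 u"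
    by (simp add: form1_add distrib_left distrib_right form1_square)
  finally show ?thesis by (simp add: eq_neg_iff_add_eq_0)
qed

lemma D_square [simp]: "D a * D a = 0"
  by (simp add: D_def form1_square)

lemma D_anticommute: "D a * D b = - (D b * D a)"
  by (simp add: D_def form1_anticommute[of "kdiff a"])

lemma form1_D: "form1 u * D b = - (D b * form1 u)"
  by (simp add: D_def form1_anticommute[of u])

lemma form1_D': "form1 u * (D b * z) = - (D b * (form1 u * z))"
  by (simp add: form1_D flip: mult.assoc)

lemma kaehler_d_abs: "kaehler_d (abs_kaehler f) = pm_sum (\<lambda>a c. D c * D a) f"
  unfolding kaehler_d_def
proof (rule kaehler_additive_lift, goal_cases)
  case (4 a b c)
  have "D a * (form0 c * D b) = - (form0 c * (D b * D a))"
    by (simp add: form0_commute'[of "D a"] D_anticommute[of a b])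
  thus ?case 
    by (simp add: D_mult distrib_left distrib_right mult.assoc form0_commute'[of "D _"])
qed (simp_all add: D_add distrib_left distrib_right)

lemma kaehler_d_add: "kaehler_d (u + v) = kaehler_d u + kaehler_d v"
proof -
  obtain f where f: "u = abs_kaehler f"
    by (rule that[OF Quotient3_abs_rep[OF Quotient3_kaehler, symmetric]])
  obtain g where g: "v = abs_kaehler g"
    by (rule that[OF Quotient3_abs_rep[OF Quotient3_kaehler, symmetric]])
  show ?thesis unfolding f g plus_kaehler.abs_eq kaehler_d_abs
    by (rule pm_sum_add) (simp_all add: D_add distrib_right)
qed

lemma kaehler_d_kdiff: "kaehler_d (kdiff a) = 0"
  by (simp add: kdiff.abs_eq[of a] kaehler_d_abs pm_sum_single)

lemma fscale_single: "fscale c (Poly_Mapping.single k e) = Poly_Mapping.single k (c * e)"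
  by (rule poly_mapping_eqI) (simp add: lookup_single when_def)

lemma kaehler_d_scale: "kaehler_d (kscale c u) = D c * form1 u + form0 c * kaehler_d u"
proof -
  obtain f where f: "u = abs_kaehler f"
    by (rule that[OF Quotient3_abs_rep[OF Quotient3_kaehler, symmetric]])
  have "kaehler_d (kscale c (abs_kaehler f)) = D c * form1 (abs_kaehler f) + form0 c * kaehler_d (abs_kaehler f)"
    unfolding kscale.abs_eq kaehler_d_abs
  proof (induction f rule: pm_induct)
    case zero
    show ?case by (simp add: form1_0 flip: zero_kaehler.abs_eq)
  next
    case (add k e f)
    have "abs_kaehler (Poly_Mapping.single k e + f) = kscale e (kdiff k) + abs_kaehler f"
      by (simp add: abs_kaehler_conv_pm_sum pm_sum_add pm_sum_single kaehler.scale_left_distrib)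
    with add show ?case
      by (simp add: free_vs.scale_right_distrib fscale_single pm_sum_add pm_sum_single D_add D_mult
          form1_add form1_scale distrib_left distrib_right mult.assoc form0_commute'[of "D c"]
          flip: D_def)
  qed
  thus ?thesis by (simp add: f)
qed

lemma kaehler_d_commute: "form1 v * kaehler_d u = kaehler_d u * form1 v"
proof -
  obtain f where f: "u = abs_kaehler f"
    by (rule that[OF Quotient3_abs_rep[OF Quotient3_kaehler, symmetric]])
  show ?thesis unfolding f kaehler_d_abs
    by (induction f rule: pm_induct)
       (simp_all add: pm_sum_add pm_sum_single D_add distrib_left distrib_right mult.assoc
          form1_D form1_D')
qed

lemma wedge_list_append: "wedge_list (us @ vs) = wedge_list us * wedge_list vs"
  by (simp add: wedge_list_def)

lemma wedge_list_Cons: "wedge_list (u # us) = form1 u * wedge_list us"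
  by (simp add: wedge_list_def)

lemma wedge_list_square: "wedge_list (xs @ u # u # ys) = 0"
proof -
  have "form1 u * (form1 u * z) = 0" for z
    by (simp add: form1_square flip: mult.assoc)
  thus ?thesis by (simp add: wedge_list_def)
qed

lemma wedge_list_scale: "wedge_list (xs @ kscale e u # ys) = form0 e * wedge_list (xs @ u # ys)"
  by (simp add: wedge_list_def form1_scale mult.assoc form0_commute'[of "prod_list _"])

lemma wedge_list_add: "wedge_list (xs @ (u + v) # ys) = wedge_list (xs @ u # ys) + wedge_list (xs @ v # ys)"
  by (simp add: wedge_list_def form1_add distrib_left distrib_right)

lemma wedge_d_add:
  "wedge_d kaehler_d (xs @ (u + v) # ys) = wedge_d kaehler_d (xs @ u # ys) + wedge_d kaehler_d (xs @ v # ys)"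
  by (induction xs) (simp_all add: kaehler_d_add form1_add wedge_list_add distrib_left distrib_right)

lemma wedge_d_scale:
  "wedge_d kaehler_d (xs @ kscale e u # ys) =
     D e * wedge_list (xs @ u # ys) + form0 e * wedge_d kaehler_d (xs @ u # ys)"
proof (induction xs)
  case Nil
  show ?case
    by (simp add: kaehler_d_scale form1_scale wedge_list_Cons distrib_right right_diff_distrib mult.assoc)
next
  case (Cons x xs)
  show ?case
    by (simp add: Cons wedge_list_scale wedge_list_Cons distrib_left right_diff_distrib mult.assoc
        form0_commute'[of "form1 _"] form0_commute'[of "kaehler_d _"] form1_D')
qed

lemma wedge_d_square: "wedge_d kaehler_d (xs @ u # u # ys) = 0"
proof (induction xs)
  case Nil
  have "form1 u * (form1 u * z) = 0" for z
    by (simp add: form1_square flip: mult.assoc)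
  moreover have "form1 u * (kaehler_d u * z) = kaehler_d u * (form1 u * z)" for z
    by (simp add: kaehler_d_commute flip: mult.assoc)
  ultimately show ?case by (simp add: wedge_list_Cons right_diff_distrib)
qed (simp add: wedge_list_square)

lemma ext_d_abs:
  "ext_d (abs_dform f) = pm_sum (\<lambda>us c. D c * wedge_list us + form0 c * wedge_d kaehler_d us) f"
  unfolding ext_d_def
proof (rule dform_additive_lift, goal_cases)
  case (4 xs e u ys c)
  show ?case
    by (simp add: wedge_list_scale wedge_d_scale D_mult form0_mult distrib_left distrib_right
        mult.assoc form0_commute'[of "D _"])
qed (simp_all add: wedge_list_add wedge_d_add wedge_list_square wedge_d_square D_add form0_add
       distrib_left distrib_right)

lemma ext_d_add: "ext_d (\<omega> + \<eta>) = ext_d \<omega> + ext_d \<eta>"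
proof -
  obtain f where f: "\<omega> = abs_dform f"
    by (rule that[OF Quotient3_abs_rep[OF Quotient3_dform, symmetric]])
  obtain g where g: "\<eta> = abs_dform g"
    by (rule that[OF Quotient3_abs_rep[OF Quotient3_dform, symmetric]])
  show ?thesis unfolding f g plus_dform.abs_eq ext_d_abs
    by (rule pm_sum_add) (simp_all add: D_add form0_add distrib_left distrib_right)
qed

lemma prod_list_D: "prod_list (map D as) = wedge_list (map kdiff as)"
  by (induction as) (simp_all add: wedge_list_def D_def)

lemma ext_d_monomial: "ext_d (form0 c * prod_list (map D as)) = D c * prod_list (map D as)"
proof -
  have "wedge_d kaehler_d (map kdiff as) = 0"
    by (induction as) (simp_all add: kaehler_d_kdiff)
  thus ?thesis
    by (simp add: prod_list_D ext_d_abs pm_sum_single flip: abs_dform_single)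
qed

lemma ext_d_unique:
  assumes "\<And>\<omega> \<eta>. \<delta> (\<omega> + \<eta>) = \<delta> \<omega> + \<delta> \<eta>"
    and "\<And>c as. \<delta> (form0 c * prod_list (map D as)) = D c * prod_list (map D as)"
  shows "\<delta> = ext_d"
  by (rule ext, rule dform_additive_eqI) (simp_all add: assms ext_d_add ext_d_monomial)

subsection \<open>Artin--Schreier map, kernels and annihilators\<close>

text \<open>\<open>d\<Omega>\<^sup>n\<^sup>-\<^sup>1(F)\<close>, which is \<open>0\<close> for \<open>n = 0\<close>.\<close>

definition exact_forms :: "nat \<Rightarrow> 'a::field dform set"
  where "exact_forms n = (if n = 0 then {0} else ext_d ` Omega (n - 1))"

definition dlog :: "'a::field \<Rightarrow> 'a dform"
  where "dlog a = form0 (inverse a) * D a"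

text \<open>
  Elements of \<open>\<Omega>\<^sup>n(F) / d\<Omega>\<^sup>n\<^sup>-\<^sup>1(F)\<close> are cosets \<open>\<omega> +o exact_forms n\<close>, added as sets.
\<close>

definition is_artin_schreier :: "nat \<Rightarrow> ('a::field dform \<Rightarrow> 'a dform set) \<Rightarrow> bool"
  where "is_artin_schreier n f \<longleftrightarrow>
    f \<in> Omega n \<rightarrow>\<^sub>E (\<lambda>\<omega>. \<omega> +o exact_forms n) ` Omega n \<and>
    (\<forall>\<omega>\<in>Omega n. \<forall>\<eta>\<in>Omega n. f (\<omega> + \<eta>) = f \<omega> + f \<eta>) \<and>
    (\<forall>x as. length as = n \<and> 0 \<notin> set as \<longrightarrow>
       f (form0 x * prod_list (map dlog as)) =
       (form0 (x ^ CHAR('a) - x) * prod_list (map dlog as)) +o exact_forms n)"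

text \<open>
  The map is unique because \<open>\<Omega>\<^sup>n(F)\<close> is additively generated by the logarithmic monomials (and it
  is taken to be extensional); in positive characteristic it exists, namely as the inverse Cartier
  operator minus the identity.
\<close>

definition artin_schreier :: "nat \<Rightarrow> 'a::field dform \<Rightarrow> 'a dform set"
  where "artin_schreier n = (THE f. is_artin_schreier n f)"

definition nu :: "nat \<Rightarrow> 'a::field dform set"
  where "nu n = {\<omega> \<in> Omega n. artin_schreier n \<omega> = exact_forms n}"

definition Omega_ker :: "nat \<Rightarrow> ('a::field \<Rightarrow> 'k::field) \<Rightarrow> 'a dform set"
  where "Omega_ker n \<iota> = {\<omega> \<in> Omega n. dform_map \<iota> \<omega> = 0}"

definition nu_ker :: "nat \<Rightarrow> ('a::field \<Rightarrow> 'k::field) \<Rightarrow> 'a dform set"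
  where "nu_ker n \<iota> = Omega_ker n \<iota> \<inter> nu n"

definition Ann_Omega :: "nat \<Rightarrow> 'a::field dform set \<Rightarrow> 'a dform set"
  where "Ann_Omega n U = {\<omega> \<in> Omega n. \<forall>u\<in>U. \<omega> * u = 0}"

definition Ann_nu :: "nat \<Rightarrow> 'a::field dform set \<Rightarrow> 'a dform set"
  where "Ann_nu n U = Ann_Omega n U \<inter> nu n"

text \<open>\<open>dS\<^sub>1 \<and> \<dots> \<and> dS\<^sub>m\<close>; for \<open>m = 0\<close> this is \<open>{1}\<close>.\<close>

definition d_wedge_sets :: "nat \<Rightarrow> (nat \<Rightarrow> 'a::field set) \<Rightarrow> 'a dform set"
  where "d_wedge_sets m S =
    {prod_list (map (\<lambda>i. D (t i)) [1..<Suc m]) | t. \<forall>i\<in>{1..m}. t i \<in> S i}"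

section \<open>\<open>p\<close>-forms\<close>

text \<open>
  With respect to a basis, a \<open>p\<close>-form \<open>\<phi>\<close> becomes \<open>v \<mapsto> \<Sum>c\<^sub>j v\<^sub>j\<^sup>p\<close> on coordinate vectors.
  The form \<open>\<langle>c\<^sub>0, \<dots>, c\<^sub>m\<^sub>-\<^sub>1\<rangle>\<^sub>p\<close> is given by its list of coefficients.  The first
  argument \<open>E\<close> of the operations below is a subfield of \<open>'k\<close> containing the coefficients, over which
  the form is considered; \<open>p = CHAR('k)\<close>.
\<close>

definition pform_eval :: "'k::field list \<Rightarrow> (nat \<Rightarrow> 'k) \<Rightarrow> 'k"
  where "pform_eval cs v = (\<Sum>j<length cs. cs ! j * v j ^ CHAR('k))"

definition pform_values :: "'k::field set \<Rightarrow> 'k list \<Rightarrow> 'k set"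
  where "pform_values E cs = {pform_eval cs v | v. (\<forall>j. v j \<in> E) \<and> pform_eval cs v \<noteq> 0}"

definition pth_powers :: "'k::field set \<Rightarrow> 'k set"
  where "pth_powers E = (\<lambda>x. x ^ CHAR('k)) ` E"

definition norm_field :: "'k::field set \<Rightarrow> 'k list \<Rightarrow> 'k set"
  where "norm_field E cs = generate_field type_ring
    (pth_powers E \<union> {a / b | a b. a \<in> pform_values E cs \<and> b \<in> pform_values E cs})"

text \<open>\<open>ring.dim\<close> is a definite description; all degrees occurring below are finite.\<close>

definition ext_degree :: "'k::field set \<Rightarrow> 'k set \<Rightarrow> nat"
  where "ext_degree E L = ring.dim type_ring E L"

definition norm_degree :: "'k::field set \<Rightarrow> 'k list \<Rightarrow> nat"
  where "norm_degree E cs = ext_degree (pth_powers E) (norm_field E cs)"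

lemma pform_eval_scale:
  "pform_eval cs (\<lambda>j. c * v j) = c ^ CHAR('k) * pform_eval cs (v :: nat \<Rightarrow> 'k::field)"
  by (simp add: pform_eval_def sum_distrib_left power_mult_distrib mult_ac)

lemma pform_eval_add:
  assumes "CHAR('k::field) > 0"
  shows "pform_eval cs (\<lambda>j. u j + v j) = pform_eval cs u + pform_eval cs (v :: nat \<Rightarrow> 'k)"
  using freshmans_dream[OF prime_CHAR_semidom[OF assms]]
  by (simp add: pform_eval_def sum.distrib distrib_left)

section \<open>Function fields\<close>

text \<open>The polynomial ring \<open>E[X\<^sub>0, \<dots>, X\<^sub>m\<^sub>-\<^sub>1]\<close>; a monomial is a finitely supported exponent vector.\<close>

definition mpoly_ring :: "'k::field set \<Rightarrow> nat \<Rightarrow> ((nat \<Rightarrow>\<^sub>0 nat) \<Rightarrow>\<^sub>0 'k) ring"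
  where "mpoly_ring E m = type_ring
    \<lparr>carrier := {P. (\<forall>\<alpha>. Poly_Mapping.lookup P \<alpha> \<in> E) \<and>
                    (\<forall>\<alpha>\<in>Poly_Mapping.keys P. Poly_Mapping.keys \<alpha> \<subseteq> {..<m})}\<rparr>"

definition mpoly_const :: "'k::field \<Rightarrow> (nat \<Rightarrow>\<^sub>0 nat) \<Rightarrow>\<^sub>0 'k"
  where "mpoly_const c = Poly_Mapping.single 0 c"

definition pform_poly :: "'k::field list \<Rightarrow> (nat \<Rightarrow>\<^sub>0 nat) \<Rightarrow>\<^sub>0 'k"
  where "pform_poly cs =
    (\<Sum>j<length cs. Poly_Mapping.single (Poly_Mapping.single j CHAR('k)) (cs ! j))"

text \<open>\<open>L\<close> is the quotient field of the domain \<open>R\<close> via the embedding \<open>\<epsilon>\<close>.\<close>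

definition is_quotient_field :: "('r, 'e) ring_scheme \<Rightarrow> ('r \<Rightarrow> 'k::field) \<Rightarrow> 'k set \<Rightarrow> bool"
  where "is_quotient_field R \<epsilon> L \<longleftrightarrow>
    \<epsilon> \<in> ring_hom R type_ring \<and> inj_on \<epsilon> (carrier R) \<and>
    L = {\<epsilon> x / \<epsilon> y | x y. x \<in> carrier R \<and> y \<in> carrier R \<and> y \<noteq> \<zero>\<^bsub>R\<^esub>}"

text \<open>
  \<open>L\<close> is the function field \<open>E(\<phi>)\<close> of the form with coefficients \<open>cs\<close>, as an extension of \<open>E\<close>
  (the last conjunct in each branch says that the embedding is one over \<open>E\<close>).
\<close>

definition is_function_field :: "'k::field set \<Rightarrow> 'k list \<Rightarrow> 'k set \<Rightarrow> bool"
  where "is_function_field E cs L \<longleftrightarrow>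
    (let P = mpoly_ring E (length cs); I = PIdl\<^bsub>P\<^esub> (pform_poly cs)
     in if norm_degree E cs > 1
        then \<exists>\<epsilon>. is_quotient_field (P Quot I) \<epsilon> L \<and> (\<forall>c\<in>E. \<epsilon> (I +>\<^bsub>P\<^esub> mpoly_const c) = c)
        else \<exists>\<epsilon>. is_quotient_field P \<epsilon> L \<and> (\<forall>c\<in>E. \<epsilon> (mpoly_const c) = c))"

text \<open>
  \<open>\<iota> : F \<rightarrow> K\<close> is the iterated function field \<open>F(\<phi>\<^sub>1, \<dots>, \<phi>\<^sub>r)\<close>, i.e.\ \<open>K\<close> is the top of a tower
  \<open>F = L\<^sub>0 \<subseteq> \<dots> \<subseteq> L\<^sub>r\<close> with \<open>L\<^sub>i = L\<^sub>i\<^sub>-\<^sub>1(\<phi>\<^sub>i)\<close>.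
\<close>

definition is_iterated_function_field :: "('a::field \<Rightarrow> 'k::field) \<Rightarrow> 'a list list \<Rightarrow> bool"
  where "is_iterated_function_field \<iota> \<phi>s \<longleftrightarrow>
    field_embedding \<iota> \<and>
    (\<exists>L. L 0 = range \<iota> \<and> L (length \<phi>s) = UNIV \<and>
         (\<forall>i<length \<phi>s. is_function_field (L i) (map \<iota> (\<phi>s ! i)) (L (Suc i))))"

section \<open>Normalized systems of \<open>p\<close>-forms\<close>

text \<open>\<open>\<langle>1, a\<^sub>1, \<dots>, a\<^sub>m\<rangle>\<^sub>p\<close>\<close>

definition normalized_pform :: "nat \<Rightarrow> (nat \<Rightarrow> 'a::field) \<Rightarrow> 'a list"
  where "normalized_pform m a = 1 # map a [1..<Suc m]"

definition normalized_pforms :: "nat \<Rightarrow> (nat \<Rightarrow> nat) \<Rightarrow> (nat \<Rightarrow> nat \<Rightarrow> 'a::field) \<Rightarrow> 'a list list"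
  where "normalized_pforms r n a = map (\<lambda>i. normalized_pform (n i) (a i)) [1..<Suc r]"

text \<open>
  An algebraic closure of \<open>F(X\<^sub>i\<^sub>j | i, j \<in> \<nat>)\<close>, in which \<open>M\<close> and its \<open>p\<close>-th roots live.
\<close>

type_synonym 'a big = "(((nat \<times> nat) \<Rightarrow>\<^sub>0 nat) \<Rightarrow>\<^sub>0 'a) fract alg_closure"

definition big_const :: "'a::field \<Rightarrow> 'a big"
  where "big_const c = to_ac (Fract (Poly_Mapping.single 0 c) 1)"

definition big_var :: "nat \<Rightarrow> nat \<Rightarrow> 'a::field big"
  where "big_var i j = to_ac (Fract (Poly_Mapping.single (Poly_Mapping.single (i, j) 1) 1) 1)"

definition M_field :: "nat \<Rightarrow> (nat \<Rightarrow> nat) \<Rightarrow> 'a::field big set"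
  where "M_field r n = generate_field type_ring
    (range big_const \<union> {big_var i j | i j. i \<in> {1..r} \<and> j \<in> {1..n i}})"

definition T_elem :: "(nat \<Rightarrow> nat) \<Rightarrow> (nat \<Rightarrow> nat \<Rightarrow> 'a::field) \<Rightarrow> nat \<Rightarrow> 'a big"
  where "T_elem n a i = (\<Sum>j=1..n i. big_const (a i j) * big_var i j ^ CHAR('a))"

definition pth_root :: "'k::field \<Rightarrow> 'k"
  where "pth_root x = (THE y. y ^ CHAR('k) = x)"

text \<open>\<open>M(T\<^sub>1\<^sup>1\<^sup>/\<^sup>p, \<dots>, T\<^sub>t\<^sup>1\<^sup>/\<^sup>p)\<close>\<close>

definition MT_field :: "nat \<Rightarrow> (nat \<Rightarrow> nat) \<Rightarrow> (nat \<Rightarrow> nat \<Rightarrow> 'a::field) \<Rightarrow> nat \<Rightarrow> 'a big set"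
  where "MT_field r n a t = generate_field type_ring
    (M_field r n \<union> (\<lambda>i. pth_root (T_elem n a i)) ` {1..t})"

text \<open>
  Here \<open>\<phi>\<^sub>i = \<langle>1, a\<^sub>i\<^sub>1, \<dots>, a\<^sub>i\<^sub>n\<rangle>\<^sub>p\<close> with \<open>n = n\<^sub>i\<close>, for \<open>1 \<le> i \<le> r\<close>.  The conditions \<open>k\<^sub>i \<le> n\<^sub>i\<close> and
  \<open>s \<le> r\<close> follow from the others but are recorded so that the indices are visibly in range.
\<close>

definition normalized_system ::
  "nat \<Rightarrow> (nat \<Rightarrow> nat) \<Rightarrow> (nat \<Rightarrow> nat \<Rightarrow> 'a::field) \<Rightarrow> (nat \<Rightarrow> nat) \<Rightarrow> nat \<Rightarrow> bool"
  where "normalized_system r n a k s \<longleftrightarrow>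
    (\<forall>i\<in>{1..r}.
       n i \<ge> 1 \<and> k i \<le> n i \<and>
       norm_degree UNIV (normalized_pform (n i) (a i)) = CHAR('a) ^ k i \<and>
       norm_field UNIV (normalized_pform (n i) (a i)) =
         generate_field type_ring (pth_powers UNIV \<union> a i ` {1..k i})) \<and>
    s \<le> r \<and>
    ext_degree (M_field r n) (MT_field r n a r) = CHAR('a) ^ s \<and>
    MT_field r n a r = MT_field r n a s"

end

theory Submission
  imports Defs
begin

text \<open>
  A form \<open>\<omega> \<in> \<Omega>\<^sup>n(F)\<close> vanishes in \<open>\<Omega>\<^sup>n(K)\<close> iff it vanishes on all tuples of derivations \<open>F \<rightarrow> K\<close> that
  extend to \<open>K\<close>.  For \<open>K = F(\<phi>\<^sub>1, \<dots>, \<phi>\<^sub>t)\<close> with generic coordinates \<open>x\<^sub>i\<^sub>j\<close>, a derivation \<open>\<delta>\<close> extends iff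
  all functionals \<open>w\<^sub>i(\<delta>) = \<Sum>x\<^sub>i\<^sub>j\<^sup>p \<delta>(a\<^sub>i\<^sub>j)\<close> vanish: a derivation is extended coefficientwise to
  polynomials, and this respects the relation \<open>\<phi>\<^sub>i(X) = 0\<close> exactly when \<open>w\<^sub>i(\<delta>) = 0\<close>.  If
  \<open>w\<^sub>1, \<dots>, w\<^sub>s\<close> are independent and span all \<open>w\<^sub>i\<close>, then \<open>\<omega>\<close> vanishes on their common kernel iff
  \<open>w\<^sub>1 \<and> \<dots> \<and> w\<^sub>s \<and> \<omega> = 0\<close>; as the \<open>x\<^sub>i\<^sub>j\<^sup>p\<close> are independent over the preceding field of the tower,
  this splits into \<open>da\<^sub>1\<^sub>j\<^sub>1 \<and> \<dots> \<and> da\<^sub>s\<^sub>j\<^sub>s \<and> \<omega> = 0\<close> for all choices of indices.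

  By the same splitting, independence of the \<open>w\<^sub>i\<close> is a condition on the \<open>da\<^sub>i\<^sub>j\<close> in \<open>\<Omega>(F)\<close> alone.  It can
  therefore be read off from the tower \<open>M(T\<^sub>1\<^sup>1\<^sup>/\<^sup>p, \<dots>, T\<^sub>r\<^sup>1\<^sup>/\<^sup>p)\<close>: the degree hypothesis makes \<open>T\<^sub>i\<close> with
  \<open>i \<le> s\<close> a non-\<open>p\<close>-th power at its step, whence some derivation annihilating \<open>T\<^sub>1, \<dots>, T\<^sub>i\<^sub>-\<^sub>1\<close> does not
  annihilate it, while for \<open>i > s\<close> the root of \<open>T\<^sub>i\<close> is already present.
\<close>

section \<open>Alternating evaluation of differential forms\<close>

text \<open>That evaluations detect forms rests on a basis of Omega^1: its coordinate functionals,
  composed with d, are derivations, and finitely many of them suffice for a given form. The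
  coordinate x_i0 is absent from w_i because its coefficient is the constant 1; leaving it out is
  also what makes the remaining x_ij^p independent although phi_i(x) = 0, since a non-zero multiple
  of phi_i cannot be free of X_i0. The obstacle in the tower is that phi_i may acquire norm degree 1
  over an intermediate field and then imposes no relation. At that point every a_ij has become a
  p-th power, so w_i vanishes on all derivations of that field, and the extension criterion has the
  same form in both cases. The degree hypothesis enters through upper bounds: every step has degree
  at most p, so p^s leaves no slack in the first s steps. The expansion yields wedges over all n_i
  coefficients; the passage to the first k_i, and to the whole norm field, is the Leibniz rule
  together with d(x^p) = 0. The statements on nu_n arise by intersecting with nu_n.\<close>

text \<open>
  The exterior product of a functional with an alternating form, both taken as functions on
  (lists of) vectors; the recursion is the Laplace expansion along the first vector.
\<close>

fun wedge1 :: "('v \<Rightarrow> 'k) \<Rightarrow> ('v list \<Rightarrow> 'k) \<Rightarrow> 'v list \<Rightarrow> 'k::comm_ring_1" where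
  "wedge1 w f [] = 0"
| "wedge1 w f (v # vs) = w v * f vs - wedge1 w (\<lambda>l. f (v # l)) vs"

lemma wedge1_cong:
  assumes "\<And>v. v \<in> set vs \<Longrightarrow> w v = w' v" "\<And>l. set l \<subseteq> set vs \<Longrightarrow> f l = f' l"
  shows "wedge1 w f vs = wedge1 w' f' vs"
  using assms
proof (induction vs arbitrary: f f')
  case (Cons v vs)
  have "wedge1 w (\<lambda>l. f (v # l)) vs = wedge1 w' (\<lambda>l. f' (v # l)) vs"
    by (rule Cons.IH) (auto intro!: Cons.prems)
  moreover have "f vs = f' vs" by (rule Cons.prems) auto
  ultimately show ?case using Cons.prems(1)[of v] by simp
qed simp

lemma wedge1_add: "wedge1 w (\<lambda>l. f l + g l) vs = wedge1 w f vs + wedge1 w g vs"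
  by (induction vs arbitrary: f g) (auto simp: algebra_simps)

lemma wedge1_scale: "wedge1 w (\<lambda>l. c * f l) vs = c * wedge1 w f vs"
  by (induction w f vs rule: wedge1.induct) (auto simp: algebra_simps)

lemma wedge1_zero [simp]: "wedge1 w (\<lambda>l. 0) vs = 0"
  by (induction vs) auto

lemma wedge1_eq_0:
  assumes "\<And>l. set l \<subseteq> set vs \<Longrightarrow> f l = 0"
  shows "wedge1 w f vs = 0"
  using wedge1_cong[of vs w w f "\<lambda>_. 0"] assms by simp

lemma wedge1_uminus: "wedge1 w (\<lambda>l. - f l) vs = - wedge1 w f vs"
  using wedge1_scale[of w "-1" f vs] by simp

lemma wedge1_diff: "wedge1 w (\<lambda>l. f l - g l) vs = wedge1 w f vs - wedge1 w g vs"
  using wedge1_add[of w f "\<lambda>l. - g l" vs] by (simp add: wedge1_uminus)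

lemma wedge1_add_left: "wedge1 (\<lambda>v. w v + w' v) f vs = wedge1 w f vs + wedge1 w' f vs"
  by (induction w f vs rule: wedge1.induct) (auto simp: algebra_simps)

lemma wedge1_scale_left: "wedge1 (\<lambda>v. c * w v) f vs = c * wedge1 w f vs"
  by (induction w f vs rule: wedge1.induct) (auto simp: algebra_simps)

lemma wedge1_zero_left [simp]: "wedge1 (\<lambda>v. 0) f vs = 0"
  by (induction vs arbitrary: f) auto

lemma wedge1_sum_left: "wedge1 (\<lambda>v. \<Sum>j\<in>J. w j v) f vs = (\<Sum>j\<in>J. wedge1 (w j) f vs)"
  by (induction J rule: infinite_finite_induct) (auto simp: wedge1_add_left)

lemma wedge1_map: "wedge1 w f (map g vs) = wedge1 (\<lambda>v. w (g v)) (\<lambda>l. f (map g l)) vs"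
  by (induction vs arbitrary: f) auto

text \<open>In the expansion along the first vector \<open>v\<close>, the two contributions
  \<open>w v * wedge1 w f vs\<close> cancel; the rest is the same double product for
  \<open>\<lambda>l. f (v # l)\<close>.\<close>

lemma wedge1_square: "wedge1 w (wedge1 w f) vs = 0"
  by (induction vs arbitrary: f) (simp_all add: wedge1_diff wedge1_scale)

text \<open>Polarization: \<open>wedge1_square\<close> for the sum of \<open>w\<close> and
  \<open>w'\<close>, expanded.\<close>

lemma wedge1_anticommute: "wedge1 w (wedge1 w' f) vs = - wedge1 w' (wedge1 w f) vs"
proof -
  have "wedge1 (\<lambda>v. w v + w' v) (wedge1 (\<lambda>v. w v + w' v) f) vs = 0"
    by (rule wedge1_square)
  hence "wedge1 w (wedge1 w' f) vs + wedge1 w' (wedge1 w f) vs = 0"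
    by (simp add: wedge1_add_left wedge1_add wedge1_square wedge1_cong[OF refl wedge1_add_left])
  thus ?thesis by (simp add: eq_neg_iff_add_eq_0)
qed

text \<open>The unit of the exterior algebra as an evaluation. Degrees are told apart by the length
  of the argument list, hence the value 0 on non-empty lists.\<close>

abbreviation ev_const :: "'v list \<Rightarrow> 'k::comm_ring_1"
  where "ev_const \<equiv> (\<lambda>l. if l = [] then 1 else 0)"

definition ev_list :: "('v \<Rightarrow> 'k::comm_ring_1) list \<Rightarrow> 'v list \<Rightarrow> 'k"
  where "ev_list ws = foldr wedge1 ws ev_const"

lemma ev_list_simps [simp]:
  "ev_list [] = ev_const"
  "ev_list (w # ws) = wedge1 w (ev_list ws)"
  by (simp_all add: ev_list_def)



subsection \<open>Derivations\<close>

text \<open>Values are taken in an extension via \<iota>, so that the same notion covers derivations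
  F -> K (with \<open>E = UNIV\<close>) and derivations of subfields of one big field (with the
  identity for \<iota>).\<close>

definition derivation_on :: "('a::field \<Rightarrow> 'k::field) \<Rightarrow> 'a set \<Rightarrow> ('a \<Rightarrow> 'k) \<Rightarrow> bool"
  where "derivation_on \<iota> E \<delta> \<longleftrightarrow> (\<forall>x\<in>E. \<forall>y\<in>E.
    \<delta> (x + y) = \<delta> x + \<delta> y \<and> \<delta> (x * y) = \<iota> x * \<delta> y + \<iota> y * \<delta> x)"

abbreviation derivation :: "('a::field \<Rightarrow> 'k::field) \<Rightarrow> ('a \<Rightarrow> 'k) \<Rightarrow> bool"
  where "derivation \<iota> \<equiv> derivation_on \<iota> UNIV"

lemma derivation_on_add: "derivation_on \<iota> E \<delta> \<Longrightarrow> x \<in> E \<Longrightarrow> y \<in> E \<Longrightarrow> \<delta> (x + y) = \<delta> x + \<delta> y"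
  and derivation_on_mult: "derivation_on \<iota> E \<delta> \<Longrightarrow> x \<in> E \<Longrightarrow> y \<in> E \<Longrightarrow> \<delta> (x * y) = \<iota> x * \<delta> y + \<iota> y * \<delta> x"
  by (auto simp: derivation_on_def)

text \<open>The linear functional on Omega^1(F) given by the universal property of Kaehler
  differentials, read off a chosen representative. Independence of the choice, for derivations, is
  \<open>lift_der_abs\<close>.\<close>

definition lift_der :: "('a::field \<Rightarrow> 'k::field) \<Rightarrow> ('a \<Rightarrow> 'k) \<Rightarrow> 'a kaehler \<Rightarrow> 'k"
  where "lift_der \<iota> \<delta> u = pm_sum (\<lambda>a c. \<iota> c * \<delta> a) (rep_kaehler u)"

text \<open>\<open>ev \<iota> \<omega> [\<delta>\<^sub>1, \<dots>, \<delta>\<^sub>n] = \<omega>(\<delta>\<^sub>1, \<dots>, \<delta>\<^sub>n)\<close>, which is \<open>0\<close> if \<open>\<omega>\<close> is homogeneous of degree other than \<open>n\<close>.\<close>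

definition ev :: "('a::field \<Rightarrow> 'k::field) \<Rightarrow> 'a dform \<Rightarrow> ('a \<Rightarrow> 'k) list \<Rightarrow> 'k"
  where "ev \<iota> \<omega> \<delta>s =
    pm_sum (\<lambda>us c. \<iota> c * ev_list (map (\<lambda>u \<delta>. lift_der \<iota> \<delta> u) us) \<delta>s) (rep_dform \<omega>)"

lemma abs_kaehler_cases: obtains f where "u = abs_kaehler f"
  by (rule that[OF Quotient3_abs_rep[OF Quotient3_kaehler, symmetric]])

lemma abs_dform_cases: obtains f where "\<omega> = abs_dform f"
  by (rule that[OF Quotient3_abs_rep[OF Quotient3_dform, symmetric]])

context
  fixes \<iota> :: "'a::field \<Rightarrow> 'k::field"
  assumes emb: "field_embedding \<iota>"
begin

lemma lift_der_abs:
  assumes "derivation \<iota> \<delta>"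
  shows "lift_der \<iota> \<delta> (abs_kaehler f) = pm_sum (\<lambda>a c. \<iota> c * \<delta> a) f"
  unfolding lift_der_def
  by (rule kaehler_additive_lift)
     (use assms in \<open>simp_all add: field_embeddingD[OF emb] derivation_on_def algebra_simps\<close>)

lemma lift_der_add:
  assumes "derivation \<iota> \<delta>"
  shows "lift_der \<iota> \<delta> (u + v) = lift_der \<iota> \<delta> u + lift_der \<iota> \<delta> v"
proof -
  obtain f where f: "u = abs_kaehler f" by (rule abs_kaehler_cases)
  obtain g where g: "v = abs_kaehler g" by (rule abs_kaehler_cases)
  show ?thesis unfolding f g plus_kaehler.abs_eq lift_der_abs[OF assms]
    by (rule pm_sum_add) (simp_all add: field_embeddingD[OF emb] algebra_simps)
qed

lemma lift_der_scale:
  assumes "derivation \<iota> \<delta>"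
  shows "lift_der \<iota> \<delta> (kscale c u) = \<iota> c * lift_der \<iota> \<delta> u"
proof -
  obtain f where f: "u = abs_kaehler f" by (rule abs_kaehler_cases)
  show ?thesis unfolding f kscale.abs_eq lift_der_abs[OF assms]
    by (induction f rule: pm_induct)
       (simp_all add: free_vs.scale_right_distrib fscale_single pm_sum_add pm_sum_single
         field_embeddingD[OF emb] distrib_left distrib_right mult.assoc)
qed

lemma lift_der_kdiff:
  assumes "derivation \<iota> \<delta>"
  shows "lift_der \<iota> \<delta> (kdiff a) = \<delta> a"
  by (simp add: kdiff.abs_eq[of a] lift_der_abs[OF assms] pm_sum_single field_embeddingD[OF emb])

text \<open>Well-definedness on the exterior algebra: additivity and homogeneity in each letter come
  from the linearity of \<open>lift_der\<close> at derivations, and a repeated letter is killed by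
  \<open>wedge1_square\<close>.\<close>

lemma ev_abs:
  assumes "set \<delta>s \<subseteq> Collect (derivation \<iota>)"
  shows "ev \<iota> (abs_dform f) \<delta>s =
    pm_sum (\<lambda>us c. \<iota> c * ev_list (map (\<lambda>u \<delta>. lift_der \<iota> \<delta> u) us) \<delta>s) f"
proof -
  let ?e = "\<lambda>us. ev_list (map (\<lambda>u \<delta>. lift_der \<iota> \<delta> u) us)"
  have add: "?e (xs @ (u + v) # ys) \<delta>s = ?e (xs @ u # ys) \<delta>s + ?e (xs @ v # ys) \<delta>s"
    if "set \<delta>s \<subseteq> Collect (derivation \<iota>)" for xs u v ys \<delta>s
    using that
  proof (induction xs arbitrary: \<delta>s)
    case Nil
    have "?e ((u + v) # ys) \<delta>s = wedge1 (\<lambda>\<delta>. lift_der \<iota> \<delta> u + lift_der \<iota> \<delta> v) (?e ys) \<delta>s"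
      unfolding list.map ev_list_simps by (rule wedge1_cong) (use Nil in \<open>auto simp: lift_der_add\<close>)
    thus ?case by (simp add: wedge1_add_left)
  next
    case (Cons x xs)
    have "?e (x # (xs @ (u + v) # ys)) \<delta>s =
        wedge1 (\<lambda>\<delta>. lift_der \<iota> \<delta> x) (\<lambda>l. ?e (xs @ u # ys) l + ?e (xs @ v # ys) l) \<delta>s"
      unfolding list.map ev_list_simps
      by (rule wedge1_cong[OF refl]) (rule Cons.IH, use Cons.prems in auto)
    thus ?case by (simp add: wedge1_add)
  qed
  have scale: "?e (xs @ kscale c u # ys) \<delta>s = \<iota> c * ?e (xs @ u # ys) \<delta>s"
    if "set \<delta>s \<subseteq> Collect (derivation \<iota>)" for xs u c ys \<delta>s
    using that
  proof (induction xs arbitrary: \<delta>s)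
    case Nil
    have "?e (kscale c u # ys) \<delta>s = wedge1 (\<lambda>\<delta>. \<iota> c * lift_der \<iota> \<delta> u) (?e ys) \<delta>s"
      unfolding list.map ev_list_simps by (rule wedge1_cong) (use Nil in \<open>auto simp: lift_der_scale\<close>)
    thus ?case by (simp add: wedge1_scale_left)
  next
    case (Cons x xs)
    have "?e (x # (xs @ kscale c u # ys)) \<delta>s =
        wedge1 (\<lambda>\<delta>. lift_der \<iota> \<delta> x) (\<lambda>l. \<iota> c * ?e (xs @ u # ys) l) \<delta>s"
      unfolding list.map ev_list_simps
      by (rule wedge1_cong[OF refl]) (rule Cons.IH, use Cons.prems in auto)
    thus ?case by (simp add: wedge1_scale)
  qed
  have sq: "?e (xs @ u # u # ys) \<delta>s = 0" for xs u ys \<delta>s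
    by (induction xs arbitrary: \<delta>s) (auto simp: wedge1_square intro: wedge1_eq_0)
  show ?thesis
    unfolding ev_def
    by (rule dform_additive_lift)
       (simp_all add: field_embeddingD[OF emb] algebra_simps add[OF assms, simplified]
          scale[OF assms, simplified] sq[simplified])
qed

context
  fixes \<delta>s :: "('a \<Rightarrow> 'k) list"
  assumes der: "set \<delta>s \<subseteq> Collect (derivation \<iota>)"
begin

lemma ev_add: "ev \<iota> (\<omega> + \<eta>) \<delta>s = ev \<iota> \<omega> \<delta>s + ev \<iota> \<eta> \<delta>s"
proof -
  obtain f where f: "\<omega> = abs_dform f" by (rule abs_dform_cases)
  obtain g where g: "\<eta> = abs_dform g" by (rule abs_dform_cases)
  show ?thesis unfolding f g plus_dform.abs_eq ev_abs[OF der]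
    by (rule pm_sum_add) (simp_all add: field_embeddingD[OF emb] algebra_simps)
qed

lemma ev_1: "ev \<iota> 1 \<delta>s = ev_const \<delta>s"
  by (simp add: one_dform.abs_eq ev_abs[OF der] pm_sum_single field_embeddingD[OF emb]
       zero_list_def flip: single_one)

lemma ev_form0: "ev \<iota> (form0 c * \<omega>) \<delta>s = \<iota> c * ev \<iota> \<omega> \<delta>s"
proof -
  obtain f where f: "\<omega> = abs_dform f" by (rule abs_dform_cases)
  show ?thesis unfolding f form0.abs_eq times_dform.abs_eq ev_abs[OF der]
    by (induction f rule: pm_induct)
       (simp_all add: pm_sum_add pm_sum_single mult_single plus_list_def distrib_left
         field_embeddingD[OF emb] mult.assoc distrib_right)
qed

lemma ev_0: "ev \<iota> 0 \<delta>s = 0"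
  using ev_form0[of 0 0] by (simp add: field_embeddingD[OF emb])

lemma ev_form1: "ev \<iota> (form1 u * \<omega>) \<delta>s = wedge1 (\<lambda>\<delta>. lift_der \<iota> \<delta> u) (ev \<iota> \<omega>) \<delta>s"
proof -
  obtain f where f: "\<omega> = abs_dform f" by (rule abs_dform_cases)
  have *: "wedge1 (\<lambda>\<delta>. lift_der \<iota> \<delta> u) (ev \<iota> (abs_dform f)) \<delta>s =
    wedge1 (\<lambda>\<delta>. lift_der \<iota> \<delta> u)
      (\<lambda>\<delta>s. pm_sum (\<lambda>us c. \<iota> c * ev_list (map (\<lambda>u \<delta>. lift_der \<iota> \<delta> u) us) \<delta>s) f) \<delta>s"
    by (rule wedge1_cong[OF refl], rule ev_abs) (use der in auto)
  show ?thesis unfolding f * unfolding form1_def times_dform.abs_eq ev_abs[OF der]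
  proof (induction f rule: pm_induct)
    case (add us c f)
    let ?h = "\<lambda>\<delta>s us c. \<iota> c * ev_list (map (\<lambda>u \<delta>. lift_der \<iota> \<delta> u) us) \<delta>s"
    have a: "pm_sum (?h \<delta>s) (f + g) = pm_sum (?h \<delta>s) f + pm_sum (?h \<delta>s) g" for f g \<delta>s
      by (rule pm_sum_add) (simp_all add: field_embeddingD[OF emb] algebra_simps)
    have b: "pm_sum (?h \<delta>s) (Poly_Mapping.single us c) = ?h \<delta>s us c" for \<delta>s us c
      by (rule pm_sum_single) (simp add: field_embeddingD[OF emb])
    show ?case
      by (simp add: distrib_left a b add wedge1_add wedge1_scale mult_single plus_list_def)
  qed simp
qed

lemma ev_D: "ev \<iota> (D a * \<omega>) \<delta>s = wedge1 (\<lambda>\<delta>. \<delta> a) (ev \<iota> \<omega>) \<delta>s"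
  unfolding D_def ev_form1 by (rule wedge1_cong) (use der in \<open>auto simp: lift_der_kdiff\<close>)

end

end

section \<open>Evaluation and change of field\<close>

lemma dform_ev_induct [consumes 0, case_names one D form0 add]:
  assumes "P 1" "\<And>a \<omega>. P \<omega> \<Longrightarrow> P (D a * \<omega>)" "\<And>c \<omega>. P \<omega> \<Longrightarrow> P (form0 c * \<omega>)"
    "\<And>\<omega> \<eta>. P \<omega> \<Longrightarrow> P \<eta> \<Longrightarrow> P (\<omega> + \<eta>)"
  shows "P (\<omega> :: 'a::field dform)"
proof (induction \<omega> rule: dform_induct)
  case zero
  show ?case using assms(3)[OF assms(1), of 0] by simp
next
  case (add c as \<omega>)
  have "P (prod_list (map D as))" by (induction as) (auto intro: assms)
  thus ?case by (intro assms add)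
qed

lemma embedding_id: "field_embedding (\<lambda>x. x)"
  by (simp add: ring_hom_def)

text \<open>Evaluating the image of a form in Omega(K) only sees the restrictions to F of
  derivations of K. This turns membership in the kernel into a question of extending
  derivations.\<close>

lemma ev_dform_map:
  fixes \<iota> :: "'a::field \<Rightarrow> 'k::field"
  assumes emb: "field_embedding \<iota>" and der: "set \<delta>s \<subseteq> Collect (derivation (\<lambda>x. x))"
  shows "ev (\<lambda>x. x) (dform_map \<iota> \<omega>) \<delta>s = ev \<iota> \<omega> (map (\<lambda>\<delta> a. \<delta> (\<iota> a)) \<delta>s)"
  using der
proof (induction \<omega> arbitrary: \<delta>s rule: dform_ev_induct)
  case one
  have *: "set (map (\<lambda>\<delta> a. \<delta> (\<iota> a)) \<delta>s) \<subseteq> Collect (derivation \<iota>)"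
    using one by (auto simp: derivation_on_def subset_iff field_embeddingD[OF emb])
  have "dform_map \<iota> 1 = 1" using dform_map_form0[OF emb, of 1] by (simp add: field_embeddingD[OF emb])
  thus ?case using ev_1[OF embedding_id one] ev_1[OF emb *] by (simp only: map_is_Nil_conv)
next
  case (D a \<omega>)
  have *: "set (map (\<lambda>\<delta> a. \<delta> (\<iota> a)) \<delta>s) \<subseteq> Collect (derivation \<iota>)"
    using D(2) by (auto simp: derivation_on_def subset_iff field_embeddingD[OF emb])
  show ?case
    unfolding dform_map_mult[OF emb] dform_map_D[OF emb] ev_D[OF embedding_id D(2)]
      ev_D[OF emb *] wedge1_map
    by (rule wedge1_cong, simp, rule D(1)) (use D(2) in blast)
next
  case (form0 c \<omega>)
  have *: "set (map (\<lambda>\<delta> a. \<delta> (\<iota> a)) \<delta>s) \<subseteq> Collect (derivation \<iota>)"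
    using form0(2) by (auto simp: derivation_on_def subset_iff field_embeddingD[OF emb])
  show ?case
    using ev_form0[OF embedding_id form0(2)] ev_form0[OF emb *] form0
    by (simp add: dform_map_mult[OF emb] dform_map_form0[OF emb])
next
  case (add \<omega> \<eta>)
  have *: "set (map (\<lambda>\<delta> a. \<delta> (\<iota> a)) \<delta>s) \<subseteq> Collect (derivation \<iota>)"
    using add(3) by (auto simp: derivation_on_def subset_iff field_embeddingD[OF emb])
  show ?case
    using ev_add[OF embedding_id add(3)] ev_add[OF emb *] add
    by (simp add: dform_map_add[OF emb])
qed

text \<open>On derivations with values in F the evaluation stays in the image of F; this is the
  bottom of the coefficient argument in \<open>foldr_comb_in_chain\<close>.\<close>

lemma ev_comp:
  fixes \<iota> :: "'a::field \<Rightarrow> 'k::field"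
  assumes emb: "field_embedding \<iota>" and der: "set \<delta>s \<subseteq> Collect (derivation (\<lambda>x. x))"
  shows "ev \<iota> \<omega> (map (\<lambda>\<delta> a. \<iota> (\<delta> a)) \<delta>s) = \<iota> (ev (\<lambda>x. x) \<omega> \<delta>s)"
  using der
proof (induction \<omega> arbitrary: \<delta>s rule: dform_ev_induct)
  case one
  have *: "set (map (\<lambda>\<delta> a. \<iota> (\<delta> a)) \<delta>s) \<subseteq> Collect (derivation \<iota>)"
    using one by (auto simp: derivation_on_def subset_iff field_embeddingD[OF emb])
  show ?case unfolding ev_1[OF embedding_id one] ev_1[OF emb *] by (simp add: field_embeddingD[OF emb])
next
  case (D a \<omega>)
  have *: "set (map (\<lambda>\<delta> a. \<iota> (\<delta> a)) \<delta>s) \<subseteq> Collect (derivation \<iota>)"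
    using D(2) by (auto simp: derivation_on_def subset_iff field_embeddingD[OF emb])
  have minus: "\<iota> (x - y) = \<iota> x - \<iota> y" for x y
    using field_embeddingD(1)[OF emb, of "x - y" y] by simp
  have w: "\<iota> (wedge1 w f l) = wedge1 (\<lambda>v. \<iota> (w v)) (\<lambda>l. \<iota> (f l)) l" for w f and l :: "('a \<Rightarrow> 'a) list"
    by (induction l arbitrary: f) (simp_all add: field_embeddingD[OF emb] minus)
  show ?case
    unfolding ev_D[OF embedding_id D(2)] ev_D[OF emb *] wedge1_map w
    by (rule wedge1_cong, simp, rule D(1)) (use D(2) in blast)
next
  case (form0 c \<omega>)
  have *: "set (map (\<lambda>\<delta> a. \<iota> (\<delta> a)) \<delta>s) \<subseteq> Collect (derivation \<iota>)"
    using form0(2) by (auto simp: derivation_on_def subset_iff field_embeddingD[OF emb])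
  show ?case
    using ev_form0[OF embedding_id form0(2)] ev_form0[OF emb *] form0
    by (simp add: field_embeddingD[OF emb])
next
  case (add \<omega> \<eta>)
  have *: "set (map (\<lambda>\<delta> a. \<iota> (\<delta> a)) \<delta>s) \<subseteq> Collect (derivation \<iota>)"
    using add(3) by (auto simp: derivation_on_def subset_iff field_embeddingD[OF emb])
  show ?case
    using ev_add[OF embedding_id add(3)] ev_add[OF emb *] add
    by (simp add: field_embeddingD[OF emb])
qed

subsection \<open>Derivations separate forms\<close>

text \<open>A coordinate functional on Omega^1, composed with the universal derivation, is again a
  derivation; these form the dual family of the basis \<open>B\<close>.\<close>

lemma derivation_representation:
  assumes B: "kaehler.independent B" "kaehler.span B = (UNIV :: 'a::field kaehler set)"
  shows "derivation (\<lambda>x. x) (\<lambda>a. kaehler.representation B (kdiff a) b)"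
    and "lift_der (\<lambda>x. x) (\<lambda>a. kaehler.representation B (kdiff a) b) u = kaehler.representation B u b"
proof -
  show der: "derivation (\<lambda>x. x) (\<lambda>a. kaehler.representation B (kdiff a) b)"
    using B by (simp add: derivation_on_def kdiff_add kdiff_mult kaehler.representation_add
        kaehler.representation_scale)
  obtain f where f: "u = abs_kaehler f" by (rule abs_kaehler_cases)
  show "lift_der (\<lambda>x. x) (\<lambda>a. kaehler.representation B (kdiff a) b) u = kaehler.representation B u b"
    unfolding f lift_der_abs[OF embedding_id der]
  proof (induction f rule: pm_induct)
    case zero
    show ?case by (simp add: kaehler.representation_zero flip: zero_kaehler.abs_eq)
  next
    case (add k c f)
    have "abs_kaehler (Poly_Mapping.single k c + f) = kscale c (kdiff k) + abs_kaehler f"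
      by (simp add: abs_kaehler_conv_pm_sum pm_sum_add pm_sum_single kaehler.scale_left_distrib)
    with add B show ?case
      by (simp add: pm_sum_add pm_sum_single kaehler.representation_add
          kaehler.representation_scale distrib_right)
  qed
qed

text \<open>The exterior algebra on the span of \<open>bs\<close>, in a normal form that splits off
  one generator at a time: for distinct letters, neither \<alpha> nor \<beta> in
  \<open>form1 b * \<alpha> + \<beta>\<close> involves \<open>b\<close>. For independent letters
  this allows \<alpha> and \<beta> to be recovered by evaluation.\<close>

primrec ext_gen :: "'a::field kaehler list \<Rightarrow> 'a dform set" where
  "ext_gen [] = range form0"
| "ext_gen (b # bs) = {form1 b * \<alpha> + \<beta> | \<alpha> \<beta>. \<alpha> \<in> ext_gen bs \<and> \<beta> \<in> ext_gen bs}"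

lemma ext_gen_ConsI:
  "\<alpha> \<in> ext_gen bs \<Longrightarrow> \<beta> \<in> ext_gen bs \<Longrightarrow> \<gamma> = form1 b * \<alpha> + \<beta> \<Longrightarrow> \<gamma> \<in> ext_gen (b # bs)"
  by auto

lemma ext_gen_form0: "form0 c \<in> ext_gen bs"
proof (induction bs arbitrary: c)
  case (Cons b bs)
  show ?case by (rule ext_gen_ConsI[OF Cons[of 0] Cons[of c]]) simp
qed simp

lemma ext_gen_add: "\<alpha> \<in> ext_gen bs \<Longrightarrow> \<beta> \<in> ext_gen bs \<Longrightarrow> \<alpha> + \<beta> \<in> ext_gen bs"
proof (induction bs arbitrary: \<alpha> \<beta>)
  case Nil
  thus ?case by (auto simp flip: form0_add)
next
  case (Cons b bs)
  from Cons.prems obtain \<alpha>1 \<alpha>2 \<beta>1 \<beta>2 where *: "\<alpha> = form1 b * \<alpha>1 + \<alpha>2" "\<beta> = form1 b * \<beta>1 + \<beta>2"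
    "\<alpha>1 \<in> ext_gen bs" "\<alpha>2 \<in> ext_gen bs" "\<beta>1 \<in> ext_gen bs" "\<beta>2 \<in> ext_gen bs" by auto
  show ?case
    by (rule ext_gen_ConsI[of "\<alpha>1 + \<beta>1" _ "\<alpha>2 + \<beta>2"]) (use Cons.IH * in \<open>auto simp: algebra_simps\<close>)
qed

lemma ext_gen_scale: "\<alpha> \<in> ext_gen bs \<Longrightarrow> form0 c * \<alpha> \<in> ext_gen bs"
proof (induction bs arbitrary: \<alpha>)
  case Nil
  thus ?case by (auto simp flip: form0_mult)
next
  case (Cons b bs)
  from Cons.prems obtain \<alpha>1 \<alpha>2 where *: "\<alpha> = form1 b * \<alpha>1 + \<alpha>2"
    "\<alpha>1 \<in> ext_gen bs" "\<alpha>2 \<in> ext_gen bs" by auto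
  show ?case
    by (rule ext_gen_ConsI[of "form0 c * \<alpha>1" _ "form0 c * \<alpha>2"])
      (use Cons.IH * in \<open>auto simp: distrib_left form0_commute'\<close>)
qed

lemma ext_gen_form1_base: "b \<in> set bs \<Longrightarrow> \<alpha> \<in> ext_gen bs \<Longrightarrow> form1 b * \<alpha> \<in> ext_gen bs"
proof (induction bs arbitrary: \<alpha>)
  case (Cons c bs)
  from Cons.prems obtain \<alpha>1 \<alpha>2 where *: "\<alpha> = form1 c * \<alpha>1 + \<alpha>2"
    "\<alpha>1 \<in> ext_gen bs" "\<alpha>2 \<in> ext_gen bs" by auto
  show ?case
  proof (cases "b = c")
    case True
    have "form1 b * \<alpha> = form1 c * \<alpha>2 + form0 0"
      by (simp add: * True distrib_left form1_square flip: mult.assoc)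
    thus ?thesis using * ext_gen_form0 by (intro ext_gen_ConsI)
  next
    case False
    have "form1 b * \<alpha> = - (form1 c * (form1 b * \<alpha>1)) + form1 b * \<alpha>2"
      by (simp add: * distrib_left form1_anticommute[of b c] flip: mult.assoc)
    also have "\<dots> = form1 c * (form0 (- 1) * (form1 b * \<alpha>1)) + form1 b * \<alpha>2"
    proof -
      have "form0 (- 1) = (- 1 :: 'a dform)"
        using form0_add[of 1 "- 1 :: 'a"] by (simp add: eq_neg_iff_add_eq_0 add.commute)
      thus ?thesis by simp
    qed
    finally have "form1 b * \<alpha> = form1 c * (form0 (- 1) * (form1 b * \<alpha>1)) + form1 b * \<alpha>2" .
    moreover have "form0 (- 1) * (form1 b * \<alpha>1) \<in> ext_gen bs" "form1 b * \<alpha>2 \<in> ext_gen bs"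
      using Cons False * by (auto intro: ext_gen_scale)
    ultimately show ?thesis by (intro ext_gen_ConsI)
  qed
qed simp

lemma ext_gen_0: "0 \<in> ext_gen bs"
  using ext_gen_form0[of 0 bs] by simp

lemma ext_gen_form1:
  assumes "u \<in> kaehler.span (set bs)" "\<alpha> \<in> ext_gen bs"
  shows "form1 u * \<alpha> \<in> ext_gen bs"
  using assms(1)
proof (induction rule: kaehler.span_induct_alt)
  case base
  thus ?case by (simp add: form1_0 ext_gen_0)
next
  case (step c x y)
  have "form1 (kscale c x + y) * \<alpha> = form0 c * (form1 x * \<alpha>) + form1 y * \<alpha>"
    by (simp add: form1_add form1_scale distrib_right mult.assoc)
  thus ?case
    using step assms(2) by (simp add: ext_gen_add ext_gen_scale ext_gen_form1_base)
qed

text \<open>A form involves only finitely many basis vectors. The conclusion quantifies over all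
  lists containing \<open>S\<close> so that the sets for two summands can be united.\<close>

lemma ext_gen_cover:
  assumes B: "kaehler.span B = (UNIV :: 'a::field kaehler set)"
  shows "\<exists>S. finite S \<and> S \<subseteq> B \<and> (\<forall>bs. S \<subseteq> set bs \<longrightarrow> \<omega> \<in> ext_gen bs)"
proof (induction \<omega> rule: dform_ev_induct)
  case one
  have "1 \<in> ext_gen bs" for bs :: "'a kaehler list" using ext_gen_form0[of 1 bs] by simp
  thus ?case by (intro exI[of _ "{}"]) simp
next
  case (D a \<omega>)
  then obtain S where S: "finite S" "S \<subseteq> B" "\<And>bs. S \<subseteq> set bs \<Longrightarrow> \<omega> \<in> ext_gen bs" by blast
  have "kdiff a \<in> kaehler.span B" using B by simp
  then obtain T where T: "finite T" "T \<subseteq> B" "kdiff a \<in> kaehler.span T"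
    unfolding kaehler.span_explicit by blast
  show ?case
  proof (intro exI[of _ "S \<union> T"] conjI allI impI)
    fix bs assume *: "S \<union> T \<subseteq> set bs"
    hence "kdiff a \<in> kaehler.span (set bs)"
      using T kaehler.span_mono[of T "set bs"] by auto
    thus "D a * \<omega> \<in> ext_gen bs"
      unfolding D_def using S(3)[of bs] * by (intro ext_gen_form1) auto
  qed (use S T in auto)
next
  case (form0 c \<omega>)
  then obtain S where S: "finite S" "S \<subseteq> B" "\<And>bs. S \<subseteq> set bs \<Longrightarrow> \<omega> \<in> ext_gen bs" by blast
  show ?case by (rule exI[of _ S]) (simp add: S ext_gen_scale)
next
  case (add \<omega> \<eta>)
  then obtain S T where "finite S" "S \<subseteq> B" "\<And>bs. S \<subseteq> set bs \<Longrightarrow> \<omega> \<in> ext_gen bs"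
    "finite T" "T \<subseteq> B" "\<And>bs. T \<subseteq> set bs \<Longrightarrow> \<eta> \<in> ext_gen bs" by blast
  thus ?case by (intro exI[of _ "S \<union> T"]) (simp add: ext_gen_add)
qed

text \<open>Every term of the Laplace expansion either applies \<open>w\<close> to \<open>x\<close>
  or applies \<open>f\<close> to a list that still contains \<open>x\<close>.\<close>

lemma wedge1_vanish:
  assumes "w x = 0" "x \<in> set vs" "\<And>l. set l \<subseteq> set vs \<Longrightarrow> x \<in> set l \<Longrightarrow> f l = 0"
  shows "wedge1 w f vs = 0"
  using assms(2,3)
proof (induction vs arbitrary: f)
  case (Cons v vs)
  show ?case
  proof (cases "v = x")
    case True
    have "wedge1 w (\<lambda>l. f (v # l)) vs = 0"
      by (rule wedge1_eq_0, rule Cons.prems(2)) (use True in auto)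
    thus ?thesis using True assms(1) by simp
  next
    case False
    hence "wedge1 w (\<lambda>l. f (v # l)) vs = 0"
      using Cons.prems(1) by (intro Cons.IH) (auto intro!: Cons.prems(2))
    moreover have "f vs = 0"
      using False Cons.prems(1) by (intro Cons.prems(2)) auto
    ultimately show ?thesis by simp
  qed
qed simp

text \<open>Write the form as \<open>form1 b * \<alpha> + \<beta>\<close> in terms of a basis.
  Evaluation with the dual derivation of \<open>b\<close> in front isolates \<alpha>, which vanishes
  by induction on the number of basis vectors; then \<beta> remains and vanishes likewise.\<close>

theorem ev_eq_0_imp:
  fixes \<omega> :: "'a::field dform"
  assumes "\<And>\<delta>s. set \<delta>s \<subseteq> Collect (derivation (\<lambda>x. x)) \<Longrightarrow> ev (\<lambda>x. x) \<omega> \<delta>s = 0"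
  shows "\<omega> = 0"
proof -
  obtain B :: "'a kaehler set" where B: "kaehler.independent B" "UNIV \<subseteq> kaehler.span B"
    using kaehler.maximal_independent_subset[of UNIV] by blast
  hence B': "kaehler.span B = UNIV" by blast
  define \<delta> where "\<delta> = (\<lambda>b a. kaehler.representation B (kdiff a) b)"
  have der: "derivation (\<lambda>x. x) (\<delta> b)" for b
    unfolding \<delta>_def by (rule derivation_representation[OF B(1) B'])
  have lift: "lift_der (\<lambda>x. x) (\<delta> b) u = kaehler.representation B u b" for b u
    unfolding \<delta>_def by (rule derivation_representation[OF B(1) B'])
  have lift_basis: "lift_der (\<lambda>x. x) (\<delta> b) c = (if c = b then 1 else 0)" if "c \<in> B" for b c
    using kaehler.representation_basis[OF B(1) that] by (simp add: lift)
  have rng: "set \<delta>s \<subseteq> range \<delta> \<Longrightarrow> set \<delta>s \<subseteq> Collect (derivation (\<lambda>x. x))" for \<delta>s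
    using der by auto
  note ev = ev_add[OF embedding_id rng] ev_form1[OF embedding_id rng] ev_0[OF embedding_id rng]
  have ev_form0': "ev (\<lambda>x. x) (form0 c) \<delta>s = c * ev_const \<delta>s" if "set \<delta>s \<subseteq> range \<delta>" for c \<delta>s
    using ev_form0[OF embedding_id rng[OF that], of c 1] ev_1[OF embedding_id rng[OF that]] by simp
  \<comment> \<open>This removes both \<beta> and the tail of the Laplace expansion when the dual
    derivation of \<open>b\<close> is put in front.\<close>
  have vanish: "ev (\<lambda>x. x) \<gamma> \<delta>s = 0"
    if "\<gamma> \<in> ext_gen bs" "set bs \<subseteq> B" "b \<notin> set bs" "set \<delta>s \<subseteq> range \<delta>" "\<delta> b \<in> set \<delta>s" for \<gamma> bs b \<delta>s
    using that
  proof (induction bs arbitrary: \<gamma> \<delta>s)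
    case Nil
    hence "ev_const \<delta>s = (0 :: 'a)" by auto
    thus ?case using Nil by (auto simp add: ev_form0' )
  next
    case (Cons c bs)
    then obtain \<alpha> \<beta> where *: "\<gamma> = form1 c * \<alpha> + \<beta>" "\<alpha> \<in> ext_gen bs" "\<beta> \<in> ext_gen bs" by auto
    have "wedge1 (\<lambda>\<delta>. lift_der (\<lambda>x. x) \<delta> c) (ev (\<lambda>x. x) \<alpha>) \<delta>s = 0"
    proof (rule wedge1_vanish[of _ "\<delta> b"])
      show "lift_der (\<lambda>x. x) (\<delta> b) c = 0" using Cons.prems by (auto simp: lift_basis)
      show "ev (\<lambda>x. x) \<alpha> l = 0" if "set l \<subseteq> set \<delta>s" "\<delta> b \<in> set l" for l
        using Cons.prems * that by (intro Cons.IH) auto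
    qed (use Cons.prems in auto)
    moreover have "ev (\<lambda>x. x) \<beta> \<delta>s = 0" using Cons.prems * by (intro Cons.IH) auto
    ultimately show ?case using Cons.prems by (simp add: * ev)
  qed
  have main: "\<gamma> = 0" if "\<gamma> \<in> ext_gen bs" "distinct bs" "set bs \<subseteq> B"
    "\<And>\<delta>s. set \<delta>s \<subseteq> \<delta> ` set bs \<Longrightarrow> ev (\<lambda>x. x) \<gamma> \<delta>s = 0" for \<gamma> bs
    using that
  proof (induction bs arbitrary: \<gamma>)
    case Nil
    then obtain c where c: "\<gamma> = form0 c" by auto
    have "c = 0" using Nil(4)[of "[]"] ev_form0'[of "[]" c] by (simp add: c)
    thus ?case by (simp add: c)
  next
    case (Cons b bs)
    then obtain \<alpha> \<beta> where *: "\<gamma> = form1 b * \<alpha> + \<beta>" "\<alpha> \<in> ext_gen bs" "\<beta> \<in> ext_gen bs" by auto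
    have "\<alpha> = 0"
    proof (rule Cons.IH)
      fix \<delta>s assume \<delta>s: "set \<delta>s \<subseteq> \<delta> ` set bs"
      hence \<delta>s': "set \<delta>s \<subseteq> range \<delta>" by auto
      have "ev (\<lambda>x. x) \<beta> (\<delta> b # \<delta>s) = 0"
        using Cons.prems * \<delta>s' by (intro vanish[of _ bs b]) auto
      moreover have "wedge1 (\<lambda>\<delta>. lift_der (\<lambda>x. x) \<delta> b) (\<lambda>l. ev (\<lambda>x. x) \<alpha> (\<delta> b # l)) \<delta>s = 0"
        using Cons.prems * \<delta>s' by (intro wedge1_eq_0 vanish[of _ bs b]) auto
      moreover have "ev (\<lambda>x. x) \<gamma> (\<delta> b # \<delta>s) = 0" using \<delta>s by (intro Cons.prems) auto
      ultimately show "ev (\<lambda>x. x) \<alpha> \<delta>s = 0"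
        using Cons.prems \<delta>s' by (simp add: * ev lift_basis)
    qed (use Cons.prems * in auto)
    hence \<gamma>: "\<gamma> = \<beta>" using * by simp
    have "\<beta> = 0"
    proof (rule Cons.IH)
      show "ev (\<lambda>x. x) \<beta> \<delta>s = 0" if "set \<delta>s \<subseteq> \<delta> ` set bs" for \<delta>s
        unfolding \<gamma>[symmetric] using that by (intro Cons.prems(4)) auto
    qed (use Cons.prems * in auto)
    thus ?case using \<gamma> by simp
  qed
  obtain S where S: "finite S" "S \<subseteq> B" "\<And>bs. S \<subseteq> set bs \<Longrightarrow> \<omega> \<in> ext_gen bs"
    using ext_gen_cover[OF B', of \<omega>] by blast
  obtain bs where bs: "set bs = S" "distinct bs" using finite_distinct_list[OF S(1)] by blast
  show ?thesis
    by (rule main[of \<omega> bs]) (use S bs in \<open>auto intro!: assms rng\<close>)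
qed

subsection \<open>Restriction of alternating forms to intersections of kernels\<close>

text \<open>Linearity in a single identity: \<open>c = 1\<close> and \<open>v = x\<close> give the
  value 0 at 0, then homogeneity and additivity follow. It is stated for the very substitution that
  occurs in \<open>alternating\<close> below.\<close>

abbreviation functional :: "(('a \<Rightarrow> 'k::field) \<Rightarrow> 'k) \<Rightarrow> bool"
  where "functional w \<equiv> \<forall>x c v. w (\<lambda>a. x a - c * v a) = w x - c * w v"

text \<open>
  Replacing every \<open>x\<close> by \<open>x - w(x) v\<close> in an alternating multilinear form \<open>f\<close> changes it by multiples
  of \<open>w\<close>, hence does not change \<open>w \<and> f\<close>.  This is all that is needed about alternation.
\<close>

definition alternating :: "('a::field \<Rightarrow> 'k::field) \<Rightarrow> (('a \<Rightarrow> 'k) list \<Rightarrow> 'k) \<Rightarrow> bool"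
  where "alternating \<iota> f \<longleftrightarrow> (\<forall>w v \<delta>s. v \<in> Collect (derivation \<iota>) \<longrightarrow> set \<delta>s \<subseteq> Collect (derivation \<iota>) \<longrightarrow>
     wedge1 w f \<delta>s = wedge1 w (\<lambda>l. f (map (\<lambda>x a. x a - w x * v a) l)) \<delta>s)"

lemma alternatingD:
  assumes "alternating \<iota> f" "derivation \<iota> v" "set \<delta>s \<subseteq> Collect (derivation \<iota>)"
  shows "wedge1 w f \<delta>s = wedge1 w (\<lambda>l. f (map (\<lambda>x a. x a - w x * v a) l)) \<delta>s"
  using assms unfolding alternating_def by simp

lemma derivation_proj:
  "derivation \<iota> x \<Longrightarrow> derivation \<iota> v \<Longrightarrow> derivation \<iota> (\<lambda>a. x a - c * v a)"
  by (auto simp: derivation_on_def algebra_simps)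

lemma derivation_scale: "derivation \<iota> v \<Longrightarrow> derivation \<iota> (\<lambda>a. c * v a)"
  by (auto simp: derivation_on_def algebra_simps)

text \<open>The substitution turns \<open>u\<close> into \<open>u - u(v) w\<close>, and the surplus
  multiple of \<open>w\<close> dies against the \<open>w\<close> in front. Anticommuting first
  brings \<open>w\<close> next to \<open>f\<close>, where its alternation applies.\<close>

lemma alternating_wedge1:
  assumes f: "alternating \<iota> f" and u: "functional u"
  shows "alternating \<iota> (wedge1 u f)"
  unfolding alternating_def
proof (intro allI impI)
  fix w v \<delta>s
  assume v: "v \<in> Collect (derivation \<iota>)" and \<delta>s: "set \<delta>s \<subseteq> Collect (derivation \<iota>)"
  define \<pi> where "\<pi> = (\<lambda>x a. x a - w x * v a)"
  define g where "g = (\<lambda>l. f (map \<pi> l))"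
  have *: "wedge1 u f (map \<pi> l) = wedge1 u g l - u v * wedge1 w g l" for l
  proof -
    have "wedge1 u f (map \<pi> l) = wedge1 (\<lambda>x. u x + (- u v) * w x) g l"
      unfolding wedge1_map g_def \<pi>_def
      by (intro wedge1_cong refl, rule trans[OF u[rule_format]]) simp
    also have "\<dots> = wedge1 u g l + (- u v) * wedge1 w g l"
      by (simp only: wedge1_add_left wedge1_scale_left)
    finally show ?thesis by simp
  qed
  have "wedge1 w (wedge1 u f) \<delta>s = - wedge1 u (wedge1 w f) \<delta>s"
    by (rule wedge1_anticommute)
  also have "wedge1 u (wedge1 w f) \<delta>s = wedge1 u (wedge1 w g) \<delta>s"
    unfolding g_def \<pi>_def by (intro wedge1_cong refl alternatingD[OF f]) (use v \<delta>s in auto)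
  also have "- \<dots> = wedge1 w (wedge1 u g) \<delta>s" by (simp add: wedge1_anticommute[of u])
  also have "\<dots> = wedge1 w (\<lambda>l. wedge1 u f (map \<pi> l)) \<delta>s"
    unfolding * by (simp add: wedge1_diff wedge1_scale wedge1_square)
  finally show "wedge1 w (wedge1 u f) \<delta>s = wedge1 w (\<lambda>l. wedge1 u f (map (\<lambda>x a. x a - w x * v a) l)) \<delta>s"
    by (simp only: \<pi>_def)
qed

lemma alternating_eqI:
  assumes f: "alternating \<iota> f"
    and eq: "\<And>\<delta>s. set \<delta>s \<subseteq> Collect (derivation \<iota>) \<Longrightarrow> g \<delta>s = f \<delta>s"
  shows "alternating \<iota> g"
  unfolding alternating_def
proof (intro allI impI)
  fix w v \<delta>s
  assume v: "v \<in> Collect (derivation \<iota>)" and \<delta>s: "set \<delta>s \<subseteq> Collect (derivation \<iota>)"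
  have "wedge1 w g \<delta>s = wedge1 w f \<delta>s"
    using \<delta>s by (intro wedge1_cong refl eq) auto
  also have "\<dots> = wedge1 w (\<lambda>l. f (map (\<lambda>x a. x a - w x * v a) l)) \<delta>s"
    by (rule alternatingD[OF f]) (use v \<delta>s in auto)
  also have "\<dots> = wedge1 w (\<lambda>l. g (map (\<lambda>x a. x a - w x * v a) l)) \<delta>s"
    using v \<delta>s by (intro wedge1_cong refl eq[symmetric]) (auto intro!: derivation_proj)
  finally show "wedge1 w g \<delta>s = \<dots>" .
qed

lemma alternating_ev:
  assumes emb: "field_embedding \<iota>"
  shows "alternating \<iota> (ev \<iota> \<omega>)"
proof (induction \<omega> rule: dform_ev_induct)
  case one
  have "alternating \<iota> (ev_const :: ('a \<Rightarrow> 'b) list \<Rightarrow> 'b)"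
    by (simp add: alternating_def)
  thus ?case by (rule alternating_eqI) (rule ev_1[OF emb])
next
  case (D a \<omega>)
  have "alternating \<iota> (wedge1 (\<lambda>\<delta>. \<delta> a) (ev \<iota> \<omega>))"
    by (rule alternating_wedge1[OF D]) simp
  thus ?case by (rule alternating_eqI) (rule ev_D[OF emb])
next
  case (form0 c \<omega>)
  hence "alternating \<iota> (\<lambda>l. \<iota> c * ev \<iota> \<omega> l)"
    by (simp add: alternating_def wedge1_scale)
  thus ?case by (rule alternating_eqI) (rule ev_form0[OF emb])
next
  case (add \<omega> \<eta>)
  hence "alternating \<iota> (\<lambda>l. ev \<iota> \<omega> l + ev \<iota> \<eta> l)"
    by (simp add: alternating_def wedge1_add)
  thus ?case by (rule alternating_eqI) (rule ev_add[OF emb])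
qed

definition common_kernel :: "('a::field \<Rightarrow> 'k::field) \<Rightarrow> (('a \<Rightarrow> 'k) \<Rightarrow> 'k) set \<Rightarrow> ('a \<Rightarrow> 'k) set"
  where "common_kernel \<iota> W = {\<delta>. derivation \<iota> \<delta> \<and> (\<forall>w\<in>W. w \<delta> = 0)}"

text \<open>Linear independence on the space of derivations: a functional lies outside the span of
  its predecessors iff it is non-zero somewhere on their common kernel. This form supplies the
  vectors along which to project.\<close>

definition indep_functionals :: "('a::field \<Rightarrow> 'k::field) \<Rightarrow> (('a \<Rightarrow> 'k) \<Rightarrow> 'k) list \<Rightarrow> bool"
  where "indep_functionals \<iota> ws \<longleftrightarrow>
    (\<forall>i<length ws. \<exists>v\<in>common_kernel \<iota> (set (take i ws)). (ws ! i) v \<noteq> 0)"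

lemma indep_functionals_Nil [simp]: "indep_functionals \<iota> []"
  by (simp add: indep_functionals_def)

lemma indep_functionals_snoc:
  "indep_functionals \<iota> (ws @ [w]) \<longleftrightarrow>
    indep_functionals \<iota> ws \<and> (\<exists>v\<in>common_kernel \<iota> (set ws). w v \<noteq> 0)"
  by (auto simp: indep_functionals_def nth_append less_Suc_eq)

text \<open>One functional at a time moves from the kernel condition into the wedge. Projecting
  along a vector \<open>v\<close> with \<open>w v = 1\<close> maps the larger kernel into the
  smaller one and does not change the wedge of \<open>w\<close> and \<open>f\<close>; conversely,
  this wedge at \<open>v\<close> followed by elements of the smaller kernel returns
  \<open>f\<close>.\<close>

lemma vanish_common_kernel_iff:
  assumes "alternating \<iota> f" "\<forall>w\<in>set ws. functional w" "indep_functionals \<iota> ws"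
  shows "(\<forall>\<delta>s. set \<delta>s \<subseteq> common_kernel \<iota> (set ws) \<longrightarrow> f \<delta>s = 0) \<longleftrightarrow>
    (\<forall>\<delta>s. set \<delta>s \<subseteq> Collect (derivation \<iota>) \<longrightarrow> foldr wedge1 ws f \<delta>s = 0)"
  using assms
proof (induction ws arbitrary: f rule: rev_induct)
  case Nil
  show ?case by (simp add: common_kernel_def)
next
  case (snoc w ws)
  from snoc.prems(3) obtain v0 where v0: "v0 \<in> common_kernel \<iota> (set ws)" "w v0 \<noteq> 0"
    and ind: "indep_functionals \<iota> ws" by (auto simp: indep_functionals_snoc)
  have w: "functional w" using snoc.prems(2) by auto
  have scale: "u (\<lambda>a. c * x a) = c * u x" if u: "functional u" for u c and x :: "'a \<Rightarrow> 'b"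
  proof -
    have "u (\<lambda>a. 0) = 0" using u[rule_format, of x 1 x] by simp
    thus ?thesis using u[rule_format, of "\<lambda>a. 0" "-c" x] by simp
  qed
  \<comment> \<open>Rescale so that \<open>w v = 1\<close>; the multiple \<open>v\<close> of
    \<open>v0\<close> stays in the common kernel of \<open>ws\<close>, so the projection along it
    does not leave that kernel.\<close>
  obtain c where c: "c * w v0 = 1" using v0(2) by (metis left_inverse)
  define v where "v = (\<lambda>a. c * v0 a)"
  have "u v = 0" if "u \<in> set ws" for u
  proof -
    have "functional u" using snoc.prems(2) that by auto
    from scale[OF this, of c v0] show ?thesis using that v0 by (simp add: v_def common_kernel_def)
  qed
  moreover have "derivation \<iota> v"
    using v0 unfolding v_def by (intro derivation_scale) (simp add: common_kernel_def)
  ultimately have v: "v \<in> common_kernel \<iota> (set ws)" "w v = 1"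
    using scale[OF w, of c v0] c by (simp_all only: common_kernel_def v_def) auto
  have *: "(\<lambda>a. x a - w x * v a) \<in> common_kernel \<iota> (set (ws @ [w]))"
    if "x \<in> common_kernel \<iota> (set ws)" for x
  proof -
    have "u (\<lambda>a. x a - w x * v a) = 0" if "u \<in> set (ws @ [w])" for u
    proof -
      have "functional u" using snoc.prems(2) that by (rule bspec)
      hence "u (\<lambda>a. x a - w x * v a) = u x - w x * u v" by (elim allE)
      thus ?thesis using that v \<open>x \<in> _\<close> by (auto simp: common_kernel_def)
    qed
    thus ?thesis using that v by (auto simp: common_kernel_def derivation_proj)
  qed
  have "(\<forall>\<delta>s. set \<delta>s \<subseteq> common_kernel \<iota> (set (ws @ [w])) \<longrightarrow> f \<delta>s = 0) \<longleftrightarrow>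
    (\<forall>\<delta>s. set \<delta>s \<subseteq> common_kernel \<iota> (set ws) \<longrightarrow> wedge1 w f \<delta>s = 0)" (is "?L \<longleftrightarrow> ?R")
  proof
    assume L: ?L
    show ?R
    proof (intro allI impI)
      fix \<delta>s assume \<delta>s: "set \<delta>s \<subseteq> common_kernel \<iota> (set ws)"
      have "wedge1 w f \<delta>s = wedge1 w (\<lambda>l. f (map (\<lambda>x a. x a - w x * v a) l)) \<delta>s"
        by (rule alternatingD[OF snoc.prems(1)]) (use \<delta>s v in \<open>auto simp: common_kernel_def\<close>)
      also have "\<dots> = 0"
      proof (rule wedge1_eq_0)
        fix l assume "set l \<subseteq> set \<delta>s"
        hence "set (map (\<lambda>x a. x a - w x * v a) l) \<subseteq> common_kernel \<iota> (set (ws @ [w]))"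
          using * \<delta>s by auto
        thus "f (map (\<lambda>x a. x a - w x * v a) l) = 0" using L by blast
      qed
      finally show "wedge1 w f \<delta>s = 0" .
    qed
  next
    assume R: ?R
    show ?L
    proof (intro allI impI)
      fix \<delta>s assume \<delta>s: "set \<delta>s \<subseteq> common_kernel \<iota> (set (ws @ [w]))"
      \<comment> \<open>With \<open>v\<close> in front only the first Laplace term survives, because
        \<open>w\<close> is zero on the remaining arguments.\<close>
      hence "set (v # \<delta>s) \<subseteq> common_kernel \<iota> (set ws)"
        using v by (auto simp: common_kernel_def)
      hence "wedge1 w f (v # \<delta>s) = 0" using R by blast
      moreover have "wedge1 w (\<lambda>l. f (v # l)) \<delta>s = wedge1 (\<lambda>_. 0) (\<lambda>l. f (v # l)) \<delta>s"
        by (rule wedge1_cong) (use \<delta>s in \<open>auto simp: common_kernel_def\<close>)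
      ultimately show "f \<delta>s = 0" using v by simp
    qed
  qed
  also have "\<dots> \<longleftrightarrow> (\<forall>\<delta>s. set \<delta>s \<subseteq> Collect (derivation \<iota>) \<longrightarrow> foldr wedge1 ws (wedge1 w f) \<delta>s = 0)"
    using snoc.prems ind by (intro snoc.IH alternating_wedge1) auto
  finally show ?case by simp
qed

text \<open>If the last functional vanished on the common kernel of its predecessors, so would its
  product with \<open>f\<close>, and the criterion above would make the whole wedge zero.\<close>

lemma wedge_nonzero_imp_indep:
  assumes "alternating \<iota> f" "\<forall>w\<in>set ws. functional w"
    "set \<delta>s \<subseteq> Collect (derivation \<iota>)" "foldr wedge1 ws f \<delta>s \<noteq> 0"
  shows "indep_functionals \<iota> ws"
  using assms
proof (induction ws arbitrary: f rule: rev_induct)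
  case (snoc w ws)
  have w: "alternating \<iota> (wedge1 w f)" using snoc.prems by (intro alternating_wedge1) auto
  have ind: "indep_functionals \<iota> ws"
    by (rule snoc.IH[OF w]) (use snoc.prems in auto)
  have "\<exists>v\<in>common_kernel \<iota> (set ws). w v \<noteq> 0"
  proof (rule ccontr)
    assume *: "\<not> ?thesis"
    have "\<forall>\<delta>s. set \<delta>s \<subseteq> common_kernel \<iota> (set ws) \<longrightarrow> wedge1 w f \<delta>s = 0"
    proof (intro allI impI)
      fix \<delta>s assume \<delta>s: "set \<delta>s \<subseteq> common_kernel \<iota> (set ws)"
      have "wedge1 w f \<delta>s = wedge1 (\<lambda>_. 0) f \<delta>s"
        by (rule wedge1_cong) (use \<delta>s * in auto)
      thus "wedge1 w f \<delta>s = 0" by simp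
    qed
    hence "foldr wedge1 ws (wedge1 w f) \<delta>s = 0"
      using vanish_common_kernel_iff[OF w _ ind] snoc.prems by auto
    thus False using snoc.prems by simp
  qed
  thus ?case using ind by (simp add: indep_functionals_snoc)
qed simp


subsection \<open>Expanding the wedge product of generic linear combinations\<close>

definition subring_set :: "'k::field set \<Rightarrow> bool"
  where "subring_set S \<longleftrightarrow> 0 \<in> S \<and> 1 \<in> S \<and> (\<forall>x\<in>S. \<forall>y\<in>S. x + y \<in> S \<and> x - y \<in> S \<and> x * y \<in> S)"

lemma subring_setD:
  assumes "subring_set S"
  shows "0 \<in> S" "1 \<in> S" "x \<in> S \<Longrightarrow> y \<in> S \<Longrightarrow> x + y \<in> S" "x \<in> S \<Longrightarrow> y \<in> S \<Longrightarrow> x - y \<in> S"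
    "x \<in> S \<Longrightarrow> y \<in> S \<Longrightarrow> x * y \<in> S"
  using assms by (auto simp: subring_set_def)

lemma subring_set_sum: "subring_set S \<Longrightarrow> (\<And>j. j \<in> J \<Longrightarrow> f j \<in> S) \<Longrightarrow> sum f J \<in> S"
  by (induction J rule: infinite_finite_induct) (auto intro: subring_setD)

text \<open>
  In the applications \<open>z i j = x\<^sub>i\<^sub>j\<^sup>p\<close> for a generic zero \<open>(x\<^sub>i\<^sub>0, x\<^sub>i\<^sub>1, \<dots>)\<close> of \<open>\<phi>\<^sub>i\<close>, and \<open>comb_functional m z a i\<close>
  below is \<open>\<delta> \<mapsto> \<delta> (\<Sum>a\<^sub>i\<^sub>j x\<^sub>i\<^sub>j\<^sup>p)\<close>, the obstruction to extending \<open>\<delta>\<close> over the \<open>i\<close>-th step.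
\<close>

definition coeff_chain ::
  "('a::field \<Rightarrow> 'k::field) \<Rightarrow> nat \<Rightarrow> (nat \<Rightarrow> nat) \<Rightarrow> (nat \<Rightarrow> nat \<Rightarrow> 'k) \<Rightarrow> (nat \<Rightarrow> 'k set) \<Rightarrow> bool"
  where "coeff_chain \<iota> t m z L \<longleftrightarrow> range \<iota> \<subseteq> L 0 \<and> (\<forall>i. subring_set (L i)) \<and>
    (\<forall>i\<in>{1..t}. L (i - 1) \<subseteq> L i \<and> (\<forall>j\<in>{1..m i}. z i j \<in> L i) \<and>
      (\<forall>c. (\<forall>j\<in>{1..m i}. c j \<in> L (i - 1)) \<longrightarrow> (\<Sum>j=1..m i. c j * z i j) = 0 \<longrightarrow>
        (\<forall>j\<in>{1..m i}. c j = 0)))"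

lemma coeff_chain_mono:
  assumes "coeff_chain \<iota> t' m z L" "t \<le> t'"
  shows "coeff_chain \<iota> t m z L"
proof -
  have sub: "{1..t} \<subseteq> {1..t'}" using assms(2) by auto
  have ball: "A \<subseteq> B \<Longrightarrow> Ball B P \<Longrightarrow> Ball A P" for A B and P :: "nat \<Rightarrow> bool" by auto
  show ?thesis
    using assms(1) unfolding coeff_chain_def
    by (elim conjE, intro conjI) (assumption | erule ball[OF sub])+
qed

definition comb_functional :: "(nat \<Rightarrow> nat) \<Rightarrow> (nat \<Rightarrow> nat \<Rightarrow> 'k) \<Rightarrow> (nat \<Rightarrow> nat \<Rightarrow> 'a) \<Rightarrow> nat
    \<Rightarrow> ('a::field \<Rightarrow> 'k::field) \<Rightarrow> 'k"
  where "comb_functional m z a i \<delta> = (\<Sum>j=1..m i. z i j * \<delta> (a i j))"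

lemma functional_comb: "functional (comb_functional m z a i)"
  by (simp add: comb_functional_def sum_subtractf algebra_simps sum_distrib_left)

definition d_product :: "(nat \<Rightarrow> nat \<Rightarrow> 'a::field) \<Rightarrow> (nat \<Rightarrow> nat) \<Rightarrow> nat \<Rightarrow> 'a dform"
  where "d_product a j t = prod_list (map (\<lambda>i. D (a i (j i))) [1..<Suc t])"

lemma d_product_0 [simp]: "d_product a j 0 = 1"
  by (simp add: d_product_def)

lemma d_product_Suc: "d_product a j (Suc t) = d_product a j t * D (a (Suc t) (j (Suc t)))"
  by (simp add: d_product_def)

lemma d_product_cong: "(\<And>i. i \<in> {1..t} \<Longrightarrow> j i = j' i) \<Longrightarrow> d_product a j t = d_product a j' t"
  unfolding d_product_def by (intro arg_cong[of _ _ prod_list] map_cong) auto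

lemma foldr_wedge1_cong:
  assumes "\<And>l. set l \<subseteq> set \<delta>s \<Longrightarrow> f l = g l"
  shows "foldr wedge1 ws f \<delta>s = foldr wedge1 ws g \<delta>s"
  using assms
proof (induction ws arbitrary: \<delta>s)
  case (Cons w ws)
  have "wedge1 w (foldr wedge1 ws f) \<delta>s = wedge1 w (foldr wedge1 ws g) \<delta>s"
    by (rule wedge1_cong[OF refl], rule Cons.IH, rule Cons.prems) auto
  thus ?case by simp
qed auto

lemma foldr_wedge1_sum:
  "foldr wedge1 ws (\<lambda>l. \<Sum>j\<in>J. c j * f j l) \<delta>s = (\<Sum>j\<in>J. c j * foldr wedge1 ws (f j) \<delta>s)"
proof (induction ws arbitrary: \<delta>s)
  case (Cons w ws)
  have sum: "wedge1 w (\<lambda>l. \<Sum>j\<in>J. g j l) vs = (\<Sum>j\<in>J. wedge1 w (g j) vs)" for g vs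
    by (induction J rule: infinite_finite_induct) (simp_all add: wedge1_add)
  have "wedge1 w (foldr wedge1 ws (\<lambda>l. \<Sum>j\<in>J. c j * f j l)) \<delta>s =
      wedge1 w (\<lambda>l. \<Sum>j\<in>J. c j * foldr wedge1 ws (f j) l) \<delta>s"
    by (rule wedge1_cong[OF refl Cons])
  thus ?case by (simp add: sum wedge1_scale)
qed simp

lemma wedge1_comb_functional:
  assumes emb: "field_embedding \<iota>" and \<delta>s: "set \<delta>s \<subseteq> Collect (derivation \<iota>)"
  shows "wedge1 (comb_functional m z a i) (ev \<iota> \<omega>) \<delta>s = (\<Sum>j=1..m i. z i j * ev \<iota> (D (a i j) * \<omega>) \<delta>s)"
  unfolding comb_functional_def wedge1_sum_left wedge1_scale_left by (simp add: ev_D[OF emb \<delta>s])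

text \<open>The innermost functional belongs to the top of the tower. Expanding it pulls out its
  generic coefficients as scalars and absorbs the differentials da_ij into the form, leaving wedges
  of length t to which \<open>foldr_comb_in_chain\<close> applies.\<close>

lemma foldr_comb_Suc:
  assumes emb: "field_embedding \<iota>" and \<delta>s: "set \<delta>s \<subseteq> Collect (derivation \<iota>)"
  shows "foldr wedge1 (map (comb_functional m z a) [1..<Suc (Suc t)]) (ev \<iota> \<omega>) \<delta>s =
    (\<Sum>j=1..m (Suc t). z (Suc t) j *
      foldr wedge1 (map (comb_functional m z a) [1..<Suc t]) (ev \<iota> (D (a (Suc t) j) * \<omega>)) \<delta>s)"
proof -
  have "foldr wedge1 (map (comb_functional m z a) [1..<Suc (Suc t)]) (ev \<iota> \<omega>) \<delta>s =
    foldr wedge1 (map (comb_functional m z a) [1..<Suc t])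
      (wedge1 (comb_functional m z a (Suc t)) (ev \<iota> \<omega>)) \<delta>s" by simp
  also have "\<dots> = foldr wedge1 (map (comb_functional m z a) [1..<Suc t])
      (\<lambda>l. \<Sum>j=1..m (Suc t). z (Suc t) j * ev \<iota> (D (a (Suc t) j) * \<omega>) l) \<delta>s"
    by (rule foldr_wedge1_cong, rule wedge1_comb_functional[OF emb]) (use \<delta>s in auto)
  finally show ?thesis by (simp only: foldr_wedge1_sum)
qed

lemma field_embedding_inj:
  assumes emb: "field_embedding \<iota>"
  shows "inj \<iota>"
proof -
  have "\<iota> x = 0 \<Longrightarrow> x = 0" for x
    using field_embeddingD(2)[OF emb, of x "inverse x"] field_embeddingD(3)[OF emb]
    by (cases "x = 0") auto
  moreover have "\<iota> (x - y) = \<iota> x - \<iota> y" for x y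
    using field_embeddingD(1)[OF emb, of "x - y" y] by simp
  ultimately show ?thesis by (metis injI eq_iff_diff_eq_0)
qed

text \<open>Tested on derivations of F itself, the first t functionals contribute only coefficients
  from level t of the chain. The new coefficients at level t + 1 are independent over precisely
  these.\<close>

lemma foldr_comb_in_chain:
  assumes emb: "field_embedding \<iota>" and chain: "coeff_chain \<iota> t m z L"
    and \<delta>s: "set \<delta>s \<subseteq> Collect (derivation (\<lambda>x. x))"
  shows "foldr wedge1 (map (comb_functional m z a) [1..<Suc t]) (ev \<iota> \<omega>) (map (\<lambda>\<delta> x. \<iota> (\<delta> x)) \<delta>s) \<in> L t"
  using chain
proof (induction t arbitrary: \<omega>)
  case 0
  thus ?case using ev_comp[OF emb \<delta>s, of \<omega>] by (auto simp: coeff_chain_def)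
next
  case (Suc t)
  have c: "coeff_chain \<iota> t m z L" by (rule coeff_chain_mono[OF Suc.prems]) simp
  have \<delta>s': "set (map (\<lambda>\<delta> x. \<iota> (\<delta> x)) \<delta>s) \<subseteq> Collect (derivation \<iota>)"
    using \<delta>s by (auto simp: derivation_on_def subset_iff field_embeddingD[OF emb])
  have L: "subring_set (L (Suc t))" "L t \<subseteq> L (Suc t)" "\<And>j. j \<in> {1..m (Suc t)} \<Longrightarrow> z (Suc t) j \<in> L (Suc t)"
  proof -
    have "Suc t \<in> {1..Suc t}" by simp
    thus "subring_set (L (Suc t))" "L t \<subseteq> L (Suc t)" "\<And>j. j \<in> {1..m (Suc t)} \<Longrightarrow> z (Suc t) j \<in> L (Suc t)"
      using Suc.prems unfolding coeff_chain_def by (metis diff_Suc_1)+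
  qed
  show ?case
    unfolding foldr_comb_Suc[OF emb \<delta>s']
    by (intro subring_set_sum subring_setD(5) L subsetD[OF L(2) Suc.IH[OF c]])
qed

text \<open>Peeling off the last functional writes the wedge as a linear combination of its generic
  coefficients over the preceding level, so every summand vanishes separately. At the bottom a form
  over F remains, to which \<open>ev_eq_0_imp\<close> applies.\<close>

theorem foldr_comb_vanish_iff:
  assumes emb: "field_embedding \<iota>" and chain: "coeff_chain \<iota> t m z L"
  shows "(\<forall>\<delta>s. set \<delta>s \<subseteq> Collect (derivation \<iota>) \<longrightarrow>
      foldr wedge1 (map (comb_functional m z a) [1..<Suc t]) (ev \<iota> \<omega>) \<delta>s = 0) \<longleftrightarrow>
    (\<forall>j. (\<forall>i\<in>{1..t}. j i \<in> {1..m i}) \<longrightarrow> d_product a j t * \<omega> = 0)"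
proof
  assume *: "\<forall>\<delta>s. set \<delta>s \<subseteq> Collect (derivation \<iota>) \<longrightarrow>
      foldr wedge1 (map (comb_functional m z a) [1..<Suc t]) (ev \<iota> \<omega>) \<delta>s = 0"
  \<comment> \<open>It suffices to test derivations of F composed with \<iota>; on these the
    coefficients are known to lie in the chain.\<close>
  have "\<forall>j. (\<forall>i\<in>{1..t}. j i \<in> {1..m i}) \<longrightarrow> d_product a j t * \<omega> = 0"
    if "\<And>\<delta>s. set \<delta>s \<subseteq> Collect (derivation (\<lambda>x. x)) \<Longrightarrow>
      foldr wedge1 (map (comb_functional m z a) [1..<Suc t]) (ev \<iota> \<omega>) (map (\<lambda>\<delta> x. \<iota> (\<delta> x)) \<delta>s) = 0"
    using that chain
  proof (induction t arbitrary: \<omega>)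
    case 0
    have "\<omega> = 0"
    proof (rule ev_eq_0_imp)
      fix \<delta>s :: "('a \<Rightarrow> 'a) list" assume \<delta>s: "set \<delta>s \<subseteq> Collect (derivation (\<lambda>x. x))"
      have "\<iota> (ev (\<lambda>x. x) \<omega> \<delta>s) = \<iota> 0"
        using 0(1)[OF \<delta>s] ev_comp[OF emb \<delta>s, of \<omega>] by (simp add: field_embeddingD[OF emb])
      thus "ev (\<lambda>x. x) \<omega> \<delta>s = 0" using injD[OF field_embedding_inj[OF emb]] by blast
    qed
    thus ?case by simp
  next
    case (Suc t)
    have c: "coeff_chain \<iota> t m z L" by (rule coeff_chain_mono[OF Suc.prems(2)]) simp
    have indep: "\<forall>j\<in>{1..m (Suc t)}. c j = 0"
      if "\<forall>j\<in>{1..m (Suc t)}. c j \<in> L t" "(\<Sum>j=1..m (Suc t). c j * z (Suc t) j) = 0" for c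
    proof -
      have "Suc t \<in> {1..Suc t}" by simp
      thus ?thesis using Suc.prems(2) that unfolding coeff_chain_def by (metis diff_Suc_1)
    qed
    have step: "\<forall>j. (\<forall>i\<in>{1..t}. j i \<in> {1..m i}) \<longrightarrow> d_product a j t * (D (a (Suc t) j') * \<omega>) = 0"
      if j': "j' \<in> {1..m (Suc t)}" for j'
    proof (rule Suc.IH[OF _ c])
      fix \<delta>s :: "('a \<Rightarrow> 'a) list" assume \<delta>s: "set \<delta>s \<subseteq> Collect (derivation (\<lambda>x. x))"
      have \<delta>s': "set (map (\<lambda>\<delta> x. \<iota> (\<delta> x)) \<delta>s) \<subseteq> Collect (derivation \<iota>)"
        using \<delta>s by (auto simp: derivation_on_def subset_iff field_embeddingD[OF emb])
      let ?c = "\<lambda>j. foldr wedge1 (map (comb_functional m z a) [1..<Suc t])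
          (ev \<iota> (D (a (Suc t) j) * \<omega>)) (map (\<lambda>\<delta> x. \<iota> (\<delta> x)) \<delta>s)"
      have "\<forall>j\<in>{1..m (Suc t)}. ?c j = 0"
      proof (rule indep)
        show "\<forall>j\<in>{1..m (Suc t)}. ?c j \<in> L t" using foldr_comb_in_chain[OF emb c \<delta>s] by blast
        show "(\<Sum>j=1..m (Suc t). ?c j * z (Suc t) j) = 0"
          using Suc.prems(1)[OF \<delta>s] unfolding foldr_comb_Suc[OF emb \<delta>s'] by (simp only: mult.commute)
      qed
      thus "?c j' = 0" using j' by blast
    qed
    show ?case
    proof (intro allI impI)
      fix j assume j: "\<forall>i\<in>{1..Suc t}. j i \<in> {1..m i}"
      hence "j (Suc t) \<in> {1..m (Suc t)}" "\<forall>i\<in>{1..t}. j i \<in> {1..m i}" by auto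
      with step[of "j (Suc t)"] show "d_product a j (Suc t) * \<omega> = 0"
        by (simp only: d_product_Suc mult.assoc)
    qed
  qed
  moreover have "set (map (\<lambda>\<delta> x. \<iota> (\<delta> x)) \<delta>s) \<subseteq> Collect (derivation \<iota>)"
    if "set \<delta>s \<subseteq> Collect (derivation (\<lambda>x. x))" for \<delta>s
    using that by (auto simp: derivation_on_def subset_iff field_embeddingD[OF emb])
  ultimately show "\<forall>j. (\<forall>i\<in>{1..t}. j i \<in> {1..m i}) \<longrightarrow> d_product a j t * \<omega> = 0"
    using * by simp
next
  assume *: "\<forall>j. (\<forall>i\<in>{1..t}. j i \<in> {1..m i}) \<longrightarrow> d_product a j t * \<omega> = 0"
  have "foldr wedge1 (map (comb_functional m z a) [1..<Suc t]) (ev \<iota> \<omega>) \<delta>s = 0"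
    if "set \<delta>s \<subseteq> Collect (derivation \<iota>)" for \<delta>s
    using * that
  proof (induction t arbitrary: \<omega>)
    case 0
    hence "\<omega> = 0" by simp
    thus ?case using ev_0[OF emb 0(2)] by simp
  next
    case (Suc t)
    have "foldr wedge1 (map (comb_functional m z a) [1..<Suc t]) (ev \<iota> (D (a (Suc t) j') * \<omega>)) \<delta>s = 0"
      if j': "j' \<in> {1..m (Suc t)}" for j'
    proof (rule Suc.IH)
      show "\<forall>j. (\<forall>i\<in>{1..t}. j i \<in> {1..m i}) \<longrightarrow> d_product a j t * (D (a (Suc t) j') * \<omega>) = 0"
      proof (intro allI impI)
        fix j assume j: "\<forall>i\<in>{1..t}. j i \<in> {1..m i}"
        have "\<forall>i\<in>{1..Suc t}. (j(Suc t := j')) i \<in> {1..m i}"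
          using j j' by (auto simp: le_Suc_eq)
        hence "d_product a (j(Suc t := j')) (Suc t) * \<omega> = 0" using Suc.prems(1) by blast
        moreover have "d_product a (j(Suc t := j')) t = d_product a j t"
          by (rule d_product_cong) auto
        ultimately show "d_product a j t * (D (a (Suc t) j') * \<omega>) = 0"
          by (simp add: d_product_Suc mult.assoc)
      qed
    qed (use Suc.prems in auto)
    thus ?case unfolding foldr_comb_Suc[OF emb Suc.prems(2)] by simp
  qed
  thus "\<forall>\<delta>s. set \<delta>s \<subseteq> Collect (derivation \<iota>) \<longrightarrow>
      foldr wedge1 (map (comb_functional m z a) [1..<Suc t]) (ev \<iota> \<omega>) \<delta>s = 0" by blast
qed

section \<open>Subfields and derivations in characteristic \<open>p\<close>\<close>

text \<open>Since \<open>inverse 0 = 0\<close>, closure under \<open>inverse\<close> is demanded of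
  all elements alike. \<open>subfield_set_iff\<close> identifies this predicate with the one of the
  algebra library, whose degrees and generated fields occur in the statement.\<close>

definition subfield_set :: "'k::field set \<Rightarrow> bool"
  where "subfield_set E \<longleftrightarrow> subring_set E \<and> (\<forall>x\<in>E. inverse x \<in> E)"

lemma subfield_setD:
  assumes "subfield_set E"
  shows "subring_set E" "0 \<in> E" "1 \<in> E" "x \<in> E \<Longrightarrow> y \<in> E \<Longrightarrow> x + y \<in> E" "x \<in> E \<Longrightarrow> y \<in> E \<Longrightarrow> x - y \<in> E"
    "x \<in> E \<Longrightarrow> y \<in> E \<Longrightarrow> x * y \<in> E" "x \<in> E \<Longrightarrow> inverse x \<in> E" "x \<in> E \<Longrightarrow> - x \<in> E" "x \<in> E \<Longrightarrow> y \<in> E \<Longrightarrow> x / y \<in> E"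
proof -
  show *: "subring_set E" "0 \<in> E" "1 \<in> E" "x \<in> E \<Longrightarrow> y \<in> E \<Longrightarrow> x + y \<in> E" "x \<in> E \<Longrightarrow> y \<in> E \<Longrightarrow> x - y \<in> E"
    "x \<in> E \<Longrightarrow> y \<in> E \<Longrightarrow> x * y \<in> E" "x \<in> E \<Longrightarrow> inverse x \<in> E" for x y
    using assms by (auto simp: subfield_set_def subring_set_def)
  show "x \<in> E \<Longrightarrow> - x \<in> E" using *(5)[of 0 x] *(2) by simp
  show "x \<in> E \<Longrightarrow> y \<in> E \<Longrightarrow> x / y \<in> E" using *(6)[of x "inverse y"] *(7)[of y] by (simp add: divide_inverse)
qed

lemma subring_set_power: "subring_set E \<Longrightarrow> x \<in> E \<Longrightarrow> x ^ n \<in> E"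
  by (induction n) (auto intro: subring_setD)

lemma subring_set_of_nat: "subring_set E \<Longrightarrow> of_nat n \<in> E"
  by (induction n) (auto intro: subring_setD)

lemma subring_set_uminus: "subring_set E \<Longrightarrow> x \<in> E \<Longrightarrow> - x \<in> E"
  using subring_setD(4)[of E 0 x] subring_setD(1)[of E] by simp

lemma subfield_set_UNIV: "subfield_set UNIV"
  by (simp add: subfield_set_def subring_set_def)

lemma type_ring_minus [simp]: "\<ominus>\<^bsub>type_ring\<^esub> x = - (x :: 'a::ring_1)"
proof -
  interpret ring "type_ring :: 'a ring" by (rule ring_type_ring)
  show ?thesis by (rule minus_equality) auto
qed

lemma field_type_ring: "Ring.field (type_ring :: 'k::field ring)"
  by (rule field_from_type_algebra)

lemma type_ring_inv: "x \<noteq> 0 \<Longrightarrow> inv\<^bsub>type_ring\<^esub> x = inverse (x :: 'k::field)"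
proof -
  assume x: "x \<noteq> 0"
  interpret Ring.field "type_ring :: 'k ring" by (rule field_type_ring)
  show ?thesis by (rule comm_inv_char) (use x in auto)
qed

lemma subfield_set_iff: "subfield E type_ring \<longleftrightarrow> subfield_set (E :: 'k::field set)"
proof
  interpret Ring.field "type_ring :: 'k ring" by (rule field_type_ring)
  assume E: "subfield E (type_ring :: 'k ring)"
  note sub = subringE[OF subfieldE(1)[OF E]]
  have inv: "inverse x \<in> E" if "x \<in> E" for x
    using subfield_m_inv(1)[OF E, of x] that sub(2) by (cases "x = 0") (auto simp: type_ring_inv)
  have "x - y \<in> E" if "x \<in> E" "y \<in> E" for x y
    using sub(7)[of x "- y"] sub(5)[of y] that by simp
  thus "subfield_set E" using sub inv by (auto simp: subfield_set_def subring_set_def)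
next
  interpret Ring.field "type_ring :: 'k ring" by (rule field_type_ring)
  assume E: "subfield_set E"
  show "subfield E (type_ring :: 'k ring)"
    by (rule subfieldI', rule subringI) (auto simp: type_ring_inv subfield_setD[OF E])
qed

lemma generate_field_subfield: "subfield_set (generate_field type_ring (H :: 'k::field set))"
proof -
  interpret Ring.field "type_ring :: 'k ring" by (rule field_type_ring)
  show ?thesis using generate_field_is_subfield[of H] by (simp add: subfield_set_iff)
qed

lemma generate_field_least:
  assumes "subfield_set E" "H \<subseteq> (E :: 'k::field set)"
  shows "generate_field type_ring H \<subseteq> E"
proof -
  interpret Ring.field "type_ring :: 'k ring" by (rule field_type_ring)
  show ?thesis by (rule generate_field_min_subfield1) (use assms in \<open>auto simp: subfield_set_iff\<close>)
qed

lemma generate_field_incl: "H \<subseteq> generate_field type_ring (H :: 'k::field set)"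
  by (auto intro: generate_field.incl)

lemma generate_field_mono:
  "H \<subseteq> H' \<Longrightarrow> generate_field type_ring H \<subseteq> generate_field type_ring (H' :: 'k::field set)"
  using generate_field_incl[of H'] by (intro generate_field_least generate_field_subfield) auto

context
  fixes \<iota> :: "'a::field \<Rightarrow> 'k::field" and E :: "'a set" and \<delta> :: "'a \<Rightarrow> 'k"
  assumes emb: "field_embedding \<iota>" and E: "subring_set E" and der: "derivation_on \<iota> E \<delta>"
begin

lemma derivation_0: "\<delta> 0 = 0"
  using derivation_on_add[OF der, of 0 0] subring_setD(1)[OF E]
  by (simp only: add_0_left add_cancel_right_right)

lemma derivation_1: "\<delta> 1 = 0"
  using derivation_on_mult[OF der, of 1 1] subring_setD(2)[OF E]
  by (simp only: mult_1_left mult_1_right field_embeddingD[OF emb] add_cancel_right_right)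

lemma derivation_sum: "(\<And>j. j \<in> J \<Longrightarrow> f j \<in> E) \<Longrightarrow> \<delta> (sum f J) = (\<Sum>j\<in>J. \<delta> (f j))"
  by (induction J rule: infinite_finite_induct)
     (auto simp: derivation_0 derivation_on_add[OF der] subring_set_sum[OF E])

lemma derivation_power:
  "x \<in> E \<Longrightarrow> \<delta> (x ^ Suc n) = of_nat (Suc n) * \<iota> x ^ n * \<delta> x"
proof (induction n)
  case (Suc n)
  have "\<delta> (x ^ Suc (Suc n)) = \<iota> x * \<delta> (x ^ Suc n) + \<iota> (x ^ Suc n) * \<delta> x"
    using derivation_on_mult[OF der Suc.prems, of "x ^ Suc n"] Suc.prems
      subring_set_power[OF E, of x "Suc n"] by simp
  moreover have "\<iota> (x ^ k) = \<iota> x ^ k" for k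
    by (induction k) (auto simp: field_embeddingD[OF emb])
  hence "\<iota> (x ^ Suc n) = \<iota> x ^ Suc n" .
  ultimately show ?case using Suc by (simp only: of_nat_Suc power_Suc) (simp add: algebra_simps)
qed simp

text \<open>The power rule produces the factor p, which is 0.\<close>

lemma derivation_pth_power:
  assumes "CHAR('k) > 0" "x \<in> E"
  shows "\<delta> (x ^ CHAR('k)) = 0"
proof -
  obtain n where n: "CHAR('k) = Suc n" using assms(1) gr0_implies_Suc by blast
  have "of_nat (Suc n) = (0 :: 'k)" unfolding n[symmetric] by simp
  thus ?thesis using derivation_power[OF assms(2), of n] by (simp add: n)
qed

end

lemma derivation_subset: "derivation_on \<iota> E \<delta> \<Longrightarrow> E' \<subseteq> E \<Longrightarrow> derivation_on \<iota> E' \<delta>"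
  unfolding derivation_on_def by (meson subsetD)

lemma derivation_restrict:
  assumes "derivation_on (\<lambda>x. x) E \<delta>" "range \<iota> \<subseteq> E" "field_embedding \<iota>"
  shows "derivation \<iota> (\<lambda>a. \<delta> (\<iota> a))"
  using assms by (auto simp: derivation_on_def image_subset_iff field_embeddingD[OF assms(3)])

subsection \<open>Extension to quotient fields\<close>

definition fractions :: "'k::field set \<Rightarrow> 'k set"
  where "fractions S = {x / y | x y. x \<in> S \<and> y \<in> S \<and> y \<noteq> 0}"

lemma fractions_incl: "subring_set S \<Longrightarrow> S \<subseteq> fractions S"
proof
  fix x assume "subring_set S" "x \<in> S"
  hence "x = x / 1" "x \<in> S" "1 \<in> S" by (auto simp: subring_setD)
  thus "x \<in> fractions S" unfolding fractions_def by (metis (mono_tags, lifting) mem_Collect_eq zero_neq_one)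
qed

lemma subfield_set_fractions:
  assumes S: "subring_set S"
  shows "subfield_set (fractions S)"
proof -
  have I: "a / b \<in> fractions S" if "a \<in> S" "b \<in> S" "b \<noteq> 0" for a b
    using that by (auto simp: fractions_def)
  have "0 \<in> fractions S" "1 \<in> fractions S"
    using fractions_incl[OF S] subring_setD(1,2)[OF S] by auto
  moreover have "u + v \<in> fractions S \<and> u - v \<in> fractions S \<and> u * v \<in> fractions S"
    if u: "u \<in> fractions S" and v: "v \<in> fractions S" for u v
  proof -
    obtain a b c d where *: "u = a / b" "v = c / d" "a \<in> S" "b \<in> S" "b \<noteq> 0" "c \<in> S" "d \<in> S" "d \<noteq> 0"
      using u v by (auto simp: fractions_def)
    have "u + v = (a * d + c * b) / (b * d)" "u - v = (a * d - c * b) / (b * d)" "u * v = (a * c) / (b * d)"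
      using * by (simp_all add: field_simps)
    thus ?thesis using * I subring_setD[OF S] by (metis mult_eq_0_iff)
  qed
  moreover have "inverse u \<in> fractions S" if u: "u \<in> fractions S" for u
  proof -
    obtain a b where *: "u = a / b" "a \<in> S" "b \<in> S" "b \<noteq> 0" using u by (auto simp: fractions_def)
    show ?thesis
    proof (cases "a = 0")
      case True
      thus ?thesis using * \<open>0 \<in> fractions S\<close> by simp
    next
      case False
      thus ?thesis using * I[of b a] by simp
    qed
  qed
  ultimately show ?thesis by (auto simp: subfield_set_def subring_set_def)
qed

text \<open>The quotient rule on a chosen numerator and denominator; the work is to see that the
  choice does not matter.\<close>

lemma derivation_extend_fractions:
  assumes S: "subring_set S" and der: "derivation_on (\<lambda>x. x) S \<delta>"
  shows "\<exists>\<delta>'. derivation_on (\<lambda>x. x) (fractions S) \<delta>' \<and> (\<forall>x\<in>S. \<delta>' x = \<delta> (x :: 'k::field))"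
proof -
  define P where "P = (\<lambda>u (a, b). a \<in> S \<and> b \<in> S \<and> b \<noteq> 0 \<and> u = a / b)"
  define \<delta>' where "\<delta>' = (\<lambda>u. case (SOME ab. P u ab) of (a, b) \<Rightarrow> (\<delta> a * b - a * \<delta> b) / b ^ 2)"
  have eq: "\<delta>' (a / b) = (\<delta> a * b - a * \<delta> b) / b ^ 2" if ab: "a \<in> S" "b \<in> S" "b \<noteq> 0" for a b
  proof -
    obtain c d where cd: "(SOME cd. P (a / b) cd) = (c, d)" by (cases "SOME cd. P (a / b) cd")
    have "P (a / b) (a, b)" using ab by (simp add: P_def)
    hence "P (a / b) (c, d)" unfolding cd[symmetric] by (rule someI)
    hence *: "c \<in> S" "d \<in> S" "d \<noteq> 0" "a / b = c / d" by (auto simp: P_def)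
    \<comment> \<open>Applying \<delta> to this equation and eliminating
      \<open>b * \<delta> c\<close> compares the two quotient-rule values.\<close>
    have ad: "a * d = c * b" using * ab by (simp add: field_simps)
    hence "\<delta> (a * d) = \<delta> (c * b)" by simp
    hence d': "a * \<delta> d + d * \<delta> a = c * \<delta> b + b * \<delta> c"
      using derivation_on_mult[OF der] ab * by simp
    have "(\<delta> c * d - c * \<delta> d) * b ^ 2 = (\<delta> a * b - a * \<delta> b) * d ^ 2"
    proof -
      have e: "b * \<delta> c = a * \<delta> d + d * \<delta> a - c * \<delta> b" using d' by simp
      have "(\<delta> c * d - c * \<delta> d) * b ^ 2 = d * b * (b * \<delta> c) - b * \<delta> d * (c * b)"
        by (simp add: power2_eq_square algebra_simps)
      also have "\<dots> = d * b * (a * \<delta> d + d * \<delta> a - c * \<delta> b) - b * \<delta> d * (c * b)"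
        unfolding e ..
      also have "\<dots> = d * b * (d * \<delta> a) - d * \<delta> b * (c * b) + b * \<delta> d * (a * d) - b * \<delta> d * (c * b)"
        by (simp add: algebra_simps)
      also have "\<dots> = (\<delta> a * b - a * \<delta> b) * d ^ 2"
        unfolding ad[symmetric] by (simp add: power2_eq_square algebra_simps)
      finally show ?thesis .
    qed
    thus ?thesis using ab * by (simp add: \<delta>'_def cd field_simps)
  qed
  have ext: "\<delta>' x = \<delta> x" if "x \<in> S" for x
    using eq[of x 1] that subring_setD(2)[OF S] derivation_1[OF embedding_id S der] by simp
  have "\<delta>' (u + v) = \<delta>' u + \<delta>' v \<and> \<delta>' (u * v) = u * \<delta>' v + v * \<delta>' u"
    if uv: "u \<in> fractions S" "v \<in> fractions S" for u v
  proof -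
    obtain a b c d where *: "u = a / b" "v = c / d" "a \<in> S" "b \<in> S" "b \<noteq> 0" "c \<in> S" "d \<in> S" "d \<noteq> 0"
      using uv by (auto simp: fractions_def)
    note cl = subring_setD(5,3)[OF S]
    have "u + v = (a * d + c * b) / (b * d)" "u * v = (a * c) / (b * d)"
      using * by (simp_all add: field_simps)
    hence 1: "\<delta>' (u + v) = (\<delta> (a * d + c * b) * (b * d) - (a * d + c * b) * \<delta> (b * d)) / (b * d) ^ 2"
      "\<delta>' (u * v) = (\<delta> (a * c) * (b * d) - (a * c) * \<delta> (b * d)) / (b * d) ^ 2"
      using eq[of "a * d + c * b" "b * d"] eq[of "a * c" "b * d"] * cl by simp_all
    \<comment> \<open>With U and V for the values at u and v, the quotient rule is rewritten as a
      product rule for a = u b and c = v d, which turns the claims into polynomial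
      identities.\<close>
    define U V where "U = \<delta>' u" and "V = \<delta>' v"
    have ab: "a = u * b" "c = v * d" using * by simp_all
    have "U = (\<delta> a * b - a * \<delta> b) / b ^ 2" "V = (\<delta> c * d - c * \<delta> d) / d ^ 2"
      using eq * by (simp_all add: U_def V_def)
    hence "U * b ^ 2 = \<delta> a * b - a * \<delta> b" "V * d ^ 2 = \<delta> c * d - c * \<delta> d"
      using * by simp_all
    hence "b * (\<delta> a - (b * U + u * \<delta> b)) = 0" "d * (\<delta> c - (d * V + v * \<delta> d)) = 0"
      by (simp_all add: ab power2_eq_square algebra_simps)
    hence 2: "\<delta> a = b * U + u * \<delta> b" "\<delta> c = d * V + v * \<delta> d" using * by simp_all
    have 3: "\<delta> (a * d + c * b) = a * \<delta> d + d * \<delta> a + (c * \<delta> b + b * \<delta> c)"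
      "\<delta> (b * d) = b * \<delta> d + d * \<delta> b" "\<delta> (a * c) = a * \<delta> c + c * \<delta> a"
      using derivation_on_mult[OF der] derivation_on_add[OF der] * cl by simp_all
    have "\<delta> (a * d + c * b) * (b * d) - (a * d + c * b) * \<delta> (b * d) = (U + V) * (b * d) ^ 2"
      "\<delta> (a * c) * (b * d) - (a * c) * \<delta> (b * d) = (u * V + v * U) * (b * d) ^ 2"
      unfolding 3 2 unfolding ab by (simp_all add: power2_eq_square algebra_simps)
    hence "\<delta>' (u + v) = U + V" "\<delta>' (u * v) = u * V + v * U" unfolding 1 using *(5,8) by simp_all
    thus ?thesis unfolding U_def V_def by blast
  qed
  thus ?thesis using ext by (intro exI[of _ \<delta>']) (auto simp: derivation_on_def)
qed

subsection \<open>Existence of derivations\<close>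

definition polys_over :: "'k::field set \<Rightarrow> 'k poly set"
  where "polys_over E = {f. \<forall>i. Polynomial.coeff f i \<in> E}"

lemma polys_over_const: "c \<in> E \<Longrightarrow> 0 \<in> E \<Longrightarrow> [:c:] \<in> polys_over E"
  by (simp add: polys_over_def coeff_pCons split: nat.split)

lemma polys_over_ops:
  assumes E: "subring_set E" and f: "f \<in> polys_over E" and g: "g \<in> polys_over E"
  shows "f + g \<in> polys_over E" "f - g \<in> polys_over E" "f * g \<in> polys_over E"
  using f g subring_setD[OF E]
  by (auto simp: polys_over_def coeff_mult intro!: subring_set_sum[OF E])

lemma polys_over_monom: "c \<in> E \<Longrightarrow> subring_set E \<Longrightarrow> Polynomial.monom c n \<in> polys_over E"
  by (auto simp: polys_over_def subring_setD)

text \<open>As the divisor is monic, no division of coefficients takes place, so quotient and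
  remainder stay over \<open>E\<close>.\<close>

lemma polys_over_division:
  assumes E: "subring_set E" and g: "g \<in> polys_over E" "lead_coeff g = 1" and f: "f \<in> polys_over E"
  shows "\<exists>q\<in>polys_over E. \<exists>r\<in>polys_over E. f = q * g + r \<and> (r = 0 \<or> Polynomial.degree r < Polynomial.degree g)"
  using f
proof (induction "Polynomial.degree f" arbitrary: f rule: less_induct)
  case less
  show ?case
  proof (cases "f = 0 \<or> Polynomial.degree f < Polynomial.degree g")
    case True
    thus ?thesis using less.prems polys_over_const[of 0 E] subring_setD(1)[OF E]
      by (intro bexI[of _ 0] bexI[of _ f]) auto
  next
    case False
    define n where "n = Polynomial.degree f - Polynomial.degree g"
    define h where "h = Polynomial.monom (lead_coeff f) n"
    have h: "h \<in> polys_over E"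
      unfolding h_def using less.prems E by (intro polys_over_monom) (auto simp: polys_over_def)
    have h0: "h \<noteq> 0" using False by (simp add: h_def)
    have g0: "g \<noteq> 0" using g(2) by auto
    have deg: "Polynomial.degree (h * g) = Polynomial.degree f"
      using False h0 g0 by (simp add: degree_mult_eq) (simp add: h_def degree_monom_eq n_def)
    have lc: "lead_coeff (h * g) = lead_coeff f"
      using False by (simp add: lead_coeff_mult g(2)) (auto simp: h_def degree_monom_eq)
    have f': "f - h * g \<in> polys_over E" using polys_over_ops[OF E] less.prems h g by blast
    show ?thesis
    proof (cases "f - h * g = 0")
      case True
      thus ?thesis using h polys_over_const[of 0 E] subring_setD(1)[OF E]
        by (intro bexI[of _ h] bexI[of _ 0]) auto
    next
      case nz: False
      have "Polynomial.degree (f - h * g) < Polynomial.degree f"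
      proof -
        have "Polynomial.coeff (f - h * g) (Polynomial.degree f) = 0" using lc deg by simp
        moreover have "Polynomial.degree (f - h * g) \<le> Polynomial.degree f"
          using degree_diff_le_max[of f "h * g"] deg by simp
        ultimately show ?thesis using nz by (metis le_neq_implies_less leading_coeff_0_iff)
      qed
      then obtain q r where qr: "q \<in> polys_over E" "r \<in> polys_over E" "f - h * g = q * g + r"
        "r = 0 \<or> Polynomial.degree r < Polynomial.degree g" using less.hyps f' by blast
      have "f = (q + h) * g + r" using qr(3) by (simp add: algebra_simps)
      thus ?thesis using qr polys_over_ops(1)[OF E qr(1) h] by blast
    qed
  qed
qed

text \<open>A linear factor is cancelled from the power at each step: from \<open>f\<close> if y is
  a root of \<open>f\<close>, from the cofactor otherwise.\<close>

lemma dvd_linear_power_root: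
  fixes f :: "'k::field poly"
  assumes "f dvd [:- y, 1:] ^ n" "lead_coeff f = 1"
  shows "f = [:- y, 1:] ^ Polynomial.degree f"
  using assms
proof (induction n arbitrary: f)
  case 0
  hence "f dvd 1" "f \<noteq> 0" by auto
  hence "Polynomial.degree f = 0" by (simp add: is_unit_iff_degree)
  then obtain c where "f = [:c:]" by (rule degree_eq_zeroE)
  thus ?case using 0 by (simp add: one_pCons)
next
  case (Suc n)
  show ?case
  proof (cases "poly f y = 0")
    case True
    then obtain f1 where f1: "f = [:- y, 1:] * f1" by (metis poly_eq_0_iff_dvd dvd_def)
    have "[:- y, 1:] * f1 dvd [:- y, 1:] * [:- y, 1:] ^ n" using Suc.prems(1) by (simp only: f1 power_Suc)
    hence d: "f1 dvd [:- y, 1:] ^ n" by (subst (asm) dvd_mult_cancel_left) auto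
    have "lead_coeff [:- y, 1:] * lead_coeff f1 = 1" using Suc.prems(2) unfolding f1 lead_coeff_mult .
    hence lc: "lead_coeff f1 = 1" by simp
    have "f1 \<noteq> 0" using lc by auto
    hence "Polynomial.degree f = Suc (Polynomial.degree f1)"
      using degree_mult_eq[of "[:- y, 1:]" f1] unfolding f1 by simp
    thus ?thesis using Suc.IH[OF d lc] f1 by (simp only: power_Suc)
  next
    case False
    obtain h where h: "[:- y, 1:] ^ Suc n = f * h" using Suc.prems(1) by (auto simp: dvd_def)
    have "poly (f * h) y = 0" by (simp flip: h)
    hence "poly h y = 0" using False by simp
    then obtain h1 where h1: "h = [:- y, 1:] * h1" by (metis poly_eq_0_iff_dvd dvd_def)
    have "[:- y, 1:] * [:- y, 1:] ^ n = [:- y, 1:] * (f * h1)" using h by (simp only: h1 power_Suc mult_ac)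
    hence "[:- y, 1:] ^ n = f * h1" by (subst (asm) mult_cancel_left) auto
    thus ?thesis using Suc.IH[of f] Suc.prems(2) by (metis dvd_triv_left)
  qed
qed

text \<open>A minimal vanishing polynomial divides \<open>Y\<^sup>p - y\<^sup>p = (Y - y)\<^sup>p\<close>, so its second coefficient shows \<open>y \<in> E\<close>.\<close>

lemma polys_over_root_eq_0:
  fixes y :: "'k::field"
  assumes p: "CHAR('k) > 0" and E: "subfield_set E" and y: "y \<notin> E" "y ^ CHAR('k) \<in> E"
    and f: "f \<in> polys_over E" "Polynomial.degree f < CHAR('k)" "poly f y = 0"
  shows "f = 0"
proof (rule ccontr)
  assume f0: "f \<noteq> 0"
  note E' = subfield_setD(1)[OF E]
  define P where "P = (\<lambda>f. f \<in> polys_over E \<and> f \<noteq> 0 \<and> poly f y = 0)"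
  \<comment> \<open>A non-zero polynomial over \<open>E\<close> of least degree among those
    vanishing at \<open>y\<close>; made monic below, it is the minimal polynomial.\<close>
  define g where "g = arg_min Polynomial.degree P"
  have Pf: "P f" using f f0 by (simp add: P_def)
  have Pg: "P g" and min: "P h \<Longrightarrow> Polynomial.degree g \<le> Polynomial.degree h" for h
    unfolding g_def using arg_min_nat_lemma[of P f Polynomial.degree] Pf by auto
  define d where "d = Polynomial.degree g"
  have d: "d < CHAR('k)" using min[OF Pf] f by (simp add: d_def)
  define h where "h = Polynomial.smult (inverse (lead_coeff g)) g"
  have lc: "lead_coeff g \<noteq> 0" using Pg by (simp add: P_def)
  have h: "h \<in> polys_over E" "lead_coeff h = 1" "poly h y = 0" "Polynomial.degree h = d"
    using Pg lc by (auto simp: h_def P_def polys_over_def d_def subfield_setD[OF E])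
  have d0: "d > 0"
  proof (rule ccontr)
    assume "\<not> d > 0"
    then obtain c where "h = [:c:]" using h(4) degree_eq_zeroE by blast
    thus False using h by auto
  qed
  define G where "G = Polynomial.monom 1 CHAR('k) - [:y ^ CHAR('k):]"
  have G: "G = [:- y, 1:] ^ CHAR('k)"
  proof -
    have pr: "CHAR('k poly) > 0" using p by simp
    have "([:- y, 1:] + [:y:]) ^ CHAR('k poly) = [:- y, 1:] ^ CHAR('k poly) + [:y:] ^ CHAR('k poly)"
      by (rule freshmans_dream[OF prime_CHAR_semidom[OF pr] refl])
    moreover have "[:- y, 1:] + [:y:] = [:0, 1:]" by simp
    ultimately show ?thesis by (simp add: G_def poly_const_pow monom_altdef)
  qed
  have GE: "G \<in> polys_over E"
    unfolding G_def using y E' subfield_setD(2,3)[OF E]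
    by (intro polys_over_ops polys_over_monom polys_over_const) auto
  obtain q r where qr: "q \<in> polys_over E" "r \<in> polys_over E" "G = q * h + r"
    "r = 0 \<or> Polynomial.degree r < Polynomial.degree h"
    using polys_over_division[OF E' h(1,2) GE] by blast
  have "poly G y = 0" using p by (simp add: G)
  hence "poly r y = 0" using qr(3) h(3) by simp
  hence "r = 0" using qr(2,4) min[of r] h(4) by (fastforce simp: P_def d_def)
  hence "h dvd G" using qr(3) by simp
  hence hd: "h = [:- y, 1:] ^ d" using dvd_linear_power_root[of h y "CHAR('k)"] h(2,4) by (simp add: G)
  \<comment> \<open>For d = k + 1 this is the second-highest coefficient of (Y - y)^d. As 0 < d < p,
    the integer d is invertible in \<open>E\<close>, and y would lie in \<open>E\<close>.\<close>
  have co: "Polynomial.coeff ([:- y, 1:] ^ Suc k) k = - of_nat (Suc k) * y" for k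
  proof (induction k)
    case (Suc k)
    have "Polynomial.coeff ([:- y, 1:] ^ Suc k) (Suc k) = 1"
      using lead_coeff_power[of "[:- y, 1:]" "Suc k"] by (simp only: degree_linear_power) simp
    thus ?case using Suc by (simp add: algebra_simps)
  qed simp
  obtain k where k: "d = Suc k" using d0 gr0_implies_Suc by blast
  have "- of_nat d * y \<in> E" using h(1) co[of k] unfolding hd k polys_over_def by (metis mem_Collect_eq)
  moreover have "of_nat d \<noteq> (0 :: 'k)" using d d0 by (auto simp: of_nat_eq_0_iff_char_dvd dest: dvd_imp_le)
  moreover have "- of_nat d \<in> E" by (intro subfield_setD(8)[OF E] subring_set_of_nat[OF E'])
  ultimately have "(- of_nat d * y) / (- of_nat d) \<in> E" "of_nat d \<noteq> (0 :: 'k)"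
    using subfield_setD(9)[OF E] by blast+
  thus False using y(1) by simp
qed

section \<open>Adjoining a p-th root to a subfield\<close>

definition adjoin :: "'k::field set \<Rightarrow> 'k \<Rightarrow> 'k set"
  where "adjoin E y = (\<lambda>f. poly f y) ` polys_over E"

lemma adjoin_incl: "subring_set E \<Longrightarrow> E \<subseteq> adjoin E y" "subring_set E \<Longrightarrow> y \<in> adjoin E y"
proof -
  assume E: "subring_set E"
  show "E \<subseteq> adjoin E y"
  proof
    fix c assume "c \<in> E"
    hence "poly [:c:] y = c" "[:c:] \<in> polys_over E"
      using polys_over_const subring_setD(1)[OF E] by auto
    thus "c \<in> adjoin E y" unfolding adjoin_def by (metis imageI)
  qed
  have "poly (Polynomial.monom 1 1) y = y" "Polynomial.monom 1 1 \<in> polys_over E"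
    using polys_over_monom[of 1 E 1] subring_setD(2)[OF E] E by (auto simp: poly_monom)
  thus "y \<in> adjoin E y" unfolding adjoin_def by (metis imageI)
qed

lemma subring_set_adjoin:
  assumes E: "subring_set E"
  shows "subring_set (adjoin E y)"
  unfolding subring_set_def
proof (intro conjI ballI)
  show "0 \<in> adjoin E y" "1 \<in> adjoin E y" using adjoin_incl(1)[OF E] subring_setD[OF E] by auto
  fix u v assume "u \<in> adjoin E y" "v \<in> adjoin E y"
  then obtain f g where fg: "u = poly f y" "v = poly g y" "f \<in> polys_over E" "g \<in> polys_over E"
    by (auto simp: adjoin_def)
  have "u + v = poly (f + g) y" "u - v = poly (f - g) y" "u * v = poly (f * g) y" by (simp_all add: fg)
  thus "u + v \<in> adjoin E y" "u - v \<in> adjoin E y" "u * v \<in> adjoin E y"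
    unfolding adjoin_def using polys_over_ops[OF E fg(3,4)] by (metis imageI)+
qed

text \<open>The Frobenius map is additive, so for u = f(y) the power u^p is the sum of the c_i^p
  (y^p)^i, where the c_i are the coefficients of f.\<close>

lemma adjoin_pth_powers:
  assumes p: "CHAR('k) > 0" and E: "subfield_set E" and y: "(y :: 'k::field) ^ CHAR('k) \<in> E"
    and u: "u \<in> adjoin E y"
  shows "u ^ CHAR('k) \<in> E"
proof -
  note pr = prime_CHAR_semidom[OF p]
  obtain f where f: "f \<in> polys_over E" "u = poly f y" using u by (auto simp: adjoin_def)
  have "u ^ CHAR('k) = (\<Sum>i\<le>Polynomial.degree f. (Polynomial.coeff f i * y ^ i) ^ CHAR('k))"
    unfolding f(2) poly_altdef by (rule freshmans_dream_sum[OF pr refl])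
  also have "\<dots> = (\<Sum>i\<le>Polynomial.degree f. Polynomial.coeff f i ^ CHAR('k) * (y ^ CHAR('k)) ^ i)"
    by (simp add: power_mult_distrib power_mult flip: power_mult mult.commute[of "CHAR('k)"])
  also have "\<dots> \<in> E"
  proof (intro subring_set_sum subfield_setD(6)[OF E])
    note E' = subfield_setD(1)[OF E]
    show "subring_set E" by (rule E')
    show "Polynomial.coeff f i ^ CHAR('k) \<in> E" for i
      using f(1) by (intro subring_set_power[OF E']) (simp add: polys_over_def)
    show "(y ^ CHAR('k)) ^ i \<in> E" for i by (rule subring_set_power[OF E' y])
  qed
  finally show ?thesis .
qed

text \<open>Inverses come from 1/u = u^(p-1) / u^p, whose denominator lies in
  \<open>E\<close>.\<close>

lemma subfield_set_adjoin:
  assumes p: "CHAR('k) > 0" and E: "subfield_set E" and y: "(y :: 'k::field) ^ CHAR('k) \<in> E"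
  shows "subfield_set (adjoin E y)"
  unfolding subfield_set_def
proof (intro conjI ballI)
  show R: "subring_set (adjoin E y)" by (rule subring_set_adjoin[OF subfield_setD(1)[OF E]])
  fix u assume u: "u \<in> adjoin E y"
  obtain n where n: "CHAR('k) = Suc n" using p gr0_implies_Suc by blast
  have "inverse (u ^ CHAR('k)) \<in> adjoin E y"
    using subfield_setD(7)[OF E adjoin_pth_powers[OF p E y u]] adjoin_incl(1)[OF subfield_setD(1)[OF E]] by auto
  hence "u ^ n * inverse (u ^ CHAR('k)) \<in> adjoin E y"
    using R u by (intro subring_setD(5) subring_set_power)
  moreover have "u ^ n * inverse (u ^ CHAR('k)) = inverse u"
    by (cases "u = 0") (use p in \<open>auto simp: n field_simps\<close>)
  ultimately show "inverse u \<in> adjoin E y" by simp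
qed

lemma generate_field_insert:
  assumes p: "CHAR('k) > 0" and E: "subfield_set E" and y: "(y :: 'k::field) ^ CHAR('k) \<in> E"
  shows "generate_field type_ring (insert y E) = adjoin E y"
proof
  show "generate_field type_ring (insert y E) \<subseteq> adjoin E y"
    using adjoin_incl[OF subfield_setD(1)[OF E]]
    by (intro generate_field_least subfield_set_adjoin[OF p E y]) auto
  have G: "subring_set (generate_field type_ring (insert y E))"
    by (rule subfield_setD(1)[OF generate_field_subfield])
  show "adjoin E y \<subseteq> generate_field type_ring (insert y E)"
    unfolding adjoin_def poly_altdef using generate_field_incl[of "insert y E"]
    by (auto simp: polys_over_def intro!: subring_set_sum[OF G] subring_setD(5)[OF G] subring_set_power[OF G])
qed

text \<open>E(y) is the quotient of E[Y] by Y^p - y^p. Acting by \<delta> on coefficients and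
  sending Y to \<open>b\<close> kills this polynomial: \<delta> is zero on its coefficients, and its
  derivative in Y is p Y^(p-1) = 0. Hence the value at y can be prescribed freely.\<close>

lemma derivation_extend_adjoin:
  assumes p: "CHAR('k) > 0" and E: "subfield_set E" and y: "(y :: 'k::field) \<notin> E" "y ^ CHAR('k) \<in> E"
    and der: "derivation_on (\<lambda>x. x) E \<delta>" and dy: "\<delta> (y ^ CHAR('k)) = 0"
  shows "\<exists>\<delta>'. derivation_on (\<lambda>x. x) (adjoin E y) \<delta>' \<and> (\<forall>x\<in>E. \<delta>' x = \<delta> x) \<and> \<delta>' y = b"
proof -
  note E' = subfield_setD(1)[OF E]
  have \<delta>0: "\<delta> 0 = 0" by (rule derivation_0[OF embedding_id E' der])
  have \<delta>1: "\<delta> 1 = 0" by (rule derivation_1[OF embedding_id E' der])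
  note coeff_map = coeff_map_poly[of \<delta>, OF \<delta>0]
  define \<Delta> where "\<Delta> = (\<lambda>f. poly (map_poly \<delta> f) y + poly (pderiv f) y * b)"
  have add: "\<Delta> (f + g) = \<Delta> f + \<Delta> g" if "f \<in> polys_over E" "g \<in> polys_over E" for f g
  proof -
    have "map_poly \<delta> (f + g) = map_poly \<delta> f + map_poly \<delta> g"
      by (rule poly_eqI) (use that in \<open>simp add: coeff_map derivation_on_add[OF der] polys_over_def\<close>)
    thus ?thesis by (simp add: \<Delta>_def pderiv_add algebra_simps)
  qed
  have mult: "\<Delta> (f * g) = poly f y * \<Delta> g + poly g y * \<Delta> f" if "f \<in> polys_over E" "g \<in> polys_over E" for f g
  proof -
    have co: "Polynomial.coeff f i \<in> E" "Polynomial.coeff g i \<in> E" for i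
      using that by (auto simp: polys_over_def)
    have "map_poly \<delta> (f * g) = f * map_poly \<delta> g + map_poly \<delta> f * g"
    proof (rule poly_eqI)
      fix n
      have "\<delta> (Polynomial.coeff (f * g) n) =
          (\<Sum>i\<le>n. \<delta> (Polynomial.coeff f i * Polynomial.coeff g (n - i)))"
        unfolding coeff_mult
        by (rule derivation_sum[OF embedding_id E' der]) (use co in \<open>auto intro: subring_setD[OF E']\<close>)
      also have "\<dots> = (\<Sum>i\<le>n. Polynomial.coeff f i * \<delta> (Polynomial.coeff g (n - i)) +
          \<delta> (Polynomial.coeff f i) * Polynomial.coeff g (n - i))"
        by (intro sum.cong refl) (simp add: derivation_on_mult[OF der] co mult.commute)
      finally show "Polynomial.coeff (map_poly \<delta> (f * g)) n =
          Polynomial.coeff (f * map_poly \<delta> g + map_poly \<delta> f * g) n"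
        by (simp add: coeff_map coeff_mult sum.distrib)
    qed
    thus ?thesis by (simp add: \<Delta>_def pderiv_mult algebra_simps)
  qed
  define G where "G = Polynomial.monom 1 CHAR('k) - [:y ^ CHAR('k):]"
  have GE: "G \<in> polys_over E"
    unfolding G_def using y E' subfield_setD(2,3)[OF E]
    by (intro polys_over_ops polys_over_monom polys_over_const) auto
  have degG: "Polynomial.degree G = CHAR('k)" "lead_coeff G = 1"
  proof -
    have "Polynomial.degree (pCons (- (y ^ CHAR('k))) 0) < Polynomial.degree (Polynomial.monom (1::'k) CHAR('k))"
      using p by (simp add: degree_monom_eq)
    moreover have "G = Polynomial.monom 1 CHAR('k) + pCons (- (y ^ CHAR('k))) 0" by (simp add: G_def)
    ultimately show *: "Polynomial.degree G = CHAR('k)"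
      by (simp only: degree_add_eq_left) (simp add: degree_monom_eq)
    show "lead_coeff G = 1" unfolding * using p by (simp add: G_def coeff_pCons split: nat.split)
  qed
  have G0: "poly G y = 0" by (simp add: G_def poly_monom)
  have "\<Delta> G = 0"
  proof -
    have "\<delta> (y ^ CHAR('k) + - (y ^ CHAR('k))) = \<delta> (y ^ CHAR('k)) + \<delta> (- (y ^ CHAR('k)))"
      using y(2) subfield_setD(8)[OF E] by (intro derivation_on_add[OF der]) auto
    hence "\<delta> (- (y ^ CHAR('k))) = 0" using dy \<delta>0 by simp
    have "map_poly \<delta> G = 0"
      by (rule poly_eqI) (use p \<delta>0 \<delta>1 \<open>\<delta> (- (y ^ CHAR('k))) = 0\<close> in \<open>auto simp: coeff_map G_def coeff_pCons split: nat.split\<close>)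
    moreover have "pderiv G = 0" by (simp add: G_def pderiv_diff pderiv_monom pderiv_pCons)
    ultimately show ?thesis by (simp add: \<Delta>_def)
  qed
  \<comment> \<open>Division by \<open>G\<close> leaves a remainder of degree below p that vanishes
    at y, hence is zero by \<open>polys_over_root_eq_0\<close>; so \<open>G\<close> generates the
    kernel of evaluation.\<close>
  have ker: "\<Delta> f = 0" if f: "f \<in> polys_over E" "poly f y = 0" for f
  proof -
    obtain q r where qr: "q \<in> polys_over E" "r \<in> polys_over E" "f = q * G + r"
      "r = 0 \<or> Polynomial.degree r < Polynomial.degree G"
      using polys_over_division[OF E' GE degG(2) f(1)] by blast
    have "poly r y = 0" using qr(3) f(2) G0 by simp
    hence "r = 0" using polys_over_root_eq_0[OF p E y qr(2)] qr(4) degG by auto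
    hence "f = q * G" using qr(3) by simp
    thus ?thesis using mult[OF qr(1) GE] G0 \<open>\<Delta> G = 0\<close> by simp
  qed
  define \<delta>' where "\<delta>' = (\<lambda>u. \<Delta> (SOME f. f \<in> polys_over E \<and> poly f y = u))"
  have eq: "\<delta>' (poly f y) = \<Delta> f" if f: "f \<in> polys_over E" for f
  proof -
    define g where "g = (SOME g. g \<in> polys_over E \<and> poly g y = poly f y)"
    have g: "g \<in> polys_over E \<and> poly g y = poly f y" unfolding g_def by (rule someI[of _ f]) (use f in auto)
    hence fg: "f - g \<in> polys_over E" "poly (f - g) y = 0" using f polys_over_ops(2)[OF E'] by auto
    have "\<Delta> (g + (f - g)) = \<Delta> g + \<Delta> (f - g)" using g fg by (intro add) auto
    thus ?thesis using ker[OF fg] by (simp add: \<delta>'_def g_def)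
  qed
  have "derivation_on (\<lambda>x. x) (adjoin E y) \<delta>'"
    unfolding derivation_on_def
  proof (intro ballI)
    fix u v assume "u \<in> adjoin E y" "v \<in> adjoin E y"
    then obtain f g where fg: "u = poly f y" "v = poly g y" "f \<in> polys_over E" "g \<in> polys_over E"
      by (auto simp: adjoin_def)
    have "u + v = poly (f + g) y" "u * v = poly (f * g) y" by (simp_all add: fg)
    thus "\<delta>' (u + v) = \<delta>' u + \<delta>' v \<and> \<delta>' (u * v) = u * \<delta>' v + v * \<delta>' u"
      using eq polys_over_ops[OF E' fg(3,4)] add[OF fg(3,4)] mult[OF fg(3,4)] fg by metis
  qed
  moreover have "\<delta>' x = \<delta> x" if "x \<in> E" for x
    using eq[OF polys_over_const[OF that subfield_setD(2)[OF E]]] \<delta>0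
    by (simp add: \<Delta>_def map_poly_pCons pderiv_pCons)
  moreover have "\<delta>' y = b"
  proof -
    have "Polynomial.monom 1 1 \<in> polys_over E"
      by (rule polys_over_monom[OF subfield_setD(3)[OF E] E'])
    from eq[OF this] show ?thesis
      by (simp add: \<Delta>_def poly_monom map_poly_monom \<delta>0 \<delta>1 pderiv_monom)
  qed
  ultimately show ?thesis by blast
qed

lemma adjoin_least:
  assumes "subring_set S" "E \<subseteq> S" "y \<in> S"
  shows "adjoin E y \<subseteq> S"
  using assms
  by (auto simp: adjoin_def polys_over_def poly_altdef
      intro!: subring_set_sum subring_setD(5) subring_set_power)

text \<open>Zorn's lemma on pairs of an intermediate field and a derivation that is zero on
  \<open>C\<close> and 1 at \<open>x\<close>. Every y in \<open>E\<close> has y^p in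
  \<open>C\<close>, where the derivation is zero, so \<open>derivation_extend_adjoin\<close>
  enlarges any pair whose field is not yet \<open>E\<close>.\<close>

lemma exists_derivation:
  fixes x :: "'k::field"
  assumes p: "CHAR('k) > 0" and E: "subfield_set E" and C: "subfield_set C" "C \<subseteq> E"
    and pow: "\<And>u. u \<in> E \<Longrightarrow> u ^ CHAR('k) \<in> C" and x: "x \<in> E" "x \<notin> C"
  shows "\<exists>\<delta>. derivation_on (\<lambda>x. x) E \<delta> \<and> (\<forall>c\<in>C. \<delta> c = 0) \<and> \<delta> x = 1"
proof -
  define good where "good = (\<lambda>D \<delta>. subfield_set D \<and> C \<subseteq> D \<and> D \<subseteq> E \<and> x \<in> D \<and>
    derivation_on (\<lambda>x. x) D \<delta> \<and> (\<forall>c\<in>C. \<delta> c = 0) \<and> \<delta> x = 1)"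
  \<comment> \<open>A pair is encoded by its graph, so that inclusion of sets is extension of domain
    and derivation at once.\<close>
  define gr where "gr = (\<lambda>D (\<delta> :: 'k \<Rightarrow> 'k). (\<lambda>u. (u, \<delta> u)) ` D)"
  define \<A> where "\<A> = {gr D \<delta> | D \<delta>. good D \<delta>}"
  have ext: "\<exists>\<delta>'. derivation_on (\<lambda>x. x) (adjoin D y) \<delta>' \<and> (\<forall>x\<in>D. \<delta>' x = \<delta> x) \<and> \<delta>' y = 1"
    if D: "subfield_set D" "C \<subseteq> D" "derivation_on (\<lambda>x. x) D \<delta>" "\<forall>c\<in>C. \<delta> c = 0"
      and y: "y \<in> E" "y \<notin> D" for D \<delta> y
    using derivation_extend_adjoin[OF p D(1) y(2) subsetD[OF D(2) pow[OF y(1)]] D(3), of 1]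
      D(4) pow[OF y(1)] by blast
  have adj: "subfield_set (adjoin D y)" "adjoin D y \<subseteq> E" "D \<subseteq> adjoin D y" "y \<in> adjoin D y"
    if D: "subfield_set D" "C \<subseteq> D" "D \<subseteq> E" and y: "y \<in> E" for D y
    using subfield_set_adjoin[OF p D(1)] pow[OF y] D(2) y
      adjoin_least[OF subfield_setD(1)[OF E] D(3) y] adjoin_incl[OF subfield_setD(1)[OF D(1)]]
    by blast+
  have "\<exists>M\<in>\<A>. \<forall>M1\<in>\<A>. M \<subseteq> M1 \<longrightarrow> M1 = M"
  proof (rule subset_Zorn_nonempty)
    \<comment> \<open>The family contains C(x): the zero derivation of \<open>C\<close>, extended by
      the value 1 at \<open>x\<close>.\<close>
    have "derivation_on (\<lambda>x. x) C (\<lambda>_. 0)" by (simp add: derivation_on_def)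
    then obtain \<delta> where \<delta>: "derivation_on (\<lambda>x. x) (adjoin C x) \<delta>" "\<forall>x\<in>C. \<delta> x = 0" "\<delta> x = 1"
      using ext[OF C(1) order.refl, of "\<lambda>_. 0" x] x by auto
    hence "good (adjoin C x) \<delta>" using adj[OF C(1) order.refl C(2) x(1)] by (simp add: good_def)
    thus "\<A> \<noteq> {}" by (auto simp: \<A>_def)
  next
    fix \<C> assume ne: "\<C> \<noteq> {}" and ch: "subset.chain \<A> \<C>"
    define U where "U = \<Union>\<C>"
    define D where "D = fst ` U"
    define \<delta> where "\<delta> = (\<lambda>u. SOME v. (u, v) \<in> U)"
    \<comment> \<open>Members of a chain are comparable, so any two points of the union lie in one
      common graph. Closure under the field operations and the derivation rules are checked
      there.\<close>
    have two: "\<exists>D1 \<delta>1. good D1 \<delta>1 \<and> gr D1 \<delta>1 \<subseteq> U \<and> a \<in> gr D1 \<delta>1 \<and> b \<in> gr D1 \<delta>1"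
      if ab: "a \<in> U" "b \<in> U" for a b
    proof -
      obtain M1 M2 where M12: "M1 \<in> \<C>" "M2 \<in> \<C>" "a \<in> M1" "b \<in> M2" using ab by (auto simp: U_def)
      hence "M1 \<subseteq> M2 \<or> M2 \<subseteq> M1" using ch by (auto simp: subset.chain_def)
      then obtain Z where Z: "Z \<in> \<C>" "a \<in> Z" "b \<in> Z" using M12 by blast
      moreover have "Z \<in> \<A>" using Z ch by (auto simp: subset.chain_def)
      ultimately show ?thesis unfolding \<A>_def U_def by blast
    qed
    have single: "v = v'" if "(u, v) \<in> U" "(u, v') \<in> U" for u v v'
      using two[OF that] by (auto simp: gr_def)
    have \<delta>: "\<delta> u = v" if "(u, v) \<in> U" for u v
      unfolding \<delta>_def by (rule some_equality) (use that single in auto)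
    have sub: "D1 \<subseteq> D \<and> (\<forall>u\<in>D1. \<delta> u = \<delta>1 u)" if "gr D1 \<delta>1 \<subseteq> U" for D1 \<delta>1
    proof (intro conjI ballI subsetI)
      fix u assume "u \<in> D1"
      hence u: "(u, \<delta>1 u) \<in> U" using that by (auto simp: gr_def)
      thus "u \<in> D" unfolding D_def by force
      show "\<delta> u = \<delta>1 u" using \<delta>[OF u] .
    qed
    have two': "\<exists>D1 \<delta>1. good D1 \<delta>1 \<and> D1 \<subseteq> D \<and> (\<forall>u\<in>D1. \<delta> u = \<delta>1 u) \<and> u \<in> D1 \<and> v \<in> D1"
      if uv: "u \<in> D" "v \<in> D" for u v
    proof -
      obtain a b where ab: "a \<in> U" "b \<in> U" "u = fst a" "v = fst b" using uv by (auto simp: D_def)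
      from two[OF ab(1,2)] obtain D1 \<delta>1 where g: "good D1 \<delta>1" "gr D1 \<delta>1 \<subseteq> U"
        "a \<in> gr D1 \<delta>1" "b \<in> gr D1 \<delta>1" by blast
      moreover have "u \<in> D1" "v \<in> D1" using g ab by (auto simp: gr_def)
      ultimately show ?thesis using sub[OF g(2)] by blast
    qed
    have "U \<noteq> {}"
    proof -
      obtain M1 where "M1 \<in> \<C>" using ne by blast
      moreover hence "M1 \<in> \<A>" using ch by (auto simp: subset.chain_def)
      ultimately show ?thesis unfolding \<A>_def U_def good_def gr_def by blast
    qed
    then obtain a where "a \<in> U" by blast
    from two[OF this this] obtain D0 \<delta>0 where D0: "good D0 \<delta>0" "gr D0 \<delta>0 \<subseteq> U" by blast
    have closed: "u + v \<in> D \<and> u - v \<in> D \<and> u * v \<in> D \<and> inverse u \<in> D \<and>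
      \<delta> (u + v) = \<delta> u + \<delta> v \<and> \<delta> (u * v) = u * \<delta> v + v * \<delta> u" if uv: "u \<in> D" "v \<in> D" for u v
    proof -
      obtain D1 \<delta>1 where g: "good D1 \<delta>1" "D1 \<subseteq> D" "\<forall>u\<in>D1. \<delta> u = \<delta>1 u" "u \<in> D1" "v \<in> D1"
        using two'[OF uv] by blast
      have D1: "subfield_set D1" "derivation_on (\<lambda>x. x) D1 \<delta>1" using g(1) by (auto simp: good_def)
      have "u + v \<in> D1" "u - v \<in> D1" "u * v \<in> D1" "inverse u \<in> D1" using g subfield_setD[OF D1(1)] by auto
      thus ?thesis
        using g derivation_on_add[OF D1(2), of u v] derivation_on_mult[OF D1(2), of u v] by auto
    qed
    have "good D \<delta>"
      unfolding good_def
    proof (intro conjI)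
      show "C \<subseteq> D" "x \<in> D" "\<forall>c\<in>C. \<delta> c = 0" "\<delta> x = 1"
        using sub[OF D0(2)] D0(1) by (auto simp: good_def)
      show "D \<subseteq> E" using two' unfolding good_def by blast
      have "0 \<in> D" "1 \<in> D" using \<open>C \<subseteq> D\<close> subfield_setD[OF C(1)] by auto
      thus "subfield_set D" using closed by (auto simp: subfield_set_def subring_set_def)
      show "derivation_on (\<lambda>x. x) D \<delta>" using closed by (auto simp: derivation_on_def)
    qed
    moreover have "U = gr D \<delta>"
    proof
      show "U \<subseteq> gr D \<delta>"
      proof
        fix a assume a: "a \<in> U"
        obtain u v where uv: "a = (u, v)" by (cases a)
        have "u \<in> D" "\<delta> u = v" using a \<delta> unfolding uv D_def by force+
        thus "a \<in> gr D \<delta>" by (auto simp: uv gr_def)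
      qed
      show "gr D \<delta> \<subseteq> U" using \<delta> by (fastforce simp: gr_def D_def)
    qed
    ultimately show "\<Union>\<C> \<in> \<A>" unfolding \<A>_def U_def[symmetric] by auto
  qed
  then obtain M where M: "M \<in> \<A>" "\<And>M1. M1 \<in> \<A> \<Longrightarrow> M \<subseteq> M1 \<Longrightarrow> M1 = M" by auto
  then obtain D \<delta> where D: "good D \<delta>" "M = gr D \<delta>" by (auto simp: \<A>_def)
  have max: "gr D' \<delta>' = gr D \<delta>" if "good D' \<delta>'" "gr D \<delta> \<subseteq> gr D' \<delta>'" for D' \<delta>'
    using M(2)[of "gr D' \<delta>'"] that by (auto simp: \<A>_def D(2))
  have D': "subfield_set D" "C \<subseteq> D" "D \<subseteq> E" "x \<in> D" "derivation_on (\<lambda>x. x) D \<delta>" "\<forall>c\<in>C. \<delta> c = 0" "\<delta> x = 1"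
    using D by (auto simp: good_def)
  have "E \<subseteq> D"
  proof
    fix y assume y: "y \<in> E"
    show "y \<in> D"
    proof (rule ccontr)
      assume nD: "y \<notin> D"
      obtain \<delta>' where \<delta>': "derivation_on (\<lambda>x. x) (adjoin D y) \<delta>'" "\<forall>x\<in>D. \<delta>' x = \<delta> x"
        using ext[OF D'(1,2,5,6) y nD] by blast
      note a = adj[OF D'(1-3) y]
      have "good (adjoin D y) \<delta>'" using a \<delta>' D' by (auto simp: good_def)
      moreover have "gr D \<delta> \<subseteq> gr (adjoin D y) \<delta>'" using a(3) \<delta>'(2) by (auto simp: gr_def image_iff)
      ultimately have "gr (adjoin D y) \<delta>' = gr D \<delta>" by (rule max)
      hence "fst ` gr (adjoin D y) \<delta>' = fst ` gr D \<delta>" by (rule arg_cong)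
      hence "adjoin D y = D" by (simp add: gr_def image_image)
      thus False using a(4) nD by blast
    qed
  qed
  thus ?thesis using D' by auto
qed

section \<open>Derivations of polynomial rings\<close>

text \<open>The carrier of \<open>mpoly_ring E m\<close> with an arbitrary set of variables in place
  of \<open>{..<m}\<close>; the other use is the ring in the X_ij.\<close>

definition mpolys_over :: "'c::field set \<Rightarrow> 'v set \<Rightarrow> (('v \<Rightarrow>\<^sub>0 nat) \<Rightarrow>\<^sub>0 'c) set"
  where "mpolys_over E V = {P. (\<forall>\<alpha>. Poly_Mapping.lookup P \<alpha> \<in> E) \<and>
    (\<forall>\<alpha>\<in>Poly_Mapping.keys P. Poly_Mapping.keys \<alpha> \<subseteq> V)}"

abbreviation mon :: "('v \<Rightarrow>\<^sub>0 nat) \<Rightarrow> ('v \<Rightarrow>\<^sub>0 nat) \<Rightarrow>\<^sub>0 'c::field"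
  where "mon \<alpha> \<equiv> Poly_Mapping.single \<alpha> 1"

lemma mpolys_over_single:
  "0 \<in> E \<Longrightarrow> c \<in> E \<Longrightarrow> Poly_Mapping.keys \<alpha> \<subseteq> V \<Longrightarrow> Poly_Mapping.single \<alpha> c \<in> mpolys_over E V"
  by (auto simp: mpolys_over_def lookup_single when_def split: if_splits)

lemma mpolys_over_add:
  "subring_set E \<Longrightarrow> P \<in> mpolys_over E V \<Longrightarrow> Q \<in> mpolys_over E V \<Longrightarrow> P + Q \<in> mpolys_over E V"
  using keys_add[of P Q] by (auto simp: mpolys_over_def lookup_add subring_setD subset_iff)

lemma mpolys_over_induct [consumes 2, case_names zero add]:
  assumes "0 \<in> E" "P \<in> mpolys_over E V"
    and "Q 0" and add: "\<And>\<alpha> c P. c \<in> E \<Longrightarrow> Poly_Mapping.keys \<alpha> \<subseteq> V \<Longrightarrow> P \<in> mpolys_over E V \<Longrightarrow> Q P \<Longrightarrow>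
      Q (Poly_Mapping.single \<alpha> c + P)"
  shows "Q P"
  using assms(2)
proof (induction "card (Poly_Mapping.keys P)" arbitrary: P)
  case 0
  thus ?case using assms(3) by simp
next
  case (Suc n)
  then obtain k where k: "k \<in> Poly_Mapping.keys P"
    by (metis card.empty ex_in_conv nat.distinct(1))
  define g where "g = Poly_Mapping.update k 0 P"
  have kg: "Poly_Mapping.keys g = Poly_Mapping.keys P - {k}"
    by (auto simp: g_def keys_update)
  hence c: "n = card (Poly_Mapping.keys g)" using k Suc(2) by simp
  have gm: "g \<in> mpolys_over E V"
    using Suc.prems kg assms(1) by (auto simp: mpolys_over_def g_def lookup_update)
  have "P = Poly_Mapping.single k (Poly_Mapping.lookup P k) + g"
    by (rule poly_mapping_eqI) (auto simp: g_def lookup_add lookup_update lookup_single when_def)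
  moreover have "Q (Poly_Mapping.single k (Poly_Mapping.lookup P k) + g)"
    using Suc.prems k by (intro add gm Suc.hyps(1)[OF c gm]) (auto simp: mpolys_over_def)
  ultimately show ?case by simp
qed

lemma mpolys_over_mult:
  assumes E: "subring_set E" and P: "P \<in> mpolys_over E V" and Q: "Q \<in> mpolys_over E V"
  shows "P * Q \<in> mpolys_over E V"
  using subring_setD(1)[OF E] P
proof (induction P rule: mpolys_over_induct)
  case zero
  show ?case using subring_setD[OF E] by (simp add: mpolys_over_def)
next
  case (add \<alpha> c P)
  have "Poly_Mapping.single \<alpha> c * Q \<in> mpolys_over E V"
    using subring_setD(1)[OF E] Q
  proof (induction Q rule: mpolys_over_induct)
    case zero
    show ?case using subring_setD[OF E] by (simp add: mpolys_over_def)
  next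
    case (add \<beta> d Q)
    have "Poly_Mapping.keys (\<alpha> + \<beta>) \<subseteq> V"
      using keys_add[of \<alpha> \<beta>] add \<open>Poly_Mapping.keys \<alpha> \<subseteq> V\<close> by blast
    thus ?case using add \<open>c \<in> E\<close>
      by (simp add: distrib_left mult_single mpolys_over_add[OF E] mpolys_over_single subring_setD[OF E])
  qed
  thus ?case using add by (simp add: distrib_right mpolys_over_add[OF E])
qed

lemma mpolys_over_diff:
  assumes "subring_set E" "P \<in> mpolys_over E V" "Q \<in> mpolys_over E V"
  shows "P - Q \<in> mpolys_over E V"
proof -
  have "Poly_Mapping.keys (P - Q) \<subseteq> Poly_Mapping.keys P \<union> Poly_Mapping.keys Q"
    by (auto simp: in_keys_iff lookup_minus)
  thus ?thesis
    using assms subring_setD[OF assms(1)] by (auto simp: mpolys_over_def lookup_minus subset_iff)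
qed

lemma subring_set_eval_image:
  assumes emb: "field_embedding \<iota>" and E: "subring_set E"
    and e_add: "\<And>P Q. P \<in> mpolys_over E V \<Longrightarrow> Q \<in> mpolys_over E V \<Longrightarrow> e (P + Q) = e P + e Q"
    and e_mult: "\<And>P Q. P \<in> mpolys_over E V \<Longrightarrow> Q \<in> mpolys_over E V \<Longrightarrow> e (P * Q) = e P * e Q"
    and e_const: "\<And>c. c \<in> E \<Longrightarrow> e (Poly_Mapping.single 0 c) = \<iota> c"
  shows "subring_set (e ` mpolys_over E V)"
  unfolding subring_set_def
proof (intro conjI ballI)
  have const: "\<iota> c \<in> e ` mpolys_over E V" if "c \<in> E" for c
    unfolding e_const[OF that, symmetric]
    by (intro imageI mpolys_over_single subring_setD[OF E] that) simp
  show "0 \<in> e ` mpolys_over E V" "1 \<in> e ` mpolys_over E V"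
    using const[OF subring_setD(1)[OF E]] const[OF subring_setD(2)[OF E]] field_embeddingD[OF emb] by simp_all
  fix x y assume "x \<in> e ` mpolys_over E V" "y \<in> e ` mpolys_over E V"
  then obtain P Q where xy: "x = e P" "y = e Q" and PQ: "P \<in> mpolys_over E V" "Q \<in> mpolys_over E V" by blast
  have "x + y = e (P + Q)" "x * y = e (P * Q)" "x - y = e (P - Q)"
    using e_add[OF PQ] e_mult[OF PQ] e_add[OF mpolys_over_diff[OF E PQ] PQ(2)] by (simp_all add: xy)
  thus "x + y \<in> e ` mpolys_over E V" "x - y \<in> e ` mpolys_over E V" "x * y \<in> e ` mpolys_over E V"
    using mpolys_over_add[OF E PQ] mpolys_over_mult[OF E PQ] mpolys_over_diff[OF E PQ] by simp_all
qed

lemma pm_sum_superset: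
  assumes "finite A" "Poly_Mapping.keys f \<subseteq> A" "\<And>k. h k 0 = 0"
  shows "pm_sum h f = (\<Sum>k\<in>A. h k (Poly_Mapping.lookup f k))"
  unfolding pm_sum_def by (rule sum.mono_neutral_left) (use assms in \<open>auto simp: in_keys_iff\<close>)

lemma pm_sum_add_on:
  assumes zero: "\<And>k. h k 0 = 0" and add: "\<And>k x y. x \<in> E \<Longrightarrow> y \<in> E \<Longrightarrow> h k (x + y) = h k x + h k y"
    and "f \<in> mpolys_over E V" "g \<in> mpolys_over E V"
  shows "pm_sum h (f + g) = pm_sum h f + pm_sum h g"
proof -
  let ?A = "Poly_Mapping.keys f \<union> Poly_Mapping.keys g"
  have "pm_sum h (f + g) = (\<Sum>k\<in>?A. h k (Poly_Mapping.lookup (f + g) k))"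
    by (rule pm_sum_superset) (use zero keys_add[of f g] in auto)
  also have "\<dots> = (\<Sum>k\<in>?A. h k (Poly_Mapping.lookup f k)) + (\<Sum>k\<in>?A. h k (Poly_Mapping.lookup g k))"
    using assms(3,4) by (simp add: lookup_add add mpolys_over_def sum.distrib)
  also have "\<dots> = pm_sum h f + pm_sum h g"
    using pm_sum_superset[of ?A f h] pm_sum_superset[of ?A g h] zero by simp
  finally show ?thesis .
qed

text \<open>
  The derivation acts on coefficients only, the variables being constants.  It descends to the image
  of the polynomial ring once it respects the kernel of the evaluation homomorphism \<open>e\<close>.
\<close>

lemma derivation_extend_polys:
  fixes e :: "(('v \<Rightarrow>\<^sub>0 nat) \<Rightarrow>\<^sub>0 'c::field) \<Rightarrow> 'k::field"
  assumes emb: "field_embedding \<iota>" and E: "subring_set E" and der: "derivation_on \<iota> E \<delta>"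
    and e_add: "\<And>P Q. P \<in> mpolys_over E V \<Longrightarrow> Q \<in> mpolys_over E V \<Longrightarrow> e (P + Q) = e P + e Q"
    and e_mult: "\<And>P Q. P \<in> mpolys_over E V \<Longrightarrow> Q \<in> mpolys_over E V \<Longrightarrow> e (P * Q) = e P * e Q"
    and e_const: "\<And>c. c \<in> E \<Longrightarrow> e (Poly_Mapping.single 0 c) = \<iota> c"
  defines "\<Delta> \<equiv> pm_sum (\<lambda>\<alpha> c. \<delta> c * e (mon \<alpha>))"
  shows "\<And>P Q. P \<in> mpolys_over E V \<Longrightarrow> Q \<in> mpolys_over E V \<Longrightarrow> \<Delta> (P + Q) = \<Delta> P + \<Delta> Q"
    and "\<And>P Q. P \<in> mpolys_over E V \<Longrightarrow> Q \<in> mpolys_over E V \<Longrightarrow> \<Delta> (P * Q) = e P * \<Delta> Q + e Q * \<Delta> P"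
    and "\<And>\<alpha> c. c \<in> E \<Longrightarrow> \<Delta> (Poly_Mapping.single \<alpha> c) = \<delta> c * e (mon \<alpha>)"
    and "(\<And>P. P \<in> mpolys_over E V \<Longrightarrow> e P = 0 \<Longrightarrow> \<Delta> P = 0) \<Longrightarrow>
      \<exists>\<delta>'. derivation_on (\<lambda>x. x) (fractions (e ` mpolys_over E V)) \<delta>' \<and> (\<forall>c\<in>E. \<delta>' (\<iota> c) = \<delta> c)"
proof -
  note E0 = subring_setD(1)[OF E] and E1 = subring_setD(2)[OF E]
  have \<delta>0: "\<delta> 0 = 0" by (rule derivation_0[OF emb E der])
  have m0: "0 \<in> mpolys_over E V" using E0 by (simp add: mpolys_over_def)
  have e0: "e 0 = 0" using e_const[OF E0] by (simp add: field_embeddingD[OF emb])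
  show add: "\<Delta> (P + Q) = \<Delta> P + \<Delta> Q" if "P \<in> mpolys_over E V" "Q \<in> mpolys_over E V" for P Q
    unfolding \<Delta>_def
    by (rule pm_sum_add_on[OF _ _ that]) (simp_all add: \<delta>0 derivation_on_add[OF der] distrib_right)
  show single: "\<Delta> (Poly_Mapping.single \<alpha> c) = \<delta> c * e (mon \<alpha>)" if "c \<in> E" for \<alpha> c
    unfolding \<Delta>_def by (rule pm_sum_single) (simp add: \<delta>0)
  have e_single: "e (Poly_Mapping.single \<alpha> c) = \<iota> c * e (mon \<alpha>)"
    if "c \<in> E" "Poly_Mapping.keys \<alpha> \<subseteq> V" for \<alpha> c
    using e_mult[OF mpolys_over_single[OF E0 that(1), of 0] mpolys_over_single[OF E0 E1 that(2)]]
      e_const[OF that(1)] by (simp add: mult_single)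
  have \<Delta>0: "\<Delta> 0 = 0" by (simp add: \<Delta>_def)
  show mult: "\<Delta> (P * Q) = e P * \<Delta> Q + e Q * \<Delta> P" if P: "P \<in> mpolys_over E V" and Q: "Q \<in> mpolys_over E V" for P Q
    using E0 P
  proof (induction P rule: mpolys_over_induct)
    case (add \<alpha> c P)
    have s: "Poly_Mapping.single \<alpha> c \<in> mpolys_over E V" using add E0 by (intro mpolys_over_single)
    have "\<Delta> (Poly_Mapping.single \<alpha> c * Q) = e (Poly_Mapping.single \<alpha> c) * \<Delta> Q + e Q * \<Delta> (Poly_Mapping.single \<alpha> c)"
      using E0 Q
    proof (induction Q rule: mpolys_over_induct)
      case (add \<beta> d Q)
      have s': "Poly_Mapping.single \<beta> d \<in> mpolys_over E V" using add E0 by (intro mpolys_over_single)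
      have em: "e (mon (\<alpha> + \<beta>)) = e (mon \<alpha>) * e (mon \<beta>)"
        using e_mult[OF mpolys_over_single[OF E0 E1 \<open>Poly_Mapping.keys \<alpha> \<subseteq> V\<close>]
            mpolys_over_single[OF E0 E1 \<open>Poly_Mapping.keys \<beta> \<subseteq> V\<close>]]
        by (simp add: mult_single)
      have "\<Delta> (Poly_Mapping.single \<alpha> c * Poly_Mapping.single \<beta> d) = (\<iota> c * \<delta> d + \<iota> d * \<delta> c) * (e (mon \<alpha>) * e (mon \<beta>))"
        using single[OF subring_setD(5)[OF E \<open>c \<in> E\<close> \<open>d \<in> E\<close>], of "\<alpha> + \<beta>"]
          derivation_on_mult[OF der \<open>c \<in> E\<close> \<open>d \<in> E\<close>] by (simp add: mult_single em)
      thus ?case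
        using add \<open>c \<in> E\<close> \<open>Poly_Mapping.keys \<alpha> \<subseteq> V\<close> s s' mpolys_over_mult[OF E s s'] mpolys_over_mult[OF E s add(3)]
        by (simp add: distrib_left \<open>\<And>P Q. P \<in> mpolys_over E V \<Longrightarrow> Q \<in> mpolys_over E V \<Longrightarrow> \<Delta> (P + Q) = \<Delta> P + \<Delta> Q\<close>
            e_add single e_single algebra_simps)
    qed (simp add: \<Delta>0 e0)
    thus ?case
      using add s mpolys_over_mult[OF E s Q] mpolys_over_mult[OF E add(3) Q]
      by (simp add: distrib_right \<open>\<And>P Q. P \<in> mpolys_over E V \<Longrightarrow> Q \<in> mpolys_over E V \<Longrightarrow> \<Delta> (P + Q) = \<Delta> P + \<Delta> Q\<close>
          e_add algebra_simps)
  qed (simp add: \<Delta>0 e0)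
  assume ker: "\<And>P. P \<in> mpolys_over E V \<Longrightarrow> e P = 0 \<Longrightarrow> \<Delta> P = 0"
  have minus: "P - Q \<in> mpolys_over E V" "e (P - Q) = e P - e Q" "\<Delta> (P - Q) = \<Delta> P - \<Delta> Q"
    if "P \<in> mpolys_over E V" "Q \<in> mpolys_over E V" for P Q
  proof -
    show m: "P - Q \<in> mpolys_over E V" by (rule mpolys_over_diff[OF E that])
    show "e (P - Q) = e P - e Q" using e_add[OF m that(2)] by simp
    show "\<Delta> (P - Q) = \<Delta> P - \<Delta> Q" using add[OF m that(2)] by simp
  qed
  \<comment> \<open>Any preimage may be chosen: two of them differ by an element of the kernel of
    \<open>e\<close>, which \<Delta> kills by assumption.\<close>
  define \<delta>' where "\<delta>' = (\<lambda>u. \<Delta> (SOME P. P \<in> mpolys_over E V \<and> e P = u))"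
  have eq: "\<delta>' (e P) = \<Delta> P" if P: "P \<in> mpolys_over E V" for P
  proof -
    define Q where "Q = (SOME Q. Q \<in> mpolys_over E V \<and> e Q = e P)"
    have Q: "Q \<in> mpolys_over E V \<and> e Q = e P" unfolding Q_def by (rule someI[of _ P]) (use P in auto)
    hence "e (P - Q) = 0" using minus[OF P] by simp
    hence "\<Delta> (P - Q) = 0" using ker minus(1)[OF P] Q by blast
    thus ?thesis using minus(3)[OF P] Q by (simp add: \<delta>'_def Q_def)
  qed
  let ?S = "e ` mpolys_over E V"
  have S: "subring_set ?S"
    using e_add e_mult e_const by (rule subring_set_eval_image[OF emb E])
  have "derivation_on (\<lambda>x. x) ?S \<delta>'"
    unfolding derivation_on_def
  proof (intro ballI)
    fix x y assume "x \<in> ?S" "y \<in> ?S"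
    then obtain P Q where xy: "x = e P" "y = e Q" and PQ: "P \<in> mpolys_over E V" "Q \<in> mpolys_over E V" by blast
    show "\<delta>' (x + y) = \<delta>' x + \<delta>' y \<and> \<delta>' (x * y) = x * \<delta>' y + y * \<delta>' x"
      using eq[OF mpolys_over_add[OF E PQ]] eq[OF mpolys_over_mult[OF E PQ]] eq[OF PQ(1)] eq[OF PQ(2)]
        e_add[OF PQ] e_mult[OF PQ] add[OF PQ] mult[OF PQ] by (simp add: xy)
  qed
  from derivation_extend_fractions[OF S this] obtain \<delta>'' where
    \<delta>'': "derivation_on (\<lambda>x. x) (fractions ?S) \<delta>''" "\<And>x. x \<in> ?S \<Longrightarrow> \<delta>'' x = \<delta>' x" by blast
  have "e (Poly_Mapping.single 0 1) = 1" using e_const[OF E1] by (simp add: field_embeddingD[OF emb])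
  hence "\<delta>'' (\<iota> c) = \<delta> c" if "c \<in> E" for c
    using \<delta>''(2)[of "\<iota> c"] eq[OF mpolys_over_single[OF E0 that, of 0]] e_const[OF that] single[OF that, of 0]
      mpolys_over_single[OF E0 that, of 0 V] by (metis empty_subsetI imageI keys_zero mult.right_neutral)
  thus "\<exists>\<delta>'. derivation_on (\<lambda>x. x) (fractions ?S) \<delta>' \<and> (\<forall>c\<in>E. \<delta>' (\<iota> c) = \<delta> c)"
    using \<delta>''(1) by blast
qed

section \<open>Function fields\<close>

lemma mpoly_ring_simps:
  "carrier (mpoly_ring E n) = mpolys_over E {..<n}" "monoid.mult (mpoly_ring E n) = (*)"
  "monoid.one (mpoly_ring E n) = 1" "ring.zero (mpoly_ring E n) = 0" "add (mpoly_ring E n) = (+)"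
  by (simp_all add: mpoly_ring_def mpolys_over_def)

lemma cring_mpoly_ring:
  assumes E: "subring_set (E :: 'k::field set)"
  shows "cring (mpoly_ring E n)"
proof -
  interpret cring "type_ring :: ((nat \<Rightarrow>\<^sub>0 nat) \<Rightarrow>\<^sub>0 'k) ring" by (rule cring_from_type_algebra)
  let ?S = "mpolys_over E {..<n}"
  have neg: "- P \<in> ?S" if "P \<in> ?S" for P
    using that subring_set_uminus[OF E] by (auto simp: mpolys_over_def)
  have one: "1 \<in> ?S"
    using mpolys_over_single[of E 1 0 "{..<n}"] subring_setD[OF E] by simp
  have "subring ?S type_ring"
    by (rule subringI) (auto simp: neg one mpolys_over_add[OF E] mpolys_over_mult[OF E])
  hence "subcring ?S type_ring" by (rule subcringI')
  hence "cring (type_ring \<lparr>carrier := ?S\<rparr>)" using subcring_iff[of ?S] by simp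
  thus ?thesis by (simp add: mpoly_ring_def mpolys_over_def)
qed

lemma pform_poly_in:
  assumes cs: "set cs \<subseteq> E" and E: "subring_set E"
  shows "pform_poly (cs :: 'k::field list) \<in> mpolys_over E {..<length cs}"
proof -
  have z: "0 \<in> mpolys_over E {..<length cs}" using subring_setD(1)[OF E] by (simp add: mpolys_over_def)
  have s: "Poly_Mapping.single (Poly_Mapping.single j CHAR('k)) (cs ! j) \<in> mpolys_over E {..<length cs}"
    if "j < length cs" for j
    using that cs subring_setD(1)[OF E] by (intro mpolys_over_single) auto
  have "(\<Sum>j\<in>J. Poly_Mapping.single (Poly_Mapping.single j CHAR('k)) (cs ! j)) \<in> mpolys_over E {..<length cs}"
    if "finite J" "J \<subseteq> {..<length cs}" for J
    using that by (induction J rule: finite_induct) (auto intro: mpolys_over_add[OF E] z s)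
  thus ?thesis by (simp add: pform_poly_def)
qed



text \<open>Puts both branches of \<open>is_function_field\<close> into one shape, a ring
  homomorphism on polynomials. The case distinction survives only in the last two clauses: the form
  is sent to 0 if the norm degree exceeds 1, and the kernel is either zero or consists of multiples
  of the form.\<close>

lemma function_field_hom:
  assumes E: "subfield_set (E :: 'k::field set)" and cs: "set cs \<subseteq> E" and L: "is_function_field E cs L"
  obtains e where
    "\<And>P Q. P \<in> mpolys_over E {..<length cs} \<Longrightarrow> Q \<in> mpolys_over E {..<length cs} \<Longrightarrow> e (P + Q) = e P + e Q"
    "\<And>P Q. P \<in> mpolys_over E {..<length cs} \<Longrightarrow> Q \<in> mpolys_over E {..<length cs} \<Longrightarrow> e (P * Q) = e P * e Q"
    "\<And>c. c \<in> E \<Longrightarrow> e (Poly_Mapping.single 0 c) = c"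
    "L = fractions (e ` mpolys_over E {..<length cs})"
    "norm_degree E cs > 1 \<Longrightarrow> e (pform_poly cs) = 0"
    "\<And>P. P \<in> mpolys_over E {..<length cs} \<Longrightarrow> e P = 0 \<Longrightarrow>
       P = 0 \<or> e (pform_poly cs) = 0 \<and> (\<exists>Q\<in>mpolys_over E {..<length cs}. P = Q * pform_poly cs)"
proof (cases "norm_degree E cs > 1")
  case False
  then obtain e where e: "is_quotient_field (mpoly_ring E (length cs)) e L"
    "\<forall>c\<in>E. e (mpoly_const c) = c"
    using L by (auto simp: is_function_field_def Let_def)
  let ?S = "mpolys_over E {..<length cs}"
  have hom: "P \<in> ?S \<Longrightarrow> Q \<in> ?S \<Longrightarrow> e (P + Q) = e P + e Q"
    "P \<in> ?S \<Longrightarrow> Q \<in> ?S \<Longrightarrow> e (P * Q) = e P * e Q" for P Q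
    using e(1) by (auto simp: is_quotient_field_def ring_hom_def mpoly_ring_simps)
  have z: "0 \<in> ?S" using subfield_setD[OF E] by (simp add: mpolys_over_def)
  have inj: "inj_on e ?S" using e(1) by (simp add: is_quotient_field_def mpoly_ring_simps)
  have e0: "e 0 = 0" using e(2) subfield_setD(2)[OF E] by (force simp: mpoly_const_def)
  hence ker: "e P = 0 \<longleftrightarrow> P = 0" if "P \<in> ?S" for P using inj_on_eq_iff[OF inj that z] by simp
  have "L = {e A / e B | A B. A \<in> ?S \<and> B \<in> ?S \<and> B \<noteq> 0}"
    using e(1) by (simp add: is_quotient_field_def mpoly_ring_simps)
  also have "\<dots> = {e A / e B | A B. A \<in> ?S \<and> B \<in> ?S \<and> e B \<noteq> 0}"
    by (intro Collect_cong ex_cong1 conj_cong refl) (simp add: ker)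
  also have "\<dots> = fractions (e ` ?S)" by (auto simp: fractions_def)
  finally have "L = fractions (e ` ?S)" .
  thus ?thesis using that[of e] hom e(2) ker False by (auto simp: mpoly_const_def)
next
  case True
  let ?P = "mpoly_ring E (length cs)" and ?S = "mpolys_over E {..<length cs}"
  interpret P: cring ?P by (rule cring_mpoly_ring[OF subfield_setD(1)[OF E]])
  have \<phi>: "pform_poly cs \<in> ?S" by (intro pform_poly_in cs subfield_setD[OF E])
  define I where "I = PIdl\<^bsub>?P\<^esub> (pform_poly cs)"
  have I_eq: "I = {Q * pform_poly cs | Q. Q \<in> ?S}"
    by (simp add: I_def cgenideal_def mpoly_ring_simps)
  interpret I: ideal I ?P
    unfolding I_def by (rule P.cgenideal_ideal) (simp add: mpoly_ring_simps \<phi>)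
  obtain \<epsilon> where \<epsilon>: "is_quotient_field (?P Quot I) \<epsilon> L" "\<forall>c\<in>E. \<epsilon> (I +>\<^bsub>?P\<^esub> mpoly_const c) = c"
    using L True by (auto simp: is_function_field_def Let_def I_def)
  define e where "e = (\<lambda>P. \<epsilon> (I +>\<^bsub>?P\<^esub> P))"
  have q: "P \<in> ?S \<Longrightarrow> I +>\<^bsub>?P\<^esub> P \<in> carrier (?P Quot I)" for P
    using ring_hom_closed[OF I.rcos_ring_hom] by (simp add: mpoly_ring_simps)
  have \<epsilon>hom: "\<epsilon> \<in> ring_hom (?P Quot I) type_ring" and inj: "inj_on \<epsilon> (carrier (?P Quot I))"
    and Leq: "L = {\<epsilon> x / \<epsilon> y | x y. x \<in> carrier (?P Quot I) \<and> y \<in> carrier (?P Quot I) \<and> y \<noteq> \<zero>\<^bsub>?P Quot I\<^esub>}"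
    using \<epsilon>(1) by (auto simp: is_quotient_field_def)
  have hom: "e (P + Q) = e P + e Q" "e (P * Q) = e P * e Q" if PQ: "P \<in> ?S" "Q \<in> ?S" for P Q
  proof -
    have "I +>\<^bsub>?P\<^esub> (P + Q) = (I +>\<^bsub>?P\<^esub> P) \<oplus>\<^bsub>?P Quot I\<^esub> (I +>\<^bsub>?P\<^esub> Q)"
      "I +>\<^bsub>?P\<^esub> (P * Q) = (I +>\<^bsub>?P\<^esub> P) \<otimes>\<^bsub>?P Quot I\<^esub> (I +>\<^bsub>?P\<^esub> Q)"
      using ring_hom_add[OF I.rcos_ring_hom, of P Q] ring_hom_mult[OF I.rcos_ring_hom, of P Q] PQ
      by (simp_all add: mpoly_ring_simps)
    thus "e (P + Q) = e P + e Q" "e (P * Q) = e P * e Q"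
      using ring_hom_add[OF \<epsilon>hom q[OF PQ(1)] q[OF PQ(2)]] ring_hom_mult[OF \<epsilon>hom q[OF PQ(1)] q[OF PQ(2)]]
      by (simp_all add: e_def)
  qed
  have z: "0 \<in> ?S" using subfield_setD[OF E] by (simp add: mpolys_over_def)
  have e0: "e 0 = 0" using hom(1)[OF z z] by (metis add.right_neutral add_cancel_right_right)
  have coset: "I +>\<^bsub>?P\<^esub> P = I +>\<^bsub>?P\<^esub> 0 \<longleftrightarrow> P \<in> I" if P: "P \<in> ?S" for P
  proof -
    have 0: "I +>\<^bsub>?P\<^esub> 0 = I" using I.a_rcos_const[of 0] I.zero_closed by (simp add: mpoly_ring_simps)
    show ?thesis
      unfolding 0 using I.a_rcos_self[of P] I.a_rcos_const[of P] P by (auto simp: mpoly_ring_simps)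
  qed
  have ker: "e P = 0 \<longleftrightarrow> P \<in> I" if P: "P \<in> ?S" for P
    using inj_on_eq_iff[OF inj q[OF P] q[OF z]] coset[OF P] e0 by (simp add: e_def)
  have car: "carrier (?P Quot I) = (\<lambda>P. I +>\<^bsub>?P\<^esub> P) ` ?S"
    by (auto simp: FactRing_def A_RCOSETS_defs a_r_coset_def mpoly_ring_simps)
  have zero: "\<zero>\<^bsub>?P Quot I\<^esub> = I +>\<^bsub>?P\<^esub> 0"
    using I.a_rcos_const[of 0] I.zero_closed by (simp add: FactRing_def mpoly_ring_simps)
  have "L = {\<epsilon> (I +>\<^bsub>?P\<^esub> A) / \<epsilon> (I +>\<^bsub>?P\<^esub> B) | A B. A \<in> ?S \<and> B \<in> ?S \<and> I +>\<^bsub>?P\<^esub> B \<noteq> I +>\<^bsub>?P\<^esub> 0}"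
    unfolding Leq car zero by blast
  also have "\<dots> = {e A / e B | A B. A \<in> ?S \<and> B \<in> ?S \<and> e B \<noteq> 0}"
    unfolding e_def by (intro Collect_cong ex_cong1 conj_cong refl) (simp add: coset ker[unfolded e_def])
  also have "\<dots> = fractions (e ` ?S)" by (auto simp: fractions_def)
  finally have "L = fractions (e ` ?S)" .
  moreover have "pform_poly cs \<in> I"
    using mpolys_over_single[of E 1 0 "{..<length cs}"] subfield_setD[OF E]
    unfolding I_eq by (intro CollectI exI[of _ 1]) simp
  ultimately show ?thesis
    using that[of e] hom \<epsilon>(2) ker \<phi> by (auto simp: e_def mpoly_const_def I_eq)
qed

lemma lookup_times_single:
  "Poly_Mapping.lookup (Q * Poly_Mapping.single \<gamma> (1 :: 'c::field)) (\<beta> + \<gamma>) =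
    Poly_Mapping.lookup (Q :: ('v \<Rightarrow>\<^sub>0 nat) \<Rightarrow>\<^sub>0 'c) \<beta>"
  by (induction Q rule: pm_induct) (simp_all add: distrib_right mult_single lookup_add lookup_single when_def)

text \<open>Compare the highest exponent of the variable \<open>X\<^sub>0\<close>.\<close>

lemma multiple_without_variable_eq_0:
  fixes Q \<psi> :: "(nat \<Rightarrow>\<^sub>0 nat) \<Rightarrow>\<^sub>0 'c::field"
  assumes p: "p > 0" and P: "P = Q * (mon (Poly_Mapping.single 0 p) + \<psi>)"
    and P0: "\<And>\<alpha>. \<alpha> \<in> Poly_Mapping.keys P \<Longrightarrow> Poly_Mapping.lookup \<alpha> 0 = 0"
    and \<psi>0: "\<And>\<alpha>. \<alpha> \<in> Poly_Mapping.keys \<psi> \<Longrightarrow> Poly_Mapping.lookup \<alpha> 0 = 0"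
  shows "Q = 0"
proof (rule ccontr)
  assume "Q \<noteq> 0"
  hence ne: "Poly_Mapping.keys Q \<noteq> {}" by simp
  define d where "d = Max ((\<lambda>\<alpha>. Poly_Mapping.lookup \<alpha> 0) ` Poly_Mapping.keys Q)"
  have "d \<in> (\<lambda>\<alpha>. Poly_Mapping.lookup \<alpha> 0) ` Poly_Mapping.keys Q"
    unfolding d_def using ne by (intro Max_in) auto
  then obtain \<beta> where \<beta>: "\<beta> \<in> Poly_Mapping.keys Q" "Poly_Mapping.lookup \<beta> 0 = d" by blast
  have le: "Poly_Mapping.lookup \<alpha> 0 \<le> d" if "\<alpha> \<in> Poly_Mapping.keys Q" for \<alpha>
    unfolding d_def using that by (intro Max_ge) auto
  define \<gamma> :: "nat \<Rightarrow>\<^sub>0 nat" where "\<gamma> = Poly_Mapping.single 0 p"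
  have \<gamma>: "Poly_Mapping.lookup (\<beta> + \<gamma>) 0 = d + p"
    by (simp add: \<gamma>_def lookup_add \<beta>(2))
  have "\<beta> + \<gamma> \<notin> Poly_Mapping.keys (Q * \<psi>)"
  proof
    assume "\<beta> + \<gamma> \<in> Poly_Mapping.keys (Q * \<psi>)"
    then obtain a b where "\<beta> + \<gamma> = a + b" "a \<in> Poly_Mapping.keys Q" "b \<in> Poly_Mapping.keys \<psi>"
      using keys_mult[of Q \<psi>] by blast
    thus False using \<gamma> le[of a] \<psi>0[of b] p by (simp add: lookup_add)
  qed
  hence "Poly_Mapping.lookup (Q * \<psi>) (\<beta> + \<gamma>) = 0" by (simp add: in_keys_iff)
  hence "Poly_Mapping.lookup P (\<beta> + \<gamma>) = Poly_Mapping.lookup Q \<beta>"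
    by (simp add: P distrib_left lookup_add lookup_times_single \<gamma>_def[symmetric])
  hence "\<beta> + \<gamma> \<in> Poly_Mapping.keys P" using \<beta>(1) by (simp add: in_keys_iff)
  thus False using P0[of "\<beta> + \<gamma>"] \<gamma> p by simp
qed

lemma pform_poly_normalized:
  "pform_poly (normalized_pform n (c :: nat \<Rightarrow> 'k::field)) = mon (Poly_Mapping.single 0 CHAR('k)) +
    (\<Sum>j=1..n. Poly_Mapping.single (Poly_Mapping.single j CHAR('k)) (c j))"
proof -
  have len: "length (normalized_pform n c) = Suc n" by (simp add: normalized_pform_def)
  have nth: "normalized_pform n c ! j = (if j = 0 then 1 else c j)" if "j < Suc n" for j
    using that by (cases j) (auto simp: normalized_pform_def simp del: upt_Suc)
  have "pform_poly (normalized_pform n c) =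
    (\<Sum>j<Suc n. Poly_Mapping.single (Poly_Mapping.single j CHAR('k)) (if j = 0 then 1 else c j))"
    unfolding pform_poly_def len by (rule sum.cong) (use nth in auto)
  also have "\<dots> = mon (Poly_Mapping.single 0 CHAR('k)) +
      (\<Sum>j<n. Poly_Mapping.single (Poly_Mapping.single (Suc j) CHAR('k)) (c (Suc j)))"
    unfolding sum.lessThan_Suc_shift by simp
  also have "(\<Sum>j<n. Poly_Mapping.single (Poly_Mapping.single (Suc j) CHAR('k)) (c (Suc j))) =
      (\<Sum>j=1..n. Poly_Mapping.single (Poly_Mapping.single j CHAR('k)) (c j))"
    by (rule sum.reindex_bij_witness[of _ "\<lambda>j. j - 1" Suc]) auto
  finally show ?thesis .
qed

lemma sum_single_keys:
  "\<alpha> \<in> Poly_Mapping.keys (\<Sum>j\<in>J. Poly_Mapping.single (Poly_Mapping.single j p) (c j)) \<Longrightarrow>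
    \<exists>j\<in>J. \<alpha> = Poly_Mapping.single j p"
proof (induction J rule: infinite_finite_induct)
  case (insert j J)
  have "\<alpha> \<in> Poly_Mapping.keys (Poly_Mapping.single (Poly_Mapping.single j p) (c j) +
     (\<Sum>j\<in>J. Poly_Mapping.single (Poly_Mapping.single j p) (c j)))"
    using insert.prems insert.hyps by simp
  hence "\<alpha> \<in> Poly_Mapping.keys (Poly_Mapping.single (Poly_Mapping.single j p) (c j)) \<or>
     \<alpha> \<in> Poly_Mapping.keys (\<Sum>j\<in>J. Poly_Mapping.single (Poly_Mapping.single j p) (c j))"
    by (rule UnE[OF subsetD[OF keys_add]]) simp_all
  thus ?case using insert.IH by (auto split: if_splits)
qed auto

lemma lookup_sum_single:
  assumes "finite J" "i \<in> J" "p > (0::nat)"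
  shows "Poly_Mapping.lookup (\<Sum>j\<in>J. Poly_Mapping.single (Poly_Mapping.single j p) (c j)) (Poly_Mapping.single i p) =
    (c i :: 'c::comm_monoid_add)"
proof -
  have "Poly_Mapping.lookup (\<Sum>j\<in>J. Poly_Mapping.single (Poly_Mapping.single j p) (c j)) (Poly_Mapping.single i p) =
    (\<Sum>j\<in>J. Poly_Mapping.lookup (Poly_Mapping.single (Poly_Mapping.single j p) (c j)) (Poly_Mapping.single i p))"
    using assms(1) by (induction J rule: finite_induct) (simp_all add: lookup_add)
  also have "\<dots> = (\<Sum>j\<in>J. if j = i then c j else 0)"
  proof (rule sum.cong)
    fix j
    have "Poly_Mapping.single j p = Poly_Mapping.single i p \<longleftrightarrow> j = i"
      using assms(3) by (metis keys_single less_irrefl singleton_inject)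
    thus "Poly_Mapping.lookup (Poly_Mapping.single (Poly_Mapping.single j p) (c j)) (Poly_Mapping.single i p) =
      (if j = i then c j else 0)" by (simp add: lookup_single when_def)
  qed simp
  also have "\<dots> = c i" using assms(1,2) by simp
  finally show ?thesis .
qed

text \<open>One floor of the tower, with \<open>z j\<close> the p-th power of the coordinate x_j.
  The hypothesis \<open>triv\<close> handles the rational branch: there no relation holds among the
  coordinates, but the coefficients are p-th powers, so the functional is zero on derivations of
  \<open>E\<close>.\<close>

lemma function_field_step:
  fixes E L :: "'k::field set" and c :: "nat \<Rightarrow> 'k"
  assumes p: "CHAR('k) > 0" and E: "subfield_set E" and c: "\<And>j. j \<in> {1..n} \<Longrightarrow> c j \<in> E"
    and L: "is_function_field E (normalized_pform n c) L"
    and triv: "norm_degree E (normalized_pform n c) \<le> 1 \<Longrightarrow> \<forall>j\<in>{1..n}. c j \<in> pth_powers E"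
  obtains z where "subfield_set L" "E \<subseteq> L" "\<And>j. j \<in> {1..n} \<Longrightarrow> z j \<in> L"
    "\<And>b. (\<forall>j\<in>{1..n}. b j \<in> E) \<Longrightarrow> (\<Sum>j=1..n. b j * z j) = 0 \<Longrightarrow> \<forall>j\<in>{1..n}. b j = 0"
    "\<And>\<delta>. derivation_on (\<lambda>x. x) L \<delta> \<Longrightarrow> (\<Sum>j=1..n. z j * \<delta> (c j)) = 0"
    "\<And>\<delta>. derivation_on (\<lambda>x. x) E \<delta> \<Longrightarrow> (\<Sum>j=1..n. z j * \<delta> (c j)) = 0 \<Longrightarrow>
       \<exists>\<delta>'. derivation_on (\<lambda>x. x) L \<delta>' \<and> (\<forall>x\<in>E. \<delta>' x = \<delta> x)"
proof -
  let ?cs = "normalized_pform n c"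
  let ?S = "mpolys_over E {..<length ?cs}"
  note E' = subfield_setD(1)[OF E] and E0 = subfield_setD(2)[OF E] and E1 = subfield_setD(3)[OF E]
  have len: "length ?cs = Suc n" by (simp add: normalized_pform_def)
  have cs: "set ?cs \<subseteq> E" using c E1 by (auto simp: normalized_pform_def)
  obtain e where e_add: "\<And>P Q. P \<in> ?S \<Longrightarrow> Q \<in> ?S \<Longrightarrow> e (P + Q) = e P + e Q"
    and e_mult: "\<And>P Q. P \<in> ?S \<Longrightarrow> Q \<in> ?S \<Longrightarrow> e (P * Q) = e P * e Q"
    and e_const: "\<And>c. c \<in> E \<Longrightarrow> e (Poly_Mapping.single 0 c) = c"
    and L_eq: "L = fractions (e ` ?S)"
    and nontriv: "norm_degree E ?cs > 1 \<Longrightarrow> e (pform_poly ?cs) = 0"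
    and ker: "\<And>P. P \<in> ?S \<Longrightarrow> e P = 0 \<Longrightarrow>
      P = 0 \<or> e (pform_poly ?cs) = 0 \<and> (\<exists>Q\<in>?S. P = Q * pform_poly ?cs)"
    by (rule function_field_hom[OF E cs L]) blast
  let ?v = "\<lambda>j. Poly_Mapping.single j CHAR('k) :: nat \<Rightarrow>\<^sub>0 nat"
  define z where "z = (\<lambda>j. e (mon (?v j)))"
  have e_zero: "e 0 = 0" using e_const[OF E0] by simp
  have vS: "Poly_Mapping.single (?v j) b \<in> ?S" if "j \<le> n" "b \<in> E" for j b
    using that E0 by (intro mpolys_over_single) (auto simp: len)
  have e_v: "e (Poly_Mapping.single (?v j) b) = b * z j" if "j \<le> n" "b \<in> E" for j b
    using e_mult[OF mpolys_over_single[OF E0 that(2), of 0] vS[OF that(1) E1]] e_const[OF that(2)]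
    by (simp add: mult_single z_def)
  have sumS: "(\<Sum>j\<in>J. Poly_Mapping.single (?v j) (b j)) \<in> ?S \<and>
      e (\<Sum>j\<in>J. Poly_Mapping.single (?v j) (b j)) = (\<Sum>j\<in>J. b j * z j)"
    if "J \<subseteq> {..n}" "\<forall>j\<in>J. b j \<in> E" for J b
  proof -
    have "finite J" using that(1) finite_subset by blast
    thus ?thesis using that
    proof (induction J rule: finite_induct)
      case empty
      show ?case using E0 by (simp add: mpolys_over_def e_zero)
    next
      case (insert j J)
      thus ?case using vS[of j "b j"] e_v[of j "b j"] by (simp add: mpolys_over_add[OF E'] e_add)
    qed
  qed
  have S: "subring_set (e ` ?S)"
    using e_add e_mult e_const by (rule subring_set_eval_image[OF embedding_id E'])
  have SL: "e ` ?S \<subseteq> L" unfolding L_eq by (rule fractions_incl[OF S])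
  have subL: "subfield_set L" unfolding L_eq by (rule subfield_set_fractions[OF S])
  have EL: "E \<subseteq> L"
  proof
    fix x assume x: "x \<in> E"
    have "e (Poly_Mapping.single 0 x) \<in> L" using SL mpolys_over_single[OF E0 x, of 0] by auto
    thus "x \<in> L" by (simp add: e_const[OF x])
  qed
  have zL: "z j \<in> L" if "j \<le> n" for j unfolding z_def using SL vS[OF that E1] by blast
  define \<psi> where "\<psi> = (\<Sum>j=1..n. Poly_Mapping.single (?v j) (c j))"
  have \<phi>: "pform_poly ?cs = mon (?v 0) + \<psi>" by (simp add: pform_poly_normalized \<psi>_def)
  \<comment> \<open>A linear relation among the \<open>z j\<close> with j at least 1 would be a
    polynomial without X_0 in the kernel; if non-zero, it would be a multiple of a form containing
    X_0^p.\<close>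
  have indep: "\<forall>j\<in>{1..n}. b j = 0" if b: "\<forall>j\<in>{1..n}. b j \<in> E" "(\<Sum>j=1..n. b j * z j) = 0" for b
  proof -
    let ?P = "\<Sum>j=1..n. Poly_Mapping.single (?v j) (b j)"
    have P: "?P \<in> ?S" "e ?P = 0" using sumS[of "{1..n}" b] b by auto
    have k0: "Poly_Mapping.lookup \<alpha> 0 = 0"
      if "\<alpha> \<in> Poly_Mapping.keys (\<Sum>j=1..n. Poly_Mapping.single (?v j) (b j))" for \<alpha> b
      using sum_single_keys[OF that] by (auto simp: lookup_single when_def)
    have "?P = 0"
    proof (rule ccontr)
      assume "?P \<noteq> 0"
      then obtain Q where Q: "?P = Q * (mon (?v 0) + \<psi>)" using ker[OF P] \<phi> by auto
      have "Q = 0"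
        by (rule multiple_without_variable_eq_0[OF p Q]) (use k0 in \<open>auto simp: \<psi>_def\<close>)
      thus False using Q \<open>?P \<noteq> 0\<close> by simp
    qed
    thus ?thesis using lookup_sum_single[of "{1..n}" _ "CHAR('k)" b] p by force
  qed
  have z0: "e (mon (?v 0)) = z 0" by (simp add: z_def)
  have e\<phi>: "e (pform_poly ?cs) = z 0 + (\<Sum>j=1..n. c j * z j)"
    using e_add[OF vS[of 0 1] conjunct1[OF sumS[of "{1..n}" c]]] sumS[of "{1..n}" c] c E1
    by (simp add: \<phi> \<psi>_def z0)
  \<comment> \<open>Each \<open>z j\<close> is a p-th power in \<open>L\<close>, hence constant for
    every derivation of \<open>L\<close>.\<close>
  have zpow: "z j = (e (mon (Poly_Mapping.single j 1))) ^ CHAR('k)" if "j \<le> n" for j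
  proof -
    have mS: "mon (Poly_Mapping.single j k) \<in> ?S" for k
      using that E0 E1 by (intro mpolys_over_single) (auto simp: len)
    have "e (mon (Poly_Mapping.single j k)) = e (mon (Poly_Mapping.single j 1)) ^ k" for k
    proof (induction k)
      case 0
      show ?case using e_const[OF E1] by simp
    next
      case (Suc k)
      have "(mon (Poly_Mapping.single j (Suc k)) :: (nat \<Rightarrow>\<^sub>0 nat) \<Rightarrow>\<^sub>0 'k) =
          mon (Poly_Mapping.single j 1) * mon (Poly_Mapping.single j k)"
        by (simp add: mult_single flip: single_add)
      hence "e (mon (Poly_Mapping.single j (Suc k))) =
          e (mon (Poly_Mapping.single j 1)) * e (mon (Poly_Mapping.single j k))"
        using e_mult[OF mS mS, of 1 k] by (simp only:)
      thus ?case using Suc by (simp only: power_Suc)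
    qed
    thus ?thesis unfolding z_def .
  qed
  have xL: "e (mon (Poly_Mapping.single j 1)) \<in> L" if "j \<le> n" for j
  proof (rule subsetD[OF SL imageI])
    show "mon (Poly_Mapping.single j 1) \<in> ?S"
      using that E0 E1 by (intro mpolys_over_single) (auto simp: len)
  qed
  have \<delta>z: "\<delta> (z j) = 0" if "derivation_on (\<lambda>x. x) L \<delta>" "j \<le> n" for \<delta> j
    unfolding zpow[OF that(2)]
    by (rule derivation_pth_power[OF embedding_id subfield_setD(1)[OF subL] that(1) p xL[OF that(2)]])
  \<comment> \<open>Differentiate the relation phi(x) = 0: the coordinates enter as p-th powers, so
    only the coefficients contribute.\<close>
  have nec: "(\<Sum>j=1..n. z j * \<delta> (c j)) = 0" if der: "derivation_on (\<lambda>x. x) L \<delta>" for \<delta>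
  proof (cases "norm_degree E ?cs > 1")
    case True
    note L' = subfield_setD(1)[OF subL]
    have cL: "c j \<in> L" if "j \<in> {1..n}" for j using c[OF that] EL by blast
    have cz: "c j * z j \<in> L" if "j \<in> {1..n}" for j
      using cL[OF that] zL[of j] that by (intro subring_setD[OF L']) auto
    have "\<delta> (z 0 + (\<Sum>j=1..n. c j * z j)) = 0"
      using e\<phi> nontriv[OF True] derivation_0[OF embedding_id L' der] by simp
    also have "\<delta> (z 0 + (\<Sum>j=1..n. c j * z j)) = \<delta> (z 0) + \<delta> (\<Sum>j=1..n. c j * z j)"
      using zL[of 0] cz by (intro derivation_on_add[OF der] subring_set_sum[OF L']) auto
    also have "\<delta> (\<Sum>j=1..n. c j * z j) = (\<Sum>j=1..n. \<delta> (c j * z j))"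
      by (rule derivation_sum[OF embedding_id L' der cz])
    also have "\<dots> = (\<Sum>j=1..n. z j * \<delta> (c j))"
      by (rule sum.cong) (use derivation_on_mult[OF der cL zL] \<delta>z[OF der] in auto)
    finally show ?thesis using \<delta>z[OF der, of 0] by simp
  next
    case False
    have "\<delta> (c j) = 0" if j: "j \<in> {1..n}" for j
    proof -
      have "c j \<in> pth_powers E" using triv False j by (meson not_le)
      then obtain x where "x \<in> E" "c j = x ^ CHAR('k)" unfolding pth_powers_def by blast
      thus ?thesis
        using derivation_pth_power[OF embedding_id subfield_setD(1)[OF subL] der p, of x] EL by auto
    qed
    thus ?thesis by simp
  qed
  \<comment> \<open>With the variables as constants, the derivative of the form, evaluated at x, is
    exactly the functional at \<delta>. If it vanishes, the product rule carries this over to all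
    multiples of the form.\<close>
  have suf: "\<exists>\<delta>'. derivation_on (\<lambda>x. x) L \<delta>' \<and> (\<forall>x\<in>E. \<delta>' x = \<delta> x)"
    if der: "derivation_on (\<lambda>x. x) E \<delta>" and w: "(\<Sum>j=1..n. z j * \<delta> (c j)) = 0" for \<delta>
  proof -
    let ?\<Delta> = "pm_sum (\<lambda>\<alpha> c. \<delta> c * e (mon \<alpha>))"
    note ext = derivation_extend_polys[OF embedding_id E' der, where V = "{..<length ?cs}" and e = e]
    have ext1: "?\<Delta> (P + Q) = ?\<Delta> P + ?\<Delta> Q" if "P \<in> ?S" "Q \<in> ?S" for P Q
      by (rule ext(1)) (fact e_add e_mult e_const that)+
    have ext2: "?\<Delta> (P * Q) = e P * ?\<Delta> Q + e Q * ?\<Delta> P" if "P \<in> ?S" "Q \<in> ?S" for P Q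
      by (rule ext(2)) (fact e_add e_mult e_const that)+
    have ext3: "?\<Delta> (Poly_Mapping.single \<alpha> b) = \<delta> b * e (mon \<alpha>)" if "b \<in> E" for \<alpha> b
      by (rule ext(3)) (fact e_add e_mult e_const that)+
    have \<Delta>sum: "?\<Delta> (\<Sum>j\<in>J. Poly_Mapping.single (?v j) (b j)) = (\<Sum>j\<in>J. \<delta> (b j) * z j)"
      if "J \<subseteq> {..n}" "\<forall>j\<in>J. b j \<in> E" for J b
    proof -
      have "finite J" using that(1) finite_subset by blast
      thus ?thesis using that
      proof (induction J rule: finite_induct)
        case (insert j J)
        thus ?case using vS[of j "b j"] sumS[of J b] ext1[of "Poly_Mapping.single (?v j) (b j)"] ext3[of "b j" "?v j"]
          by (simp add: z_def)
      qed simp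
    qed
    have \<psi>S: "\<psi> \<in> ?S" using sumS[of "{1..n}" c] c by (auto simp: \<psi>_def)
    have "?\<Delta> (mon (?v 0)) = 0"
      using ext3[OF E1, of "?v 0"] derivation_1[OF embedding_id E' der] by simp
    hence \<Delta>\<phi>: "?\<Delta> (pform_poly ?cs) = 0"
      using ext1[OF vS[of 0 1] \<psi>S] \<Delta>sum[of "{1..n}" c] c E1 w by (simp add: \<phi> \<psi>_def mult.commute)
    have \<phi>S: "pform_poly ?cs \<in> ?S" by (rule pform_poly_in[OF cs E'])
    have ker0: "?\<Delta> P = 0" if P: "P \<in> ?S" "e P = 0" for P
    proof (cases "P = 0")
      case False
      then obtain Q where Q: "Q \<in> ?S" "P = Q * pform_poly ?cs" "e (pform_poly ?cs) = 0"
        using ker[OF P] by blast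
      thus ?thesis using ext2[OF Q(1) \<phi>S] \<Delta>\<phi> by simp
    qed simp
    show ?thesis unfolding L_eq
      by (rule ext(4)) (erule (1) e_add e_mult ker0 | erule e_const)+
  qed
  show ?thesis
  proof (rule that[of z])
    show "z j \<in> L" if "j \<in> {1..n}" for j using zL that by simp
  qed (fact subL EL indep nec suf)+
qed

section \<open>Degrees of purely inseparable extensions\<close>

abbreviation tdim :: "nat \<Rightarrow> 'k::field set \<Rightarrow> 'k set \<Rightarrow> bool"
  where "tdim \<equiv> ring.dimension type_ring"

text \<open>Each further vector either raises the dimension by one or already lies in the
  span.\<close>

lemma dim_Span_le:
  assumes K: "subfield_set (K :: 'k::field set)"
  shows "\<exists>n\<le>length Us. tdim n K (ring.Span type_ring K Us)"
proof -
  interpret R: Ring.field "type_ring :: 'k ring" by (rule field_type_ring)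
  have K': "subfield K type_ring" using K by (simp add: subfield_set_iff)
  show ?thesis
  proof (induction Us)
    case Nil
    show ?case using R.zero_dim[of K] by auto
  next
    case (Cons u Us)
    then obtain n where n: "n \<le> length Us" "R.dimension n K (R.Span K Us)" by blast
    have eq: "R.Span K (u # Us) = R.line_extension K u (R.Span K Us)" by simp
    show ?case
    proof (cases "u \<in> R.Span K Us")
      case False
      hence "R.dimension (Suc n) K (R.Span K (u # Us))"
        unfolding eq using n(2) by (intro R.Suc_dim) auto
      thus ?thesis using n(1) by auto
    next
      case True
      note sp = R.Span_subgroup_props[OF K', of Us] R.Span_smult_closed[OF K', of Us]
      have "R.line_extension K u (R.Span K Us) = R.Span K Us"
      proof (intro equalityI subsetI)
        fix x assume "x \<in> R.line_extension K u (R.Span K Us)"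
        then obtain k v where kv: "k \<in> K" "v \<in> R.Span K Us" "x = k * u + v"
          unfolding R.line_extension_mem_iff by auto
        thus "x \<in> R.Span K Us" using sp(5)[of k u] sp(3)[of "k * u" v] True by simp
      next
        fix x assume "x \<in> R.Span K Us"
        hence "x = 0 * u + x" "(0 :: 'k) \<in> K" using subfield_setD[OF K] by auto
        thus "x \<in> R.line_extension K u (R.Span K Us)"
          unfolding R.line_extension_mem_iff using \<open>x \<in> R.Span K Us\<close> by (metis type_ring_simps(2,5))
      qed
      thus ?thesis using n eq by (intro exI[of _ n]) auto
    qed
  qed
qed

lemma tdim_ge_1:
  assumes K: "subfield_set (K :: 'k::field set)" and "tdim n K E" "1 \<in> E"
  shows "n \<ge> 1"
proof -
  interpret R: Ring.field "type_ring :: 'k ring" by (rule field_type_ring)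
  have K': "subfield K type_ring" using K by (simp add: subfield_set_iff)
  have "n \<noteq> 0"
  proof
    assume "n = 0"
    hence "E = {0}" using R.dimension_zero[OF K'] assms(2) by simp
    thus False using assms(3) by simp
  qed
  thus ?thesis by simp
qed

lemma tdim_1_eq:
  assumes K: "subfield_set (K :: 'k::field set)" and E: "tdim 1 K E" "K \<subseteq> E"
  shows "E = K"
proof -
  interpret R: Ring.field "type_ring :: 'k ring" by (rule field_type_ring)
  have K': "subfield K type_ring" using K by (simp add: subfield_set_iff)
  have "R.independent K [1]" by (rule R.li_Cons) auto
  moreover have "set [1] \<subseteq> E" using E(2) subfield_setD[OF K] by auto
  ultimately have "R.Span K [1] = E" using R.independent_length_eq_dimension[OF K' E(1), of "[1]"] by auto
  moreover have "R.Span K [1] = K"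
  proof -
    have "x \<in> R.line_extension K 1 {0} \<longleftrightarrow> x \<in> K" for x
      unfolding R.line_extension_mem_iff by auto
    thus ?thesis by auto
  qed
  ultimately show ?thesis by simp
qed

lemma ext_degree_eq:
  assumes "subfield_set (K :: 'k::field set)" "tdim n K E"
  shows "ext_degree K E = n"
proof -
  interpret R: Ring.field "type_ring :: 'k ring" by (rule field_type_ring)
  show ?thesis
    using R.dimI[of K n E] assms by (simp add: subfield_set_iff ext_degree_def over_def)
qed

lemma tdim_mult:
  assumes "subfield_set (K :: 'k::field set)" "subfield_set F" "tdim n K F" "tdim m F E"
  shows "tdim (n * m) K E"
proof -
  interpret R: Ring.field "type_ring :: 'k ring" by (rule field_type_ring)
  show ?thesis by (rule R.telescopic_base[of K F]) (use assms in \<open>auto simp: subfield_set_iff\<close>)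
qed

lemma tdim_refl: "subfield_set (K :: 'k::field set) \<Longrightarrow> tdim 1 K K"
proof -
  assume K: "subfield_set K"
  interpret R: Ring.field "type_ring :: 'k ring" by (rule field_type_ring)
  show ?thesis by (rule R.dimension_one) (use K in \<open>simp add: subfield_set_iff\<close>)
qed

text \<open>The powers 1, y, ..., y^(p-1) span, since y^i = (y^p)^(i div p) y^(i mod p). The upper
  bound p is what the later counting argument asks for.\<close>

lemma tdim_adjoin:
  assumes p: "CHAR('k) > 0" and E: "subfield_set E" and y: "(y :: 'k::field) ^ CHAR('k) \<in> E"
  shows "\<exists>n\<ge>1. n \<le> CHAR('k) \<and> tdim n E (adjoin E y) \<and> (y \<in> E \<longrightarrow> n = 1)"
proof (cases "y \<in> E")
  case True
  hence "adjoin E y = E"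
    using adjoin_least[OF subfield_setD(1)[OF E] order.refl True] adjoin_incl(1)[OF subfield_setD(1)[OF E]] by auto
  thus ?thesis using tdim_refl[OF E] p by (intro exI[of _ 1]) auto
next
  case False
  interpret R: Ring.field "type_ring :: 'k ring" by (rule field_type_ring)
  have E': "subfield E type_ring" using E by (simp add: subfield_set_iff)
  let ?p = "CHAR('k)"
  define Us where "Us = map (\<lambda>i. y ^ i) [0..<?p]"
  note sp = R.Span_subgroup_props[OF E', of Us] R.Span_smult_closed[OF E', of Us]
  have base: "y ^ i \<in> R.Span E Us" for i
  proof -
    have "y ^ (i mod ?p) \<in> set Us" using p by (auto simp: Us_def)
    hence "y ^ (i mod ?p) \<in> R.Span E Us" using R.Span_base_incl[OF E', of Us] by auto
    moreover have "(y ^ ?p) ^ (i div ?p) \<in> E" by (rule subring_set_power[OF subfield_setD(1)[OF E] y])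
    ultimately have "(y ^ ?p) ^ (i div ?p) * y ^ (i mod ?p) \<in> R.Span E Us" using sp(5) by auto
    also have "(y ^ ?p) ^ (i div ?p) * y ^ (i mod ?p) = y ^ i"
      by (simp flip: power_mult power_add)
    finally show ?thesis .
  qed
  have "adjoin E y \<subseteq> R.Span E Us"
  proof
    fix x assume "x \<in> adjoin E y"
    then obtain f where f: "f \<in> polys_over E" "x = poly f y" by (auto simp: adjoin_def)
    have "finite J \<Longrightarrow> (\<Sum>i\<in>J. Polynomial.coeff f i * y ^ i) \<in> R.Span E Us" for J
    proof (induction J rule: finite_induct)
      case empty
      show ?case using sp(2) by simp
    next
      case (insert i J)
      have "Polynomial.coeff f i * y ^ i \<in> R.Span E Us"
        using sp(5)[of "Polynomial.coeff f i" "y ^ i"] base f(1) by (auto simp: polys_over_def)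
      thus ?case using insert sp(3)[of "Polynomial.coeff f i * y ^ i"] by auto
    qed
    thus "x \<in> R.Span E Us" unfolding f(2) poly_altdef by blast
  qed
  moreover have "R.Span E Us \<subseteq> adjoin E y"
  proof -
    have A: "subfield_set (adjoin E y)" by (rule subfield_set_adjoin[OF p E y])
    have "x \<in> R.Span E Us \<Longrightarrow> set Us \<subseteq> adjoin E y \<Longrightarrow> x \<in> adjoin E y" for x Us
    proof (induction Us arbitrary: x)
      case Nil
      thus ?case using subfield_setD[OF A] by simp
    next
      case (Cons u Us)
      have "x \<in> R.line_extension E u (R.Span E Us)" using Cons.prems(1) by simp
      then obtain k v where "k \<in> E" "v \<in> R.Span E Us" "x = k * u + v"
        unfolding R.line_extension_mem_iff by auto
      thus ?case using Cons subfield_setD[OF A] adjoin_incl(1)[OF subfield_setD(1)[OF E], of y] by auto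
    qed
    moreover have "set Us \<subseteq> adjoin E y"
      using subring_set_power[OF subfield_setD(1)[OF A] adjoin_incl(2)[OF subfield_setD(1)[OF E]]]
      by (auto simp: Us_def)
    ultimately show ?thesis by blast
  qed
  ultimately have eq: "adjoin E y = R.Span E Us" by blast
  obtain n where n: "n \<le> length Us" "tdim n E (adjoin E y)" using dim_Span_le[OF E, of Us] eq by auto
  have "n \<ge> 1"
    by (rule tdim_ge_1[OF E n(2)])
       (use subfield_setD[OF subfield_set_adjoin[OF p E y]] in blast)
  thus ?thesis using n False by (auto simp: Us_def)
qed

section \<open>The norm field of a normalized form\<close>

lemma subfield_set_pth_powers:
  assumes p: "CHAR('k) > 0" and E: "subfield_set (E :: 'k::field set)"
  shows "subfield_set (pth_powers E)"
proof -
  let ?p = "CHAR('k)"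
  have add: "(x + y) ^ ?p = x ^ ?p + y ^ ?p" for x y :: 'k
    by (rule freshmans_dream[OF prime_CHAR_semidom[OF p] refl])
  have diff: "(x - y) ^ ?p = x ^ ?p - y ^ ?p" for x y :: 'k
    using add[of "x - y" y] by simp
  have I: "x \<in> E \<Longrightarrow> y = x ^ ?p \<Longrightarrow> y \<in> pth_powers E" for x y by (auto simp: pth_powers_def)
  note E' = subfield_setD[OF E]
  show ?thesis
    unfolding subfield_set_def subring_set_def
  proof (intro conjI ballI)
    show "0 \<in> pth_powers E" "1 \<in> pth_powers E" using I[OF E'(2), of 0] I[OF E'(3), of 1] p by simp_all
    fix u assume "u \<in> pth_powers E"
    then obtain x where x: "x \<in> E" "u = x ^ ?p" by (auto simp: pth_powers_def)
    show "inverse u \<in> pth_powers E" by (rule I[OF E'(7)[OF x(1)]]) (simp add: x(2) power_inverse)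
    fix v assume "v \<in> pth_powers E"
    then obtain y where y: "y \<in> E" "v = y ^ ?p" by (auto simp: pth_powers_def)
    show "u + v \<in> pth_powers E" by (rule I[OF E'(4)[OF x(1) y(1)]]) (simp add: x(2) y(2) add)
    show "u - v \<in> pth_powers E" by (rule I[OF E'(5)[OF x(1) y(1)]]) (simp add: x(2) y(2) diff)
    show "u * v \<in> pth_powers E" by (rule I[OF E'(6)[OF x(1) y(1)]]) (simp add: x(2) y(2) power_mult_distrib)
  qed
qed

text \<open>Exhausts the norm field by adjoining the c_j to E^p one by one. Its degree over E^p is
  thus finite, so that \<open>norm_degree\<close> really is a dimension and a value of at most 1
  forces the norm field to be E^p.\<close>

lemma norm_field_normalized:
  fixes E :: "'k::field set" and c :: "nat \<Rightarrow> 'k"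
  assumes p: "CHAR('k) > 0" and E: "subfield_set E" and c: "\<And>j. j \<in> {1..n} \<Longrightarrow> c j \<in> E"
  shows "c ` {1..n} \<subseteq> norm_field E (normalized_pform n c)"
    and "norm_degree E (normalized_pform n c) \<le> 1 \<Longrightarrow> \<forall>j\<in>{1..n}. c j \<in> pth_powers E"
proof -
  let ?cs = "normalized_pform n c" and ?p = "CHAR('k)"
  define N where "N = norm_field E ?cs"
  have len: "length ?cs = Suc n" by (simp add: normalized_pform_def)
  have nth: "?cs ! j = (if j = 0 then 1 else c j)" if "j < Suc n" for j
    using that by (cases j) (auto simp: normalized_pform_def simp del: upt_Suc)
  have csE: "?cs ! j \<in> E" if "j < Suc n" for j
    using nth[OF that] c[of j] subfield_setD[OF E] that by auto
  have subN: "subfield_set N" unfolding N_def norm_field_def by (rule generate_field_subfield)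
  have PN: "pth_powers E \<subseteq> N" unfolding N_def norm_field_def
    by (rule order.trans[OF Un_upper1 generate_field_incl])
  \<comment> \<open>Unit vectors show that the non-zero coefficients are values of the form;
    dividing by the value 1 puts them into the norm field.\<close>
  have unit: "pform_eval ?cs (\<lambda>i. if i = j then 1 else 0) = ?cs ! j" if "j < Suc n" for j
  proof -
    have "pform_eval ?cs (\<lambda>i. if i = j then 1 else 0) = (\<Sum>i<Suc n. if i = j then ?cs ! j else 0)"
      unfolding pform_eval_def len by (rule sum.cong) (use p in auto)
    thus ?thesis using that by simp
  qed
  have val: "?cs ! j \<in> pform_values E ?cs" if "j < Suc n" "?cs ! j \<noteq> 0" for j
  proof -
    have "\<forall>i. (if i = j then 1 else 0) \<in> E" using subfield_setD[OF E] by auto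
    thus ?thesis unfolding pform_values_def using unit[OF that(1)] that(2)
      by (intro CollectI exI[of _ "\<lambda>i. if i = j then 1 else 0"]) auto
  qed
  have cN: "c j \<in> N" if j: "j \<in> {1..n}" for j
  proof (cases "c j = 0")
    case True
    thus ?thesis using subfield_setD[OF subN] by simp
  next
    case False
    hence "c j \<in> pform_values E ?cs" "1 \<in> pform_values E ?cs"
      using val[of j] val[of 0] j nth[of j] nth[of 0] by auto
    hence "c j / 1 \<in> {a / b | a b. a \<in> pform_values E ?cs \<and> b \<in> pform_values E ?cs}" by blast
    hence "c j \<in> {a / b | a b. a \<in> pform_values E ?cs \<and> b \<in> pform_values E ?cs}" by simp
    thus ?thesis unfolding N_def norm_field_def by (intro subsetD[OF generate_field_incl] UnI2)
  qed
  thus "c ` {1..n} \<subseteq> norm_field E ?cs" unfolding N_def by blast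
  define A where "A = rec_nat (pth_powers E) (\<lambda>i B. adjoin B (c (Suc i)))"
  have A0: "A 0 = pth_powers E" and AS: "A (Suc i) = adjoin (A i) (c (Suc i))" for i
    by (simp_all add: A_def)
  have sub0: "subfield_set (pth_powers E)" by (rule subfield_set_pth_powers[OF p E])
  have A: "subfield_set (A i) \<and> pth_powers E \<subseteq> A i \<and> (\<forall>j\<in>{1..i}. c j \<in> A i) \<and> A i \<subseteq> N \<and>
      (\<exists>d. tdim d (pth_powers E) (A i))" if "i \<le> n" for i
    using that
  proof (induction i)
    case 0
    show ?case using sub0 PN tdim_refl[OF sub0] by (auto simp: A0)
  next
    case (Suc i)
    hence IH: "subfield_set (A i)" "pth_powers E \<subseteq> A i" "\<forall>j\<in>{1..i}. c j \<in> A i" "A i \<subseteq> N"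
      "\<exists>d. tdim d (pth_powers E) (A i)" by auto
    have "c (Suc i) ^ ?p \<in> pth_powers E" using c[of "Suc i"] Suc.prems by (auto simp: pth_powers_def)
    hence cp: "c (Suc i) ^ ?p \<in> A i" using IH(2) by blast
    obtain d where d: "tdim d (pth_powers E) (A i)" using IH(5) by blast
    obtain d' where d': "tdim d' (A i) (A (Suc i))" using tdim_adjoin[OF p IH(1) cp] by (auto simp: AS)
    have inc: "A i \<subseteq> A (Suc i)" "c (Suc i) \<in> A (Suc i)"
      unfolding AS using adjoin_incl[OF subfield_setD(1)[OF IH(1)]] by auto
    have "A (Suc i) \<subseteq> N"
      unfolding AS using cN[of "Suc i"] Suc.prems by (intro adjoin_least[OF subfield_setD(1)[OF subN] IH(4)]) auto
    moreover have "subfield_set (A (Suc i))" unfolding AS by (rule subfield_set_adjoin[OF p IH(1) cp])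
    moreover have "\<forall>j\<in>{1..Suc i}. c j \<in> A (Suc i)" using IH(3) inc by (auto simp: le_Suc_eq)
    moreover have "\<exists>d. tdim d (pth_powers E) (A (Suc i))" using tdim_mult[OF sub0 IH(1) d d'] by blast
    ultimately show ?case using IH(2) inc by blast
  qed
  have An: "subfield_set (A n)" "pth_powers E \<subseteq> A n" "\<And>j. j \<in> {1..n} \<Longrightarrow> c j \<in> A n" "A n \<subseteq> N"
    using A[of n] by auto
  \<comment> \<open>Conversely, every value is a combination of the coefficients with factors in
    E^p, so the norm field is no larger than the last step of the tower.\<close>
  have "pform_values E ?cs \<subseteq> A n"
  proof
    fix x assume "x \<in> pform_values E ?cs"
    then obtain v where v: "\<forall>j. v j \<in> E" "x = pform_eval ?cs v" by (auto simp: pform_values_def)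
    note An' = subfield_setD(1)[OF An(1)]
    have "?cs ! j * v j ^ ?p \<in> A n" if "j < Suc n" for j
    proof (rule subring_setD(5)[OF An'])
      show "?cs ! j \<in> A n" using nth[OF that] An(3)[of j] that subfield_setD[OF An(1)] by auto
      show "v j ^ ?p \<in> A n" using v(1) An(2) by (auto simp: pth_powers_def)
    qed
    thus "x \<in> A n" unfolding v(2) pform_eval_def len by (intro subring_set_sum[OF An']) auto
  qed
  hence "N \<subseteq> A n"
    unfolding N_def norm_field_def using An(2)
    by (intro generate_field_least[OF An(1)]) (auto intro!: subfield_setD(9)[OF An(1)])
  hence N: "N = A n" using An(4) by blast
  obtain d where d: "tdim d (pth_powers E) N" using A[of n] N by auto
  show "\<forall>j\<in>{1..n}. c j \<in> pth_powers E" if "norm_degree E ?cs \<le> 1"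
  proof -
    have "d \<le> 1" using that ext_degree_eq[OF sub0 d] by (simp add: norm_degree_def N_def)
    moreover have "d \<ge> 1" by (rule tdim_ge_1[OF sub0 d]) (use subfield_setD[OF subN] in blast)
    ultimately have "d = 1" by simp
    hence "N = pth_powers E" using tdim_1_eq[OF sub0 _ PN] d by simp
    thus ?thesis using cN by blast
  qed
qed

section \<open>The generic tower \<open>M(T\<^sub>1\<^sup>1\<^sup>/\<^sup>p, \<dots>, T\<^sub>r\<^sup>1\<^sup>/\<^sup>p)\<close>\<close>

lemma CHAR_field_embedding:
  assumes emb: "field_embedding (\<iota> :: 'a::field \<Rightarrow> 'k::field)"
  shows "CHAR('k) = CHAR('a)"
proof -
  have of_nat: "\<iota> (of_nat n) = of_nat n" for n
    by (induction n) (simp_all add: field_embeddingD[OF emb])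
  have "of_nat n = (0 :: 'k) \<longleftrightarrow> of_nat n = (0 :: 'a)" for n
    using injD[OF field_embedding_inj[OF emb], of "of_nat n" 0]
    by (auto simp: of_nat field_embeddingD[OF emb] dest: arg_cong[of _ _ \<iota>])
  thus ?thesis by (intro CHAR_eqI) (simp_all flip: of_nat_eq_0_iff_char_dvd)
qed

definition big_eval :: "(((nat \<times> nat) \<Rightarrow>\<^sub>0 nat) \<Rightarrow>\<^sub>0 'a::field) \<Rightarrow> 'a big"
  where "big_eval P = to_ac (Fract P 1)"

lemma big_eval_simps:
  "big_eval (P + Q) = big_eval P + big_eval Q" "big_eval (P * Q) = big_eval P * big_eval Q"
  "big_eval (P - Q) = big_eval P - big_eval Q"
  "big_eval 0 = 0" "big_eval 1 = 1" "big_eval P = 0 \<longleftrightarrow> P = 0"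
  "big_eval (Poly_Mapping.single 0 c) = big_const c"
  "big_eval (mon (Poly_Mapping.single (i, j) 1)) = big_var i j"
proof -
  show add: "big_eval (P + Q) = big_eval P + big_eval Q" for P Q :: "((nat \<times> nat) \<Rightarrow>\<^sub>0 nat) \<Rightarrow>\<^sub>0 'a"
    unfolding big_eval_def to_ac_add[symmetric] by simp
  show "big_eval (P * Q) = big_eval P * big_eval Q"
    unfolding big_eval_def to_ac_mult[symmetric] by simp
  show "big_eval (P - Q) = big_eval P - big_eval Q" using add[of "P - Q" Q] by simp
  show "big_eval 0 = 0" by (simp add: big_eval_def flip: Zero_fract_def)
  show "big_eval 1 = 1" by (simp add: big_eval_def flip: One_fract_def)
  show "big_eval P = 0 \<longleftrightarrow> P = 0" by (simp add: big_eval_def eq_fract Zero_fract_def)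
qed (simp_all add: big_eval_def big_const_def big_var_def)

lemma big_eval_sum: "big_eval (sum f J) = (\<Sum>j\<in>J. big_eval (f j))"
  by (induction J rule: infinite_finite_induct) (simp_all add: big_eval_simps)

lemma big_eval_power: "big_eval (mon (Poly_Mapping.single (i, j) k)) = (big_var i j ^ k :: 'a::field big)"
proof (induction k)
  case 0
  show ?case by (simp add: big_eval_simps)
next
  case (Suc k)
  have "(mon (Poly_Mapping.single (i, j) (Suc k)) :: ((nat \<times> nat) \<Rightarrow>\<^sub>0 nat) \<Rightarrow>\<^sub>0 'a) =
      mon (Poly_Mapping.single (i, j) 1) * mon (Poly_Mapping.single (i, j) k)"
    by (simp add: mult_single flip: single_add)
  hence "big_eval (mon (Poly_Mapping.single (i, j) (Suc k)) :: ((nat \<times> nat) \<Rightarrow>\<^sub>0 nat) \<Rightarrow>\<^sub>0 'a) =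
      big_eval (mon (Poly_Mapping.single (i, j) 1)) * big_eval (mon (Poly_Mapping.single (i, j) k))"
    by (simp only: big_eval_simps)
  thus ?case using Suc by (simp only: big_eval_simps power_Suc)
qed

lemma embedding_big_const: "field_embedding big_const"
proof -
  have "big_const (a + b) = big_const a + big_const b" "big_const (a * b) = big_const a * big_const b"
    for a b :: 'a
    unfolding big_eval_simps(7)[symmetric] big_eval_simps(1,2)[symmetric]
    by (simp_all add: single_add mult_single)
  moreover have "big_const (1 :: 'a) = 1" unfolding big_eval_simps(7)[symmetric] by (simp add: big_eval_simps)
  ultimately show ?thesis by (simp add: ring_hom_def)
qed

lemma CHAR_big: "CHAR('a::field big) = CHAR('a)"
  by (rule CHAR_field_embedding[OF embedding_big_const])

context
  assumes p: "CHAR('a::field) > 0"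
begin

lemma p_big: "CHAR('a big) > 0"
  using p by (simp only: CHAR_big)

lemma pth_power_inj: "(x :: 'a big) ^ CHAR('a) = y ^ CHAR('a) \<Longrightarrow> x = y"
proof -
  assume eq: "x ^ CHAR('a) = y ^ CHAR('a)"
  have "((x - y) + y) ^ CHAR('a big) = (x - y) ^ CHAR('a big) + y ^ CHAR('a big)"
    by (rule freshmans_dream[OF prime_CHAR_semidom[OF p_big] refl])
  hence "(x - y) ^ CHAR('a) = 0" using eq by (simp only: CHAR_big) simp
  thus "x = y" by simp
qed

text \<open>In an algebraically closed field the p-th root exists, and injectivity of Frobenius
  makes it unique, so the definite description denotes it.\<close>

lemma pth_root_power: "pth_root x ^ CHAR('a) = (x :: 'a big)"
proof -
  obtain y where y: "y ^ CHAR('a) = x" using nth_root_exists[OF p] by blast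
  have "pth_root x = y"
    unfolding pth_root_def CHAR_big by (rule the_equality) (use y pth_power_inj in blast)+
  thus ?thesis using y by simp
qed

text \<open>The counterpart over M of the coefficients z_ij of a function field.\<close>

definition big_coeff :: "nat \<Rightarrow> nat \<Rightarrow> 'a big"
  where "big_coeff i j = big_var i j ^ CHAR('a)"

lemma mpolys_over_mono: "V \<subseteq> V' \<Longrightarrow> mpolys_over E V \<subseteq> mpolys_over E V'"
  by (fastforce simp: mpolys_over_def)

text \<open>Level i consists of the polynomials in the rows \<sigma> 1, ..., \<sigma> i of
  variables, and the p-th powers of a new row are independent over them. The reindexing \<sigma>
  allows a row beyond \<open>s\<close> to follow directly upon the first \<open>s\<close>
  rows.\<close>

lemma coeff_chain_big:
  assumes inj: "inj_on \<sigma> {1..t}"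
  shows "coeff_chain big_const t m (\<lambda>i. big_coeff (\<sigma> i))
    (\<lambda>i. big_eval ` mpolys_over (UNIV :: 'a set) {(\<sigma> i', j) | i' j. i' \<in> {1..min i t}})"
proof -
  define V where "V = (\<lambda>i. {(\<sigma> i', j :: nat) | i' j. i' \<in> {1..min i t}})"
  define L where "L = (\<lambda>i. big_eval ` mpolys_over (UNIV :: 'a set) (V i))"
  have U: "subring_set (UNIV :: 'a set)" by (simp add: subring_set_def)
  have single: "Poly_Mapping.single \<alpha> c \<in> mpolys_over (UNIV :: 'a set) V" if "Poly_Mapping.keys \<alpha> \<subseteq> V" for \<alpha> c V
    using that by (intro mpolys_over_single) auto
  have sub: "subring_set (L i)" for i
    unfolding L_def by (rule subring_set_eval_image[OF embedding_big_const U]) (simp_all add: big_eval_simps)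
  have const: "range big_const \<subseteq> L 0"
    using single[of 0 "V 0"] by (auto simp: L_def simp flip: big_eval_simps(7))
  have inc: "L (i - 1) \<subseteq> L i" for i
    unfolding L_def by (intro image_mono mpolys_over_mono) (auto simp: V_def)
  have coeff: "big_coeff (\<sigma> i) j \<in> L i" if "i \<in> {1..t}" for i j
  proof -
    have "mon (Poly_Mapping.single (\<sigma> i, j) CHAR('a)) \<in> mpolys_over (UNIV :: 'a set) (V i)"
      using that by (intro single) (auto simp: V_def)
    thus ?thesis unfolding L_def big_coeff_def big_eval_power[symmetric] by blast
  qed
  have indep: "\<forall>j\<in>{1..n}. c j = 0"
    if i: "i \<in> {1..t}" and c: "\<forall>j\<in>{1..n}. c j \<in> L (i - 1)" and sum0: "(\<Sum>j=1..n. c j * big_coeff (\<sigma> i) j) = 0"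
    for i n c
  proof -
    have "\<forall>j\<in>{1..n}. \<exists>P. P \<in> mpolys_over UNIV (V (i - 1)) \<and> c j = big_eval P" using c by (auto simp: L_def)
    from bchoice[OF this] obtain P where PP: "\<forall>j\<in>{1..n}. P j \<in> mpolys_over UNIV (V (i - 1)) \<and> c j = big_eval (P j)" ..
    have P: "P j \<in> mpolys_over UNIV (V (i - 1))" "c j = big_eval (P j)" if "j \<in> {1..n}" for j
      using bspec[OF PP that] by simp_all
    define \<gamma> where "\<gamma> = (\<lambda>j :: nat. Poly_Mapping.single (\<sigma> i, j) CHAR('a))"
    have nV: "(\<sigma> i, j) \<notin> V (i - 1)" for j
    proof
      assume "(\<sigma> i, j) \<in> V (i - 1)"
      then obtain i' where i': "\<sigma> i = \<sigma> i'" "i' \<in> {1..min (i - 1) t}" by (auto simp: V_def)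
      hence "i = i'" using inj_onD[OF inj i'(1)] i by auto
      thus False using i' i by auto
    qed
    have "big_eval (\<Sum>j=1..n. P j * mon (\<gamma> j)) = (\<Sum>j=1..n. c j * big_coeff (\<sigma> i) j)"
      unfolding big_eval_sum
      by (rule sum.cong) (simp_all add: P(2) big_eval_simps \<gamma>_def big_eval_power big_coeff_def)
    hence zero: "(\<Sum>j=1..n. P j * mon (\<gamma> j)) = 0" using sum0 by (simp add: big_eval_simps)
    have "P j0 = 0" if j0: "j0 \<in> {1..n}" for j0
    proof (rule ccontr)
      assume "P j0 \<noteq> 0"
      then obtain \<alpha> where \<alpha>: "\<alpha> \<in> Poly_Mapping.keys (P j0)" by (metis ex_in_conv keys_eq_empty)
      have key0: "Poly_Mapping.lookup \<beta> (\<sigma> i, j') = 0"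
        if "\<beta> \<in> Poly_Mapping.keys (P j)" "j \<in> {1..n}" for \<beta> j j'
      proof -
        have "Poly_Mapping.keys \<beta> \<subseteq> V (i - 1)" using P(1)[OF that(2)] that(1) by (simp add: mpolys_over_def)
        hence "(\<sigma> i, j') \<notin> Poly_Mapping.keys \<beta>" using nV by blast
        thus ?thesis by (simp add: in_keys_iff)
      qed
      \<comment> \<open>The monomial \<alpha> of \<open>P j0\<close>, shifted by the p-th power of
        the variable (\<sigma> i, j0), involves the new row only in column j0, so no other summand
        can produce it.\<close>
      have other: "Poly_Mapping.lookup (P j * mon (\<gamma> j)) (\<alpha> + \<gamma> j0) = 0" if j: "j \<in> {1..n}" "j \<noteq> j0" for j
      proof (rule ccontr)
        assume "Poly_Mapping.lookup (P j * mon (\<gamma> j)) (\<alpha> + \<gamma> j0) \<noteq> 0"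
        hence "\<alpha> + \<gamma> j0 \<in> Poly_Mapping.keys (P j * mon (\<gamma> j))" by (simp add: in_keys_iff)
        then obtain a b where ab: "\<alpha> + \<gamma> j0 = a + b" "a \<in> Poly_Mapping.keys (P j)"
          "b \<in> Poly_Mapping.keys (mon (\<gamma> j) :: _ \<Rightarrow>\<^sub>0 'a)"
          using keys_mult[of "P j" "mon (\<gamma> j)"] by blast
        hence b: "b = \<gamma> j" by (simp split: if_splits)
        have "Poly_Mapping.lookup (\<alpha> + \<gamma> j0) (\<sigma> i, j0) = Poly_Mapping.lookup (a + \<gamma> j) (\<sigma> i, j0)"
          using ab b by simp
        thus False using key0[OF ab(2) j(1)] p j(2) by (simp add: \<gamma>_def lookup_add lookup_single when_def)
      qed
      have "0 = (\<Sum>j=1..n. Poly_Mapping.lookup (P j * mon (\<gamma> j)) (\<alpha> + \<gamma> j0))"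
        using zero by (simp flip: lookup_sum)
      also have "\<dots> = Poly_Mapping.lookup (P j0 * mon (\<gamma> j0)) (\<alpha> + \<gamma> j0)"
        using j0 other by (subst sum.remove[of _ j0]) auto
      also have "\<dots> = Poly_Mapping.lookup (P j0) \<alpha>" by (rule lookup_times_single)
      finally show False using \<alpha> by (simp add: in_keys_iff)
    qed
    thus ?thesis using P(2) by (simp add: big_eval_simps)
  qed
  show ?thesis
    unfolding coeff_chain_def L_def[symmetric, unfolded V_def]
  proof (intro conjI allI ballI impI)
    show "range big_const \<subseteq> L 0" by (rule const)
    show "subring_set (L i)" for i by (rule sub)
    fix i assume i: "i \<in> {1..t}"
    show "L (i - 1) \<subseteq> L i" by (rule inc)
    show "big_coeff (\<sigma> i) j \<in> L i" for j by (rule coeff[OF i])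
    show "c j = 0" if "\<forall>j\<in>{1..m i}. c j \<in> L (i - 1)" "(\<Sum>j=1..m i. c j * big_coeff (\<sigma> i) j) = 0"
      "j \<in> {1..m i}" for c j
      using indep[OF i that(1,2)] that(3) by blast
  qed
qed

text \<open>The evaluation \<open>big_eval\<close> is injective, so the kernel condition of
  \<open>derivation_extend_polys\<close> reduces to the zero polynomial.\<close>

lemma derivation_extend_big:
  assumes der: "derivation big_const \<delta>"
  shows "\<exists>\<delta>'. derivation_on (\<lambda>x. x) (fractions (range big_eval)) \<delta>' \<and> (\<forall>c::'a. \<delta>' (big_const c) = \<delta> c)"
proof -
  have U: "subring_set (UNIV :: 'a set)" by (simp add: subring_set_def)
  have "mpolys_over (UNIV :: 'a set) (UNIV :: (nat \<times> nat) set) = UNIV" by (simp add: mpolys_over_def)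
  moreover have "\<exists>\<delta>'. derivation_on (\<lambda>x. x) (fractions (big_eval ` mpolys_over UNIV UNIV)) \<delta>' \<and>
      (\<forall>c\<in>UNIV. \<delta>' (big_const c) = \<delta> c)"
    by (rule derivation_extend_polys(4)[OF embedding_big_const U der])
       (simp_all add: big_eval_simps)
  ultimately show ?thesis by simp
qed

lemma subring_big_eval: "subring_set (range (big_eval :: _ \<Rightarrow> 'a big))"
proof -
  have U: "subring_set (UNIV :: 'a set)" by (simp add: subring_set_def)
  have "mpolys_over (UNIV :: 'a set) (UNIV :: (nat \<times> nat) set) = UNIV" by (simp add: mpolys_over_def)
  moreover have "subring_set (big_eval ` mpolys_over (UNIV :: 'a set) UNIV)"
    by (rule subring_set_eval_image[OF embedding_big_const U]) (simp_all add: big_eval_simps)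
  ultimately show ?thesis by simp
qed

text \<open>The X_ij^p are constants, so only the coefficients of T_i are differentiated. This
  identifies the i-th functional with the value of the derivation at T_i.\<close>

lemma derivation_T_elem:
  assumes E: "subfield_set E" and const: "range big_const \<subseteq> E"
    and var: "\<And>j. j \<in> {1..m i} \<Longrightarrow> big_var i j \<in> E"
    and der: "derivation_on (\<lambda>x. x) E \<delta>"
  shows "T_elem m a i \<in> E"
    and "\<delta> (T_elem m a i) = comb_functional m big_coeff a i (\<lambda>c::'a. \<delta> (big_const c))"
proof -
  note E' = subfield_setD(1)[OF E]
  have cE: "big_const (a i j) \<in> E" for j using const by auto
  have vE: "big_coeff i j \<in> E" if "j \<in> {1..m i}" for j
    unfolding big_coeff_def by (rule subring_set_power[OF E' var[OF that]])
  have v0: "\<delta> (big_coeff i j) = 0" if "j \<in> {1..m i}" for j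
    using derivation_pth_power[OF embedding_id E' der p_big var[OF that]]
    unfolding big_coeff_def CHAR_big .
  have T: "T_elem m a i = (\<Sum>j=1..m i. big_const (a i j) * big_coeff i j)"
    by (simp add: T_elem_def big_coeff_def)
  have prod: "big_const (a i j) * big_coeff i j \<in> E" if "j \<in> {1..m i}" for j
    by (rule subring_setD(5)[OF E' cE vE[OF that]])
  show "T_elem m a i \<in> E" unfolding T using prod by (intro subring_set_sum[OF E'])
  have "\<delta> (T_elem m a i) = (\<Sum>j=1..m i. \<delta> (big_const (a i j) * big_coeff i j))"
    unfolding T by (rule derivation_sum[OF embedding_id E' der prod])
  also have "\<dots> = (\<Sum>j=1..m i. big_coeff i j * \<delta> (big_const (a i j)))"
    by (rule sum.cong) (use derivation_on_mult[OF der cE vE] v0 in auto)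
  finally show "\<delta> (T_elem m a i) = comb_functional m big_coeff a i (\<lambda>c. \<delta> (big_const c))"
    by (simp add: comb_functional_def)
qed

end

section \<open>Consequences of the degree hypothesis\<close>

context
  fixes r s :: nat and m :: "nat \<Rightarrow> nat" and a :: "nat \<Rightarrow> nat \<Rightarrow> 'a::field"
  assumes p: "CHAR('a) > 0" and sr: "s \<le> r"
    and deg: "ext_degree (M_field r m) (MT_field r m a r) = CHAR('a) ^ s"
    and MT_eq: "MT_field r m a r = MT_field r m a s"
begin

private abbreviation (input) "MT \<equiv> MT_field r m a"
private abbreviation (input) "rtT i \<equiv> pth_root (T_elem m a i)"

lemma M_field_facts:
  shows "subfield_set (M_field r m :: 'a big set)" "range big_const \<subseteq> (M_field r m :: 'a big set)"
    "i \<in> {1..r} \<Longrightarrow> j \<in> {1..m i} \<Longrightarrow> big_var i j \<in> (M_field r m :: 'a big set)"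
  unfolding M_field_def by (rule generate_field_subfield) (auto intro: generate_field.incl)

lemma T_in_M: "i \<in> {1..r} \<Longrightarrow> T_elem m a i \<in> M_field r m"
  by (rule derivation_T_elem(1)[OF p M_field_facts(1,2), where \<delta> = "\<lambda>_. 0"])
     (auto simp: derivation_on_def intro: M_field_facts(3))

lemma subfield_MT: "subfield_set (MT t)"
  unfolding MT_field_def by (rule generate_field_subfield)

lemma M_subset_MT: "M_field r m \<subseteq> MT t"
  unfolding MT_field_def using generate_field_incl by blast

lemma root_in_MT: "i \<in> {1..t} \<Longrightarrow> rtT i \<in> MT t"
  unfolding MT_field_def by (auto intro: generate_field.incl)

lemma root_power: "rtT i ^ CHAR('a big) = T_elem m a i"
  unfolding CHAR_big by (rule pth_root_power[OF p])

lemma MT_mono: "t \<le> t' \<Longrightarrow> MT t \<subseteq> MT t'"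
  unfolding MT_field_def by (rule generate_field_mono) auto

lemma MT_0: "MT 0 = M_field r m"
  using generate_field_least[OF M_field_facts(1) order.refl] M_subset_MT[of 0]
  by (auto simp: MT_field_def)

lemma MT_Suc:
  assumes "Suc t \<le> r"
  shows "MT (Suc t) = adjoin (MT t) (rtT (Suc t))"
proof -
  have "rtT (Suc t) ^ CHAR('a big) \<in> MT t"
    unfolding root_power using T_in_M[of "Suc t"] M_subset_MT assms by auto
  hence "adjoin (MT t) (rtT (Suc t)) = generate_field type_ring (insert (rtT (Suc t)) (MT t))"
    using generate_field_insert[OF p_big[OF p] subfield_MT] by simp
  moreover have "generate_field type_ring (insert (rtT (Suc t)) (MT t)) \<subseteq> MT (Suc t)"
    using MT_mono[of t "Suc t"] root_in_MT[of "Suc t" "Suc t"]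
    by (intro generate_field_least[OF subfield_MT]) auto
  moreover have "MT (Suc t) \<subseteq> generate_field type_ring (insert (rtT (Suc t)) (MT t))"
  proof -
    have incl: "insert (rtT (Suc t)) (MT t) \<subseteq> generate_field type_ring (insert (rtT (Suc t)) (MT t))"
      by (rule generate_field_incl)
    have "M_field r m \<union> rtT ` {1..Suc t} \<subseteq> insert (rtT (Suc t)) (MT t)"
      using M_subset_MT[of t] root_in_MT[of _ t] by (auto simp: le_Suc_eq)
    thus ?thesis unfolding MT_field_def[of r m a "Suc t"] using incl
      by (intro generate_field_least[OF generate_field_subfield]) auto
  qed
  ultimately show ?thesis by blast
qed

lemma root_notin_MT:
  assumes i: "i \<in> {1..s}"
  shows "rtT i \<notin> MT (i - 1)"
proof
  assume *: "rtT i \<in> MT (i - 1)"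
  let ?p = "CHAR('a)"
  have p2: "?p \<ge> 2" using prime_CHAR_semidom[OF p] by (rule prime_ge_2_nat)
  note M = M_field_facts(1)
  \<comment> \<open>From step i on, the bound on the degree is one factor p smaller.\<close>
  have "\<exists>d. tdim d (M_field r m) (MT t) \<and> d \<le> ?p ^ t \<and> (i \<le> t \<longrightarrow> d \<le> ?p ^ (t - 1))" if "t \<le> r" for t
    using that
  proof (induction t)
    case 0
    show ?case using tdim_refl[OF M] i by (intro exI[of _ 1]) (auto simp: MT_0)
  next
    case (Suc t)
    then obtain d where d: "tdim d (M_field r m) (MT t)" "d \<le> ?p ^ t" "i \<le> t \<Longrightarrow> d \<le> ?p ^ (t - 1)" by auto
    have "rtT (Suc t) ^ CHAR('a big) \<in> MT t"
      unfolding root_power using T_in_M[of "Suc t"] M_subset_MT Suc.prems by auto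
    from tdim_adjoin[OF p_big[OF p] subfield_MT this] obtain e where e: "e \<le> ?p"
      "tdim e (MT t) (MT (Suc t))" "rtT (Suc t) \<in> MT t \<Longrightarrow> e = 1"
      unfolding MT_Suc[OF Suc.prems] CHAR_big by blast
    have "tdim (d * e) (M_field r m) (MT (Suc t))" by (rule tdim_mult[OF M subfield_MT d(1) e(2)])
    moreover have "d * e \<le> ?p ^ Suc t" using mult_le_mono[OF d(2) e(1)] by (simp add: mult.commute)
    moreover have "d * e \<le> ?p ^ t" if "i \<le> Suc t"
    proof (cases "i = Suc t")
      case True
      hence "e = 1" using e(3) * by simp
      thus ?thesis using d(2) by simp
    next
      case False
      hence it: "i \<le> t" using that by simp
      hence "t = Suc (t - 1)" using i by simp
      hence "?p ^ t = ?p ^ (t - 1) * ?p" by (metis power_Suc mult.commute)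
      thus ?thesis using mult_le_mono[OF d(3)[OF it] e(1)] by simp
    qed
    ultimately show ?case by auto
  qed
  from this[OF sr] obtain d where d: "tdim d (M_field r m) (MT s)" "i \<le> s \<longrightarrow> d \<le> ?p ^ (s - 1)" by blast
  have "d = ?p ^ s" using ext_degree_eq[OF M d(1)] deg by (simp add: MT_eq)
  hence "?p ^ s \<le> ?p ^ (s - 1)" using d(2) i by simp
  moreover have "?p ^ (s - 1) < ?p ^ s" using i p2 by (intro power_strict_increasing) auto
  ultimately show False by simp
qed

private abbreviation (input) "w \<equiv> comb_functional m big_coeff a"

text \<open>Were T_(t+1) a p-th power in the current field, its root would already be there. So a
  derivation trivial on all p-th powers, hence on T_1, ..., T_t, takes the value 1 at T_(t+1); its
  restriction to F witnesses the independence.\<close>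

lemma indep_big: "t \<le> s \<Longrightarrow> indep_functionals big_const (map w [1..<Suc t])"
proof (induction t)
  case (Suc t)
  let ?E = "MT t" and ?T = "T_elem m a"
  have t: "Suc t \<in> {1..s}" "Suc t \<in> {1..r}" using Suc.prems sr by auto
  have TE: "?T (Suc t) \<in> ?E" using T_in_M[OF t(2)] M_subset_MT by blast
  have sub: "subfield_set (pth_powers ?E)" by (rule subfield_set_pth_powers[OF p_big[OF p] subfield_MT])
  have notin: "?T (Suc t) \<notin> pth_powers ?E"
  proof
    assume "?T (Suc t) \<in> pth_powers ?E"
    then obtain x where x: "x \<in> ?E" "?T (Suc t) = x ^ CHAR('a)" unfolding pth_powers_def CHAR_big by blast
    hence "rtT (Suc t) ^ CHAR('a) = x ^ CHAR('a)" using root_power[of "Suc t"] unfolding CHAR_big by simp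
    hence "rtT (Suc t) = x" by (rule pth_power_inj[OF p])
    thus False using root_notin_MT[OF t(1)] x(1) by simp
  qed
  have "pth_powers ?E \<subseteq> ?E"
    using subring_set_power[OF subfield_setD(1)[OF subfield_MT]] by (auto simp: pth_powers_def)
  moreover have "\<And>u. u \<in> ?E \<Longrightarrow> u ^ CHAR('a big) \<in> pth_powers ?E" by (auto simp: pth_powers_def)
  ultimately obtain \<delta> where \<delta>: "derivation_on (\<lambda>x. x) ?E \<delta>" "\<forall>c\<in>pth_powers ?E. \<delta> c = 0" "\<delta> (?T (Suc t)) = 1"
    using exists_derivation[OF p_big[OF p] subfield_MT sub _ _ TE notin] by blast
  define v where "v = (\<lambda>c. \<delta> (big_const c))"
  have const: "range big_const \<subseteq> ?E" using M_field_facts(2) M_subset_MT by blast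
  have v: "derivation big_const v"
    unfolding v_def by (rule derivation_restrict[OF \<delta>(1) const embedding_big_const])
  have wT: "\<delta> (?T i) = w i v" if "i \<in> {1..r}" for i
    unfolding v_def
  proof (rule derivation_T_elem(2)[OF p subfield_MT const _ \<delta>(1)])
    show "big_var i j \<in> ?E" if "j \<in> {1..m i}" for j
      using subsetD[OF M_subset_MT M_field_facts(3)[OF \<open>i \<in> {1..r}\<close> that]] .
  qed
  have "w i v = 0" if "i \<in> {1..t}" for i
  proof -
    have "?T i \<in> pth_powers ?E"
      unfolding pth_powers_def by (rule image_eqI[where x = "rtT i"], rule root_power[symmetric], rule root_in_MT[OF that])
    thus ?thesis using wT[of i] \<delta>(2) that t by auto
  qed
  hence "v \<in> common_kernel big_const (set (map w [1..<Suc t]))"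
    using v by (simp add: common_kernel_def del: upt_Suc)
  moreover have "w (Suc t) v \<noteq> 0" using wT[OF t(2)] \<delta>(3) by simp
  ultimately have "indep_functionals big_const (map w [1..<Suc t] @ [w (Suc t)])"
    unfolding indep_functionals_snoc using Suc.IH Suc.prems by (meson Suc_leD)
  thus ?case by simp
qed simp

lemma functional_w: "\<forall>u\<in>set (map w ks). functional u"
  by (auto intro!: functional_comb[rule_format])

text \<open>Apply both criteria to the form 1: it would have to vanish on the common kernel of
  independent functionals, yet its value on the empty list is 1.\<close>

theorem d_product_nonzero:
  "\<exists>j. (\<forall>i\<in>{1..s}. j i \<in> {1..m i}) \<and> d_product a j s \<noteq> 0"
proof (rule ccontr)
  assume "\<not> ?thesis"
  hence *: "\<forall>j. (\<forall>i\<in>{1..s}. j i \<in> {1..m i}) \<longrightarrow> d_product a j s * 1 = 0"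
    unfolding mult_1_right by blast
  have "coeff_chain big_const s m big_coeff
      (\<lambda>i. big_eval ` mpolys_over (UNIV :: 'a set) {(i', j) | i' j. i' \<in> {1..min i s}})"
    using coeff_chain_big[OF p, of "\<lambda>i. i" s m] by simp
  from foldr_comb_vanish_iff[OF embedding_big_const this, of a 1] *
  have "\<forall>\<delta>s. set \<delta>s \<subseteq> Collect (derivation big_const) \<longrightarrow>
      foldr wedge1 (map w [1..<Suc s]) (ev big_const 1) \<delta>s = 0" by blast
  hence "\<forall>\<delta>s. set \<delta>s \<subseteq> common_kernel big_const (set (map w [1..<Suc s])) \<longrightarrow> ev big_const (1 :: 'a dform) \<delta>s = 0"
    using vanish_common_kernel_iff[OF alternating_ev[OF embedding_big_const] functional_w indep_big[OF order.refl]]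
    by blast
  hence "ev big_const (1 :: 'a dform) [] = 0" by simp
  thus False using ev_1[OF embedding_big_const, of "[] :: ('a \<Rightarrow> 'a big) list"] by simp
qed

text \<open>Extend \<delta> to the rational function field with the variables as constants. The
  elements whose p-th power is a constant form a field that contains M and the roots of T_1, ...,
  T_s, hence by the choice of \<open>s\<close> also the root of T_i; therefore T_i itself is a
  constant.\<close>

lemma w_vanish:
  assumes i: "i \<in> {s<..r}" and \<delta>: "\<delta> \<in> common_kernel big_const (set (map w [1..<Suc s]))"
  shows "w i \<delta> = 0"
proof -
  have der: "derivation big_const \<delta>" and w0: "\<And>i. i \<in> {1..s} \<Longrightarrow> w i \<delta> = 0"
    using \<delta> by (auto simp: common_kernel_def)
  let ?Q = "fractions (range (big_eval :: _ \<Rightarrow> 'a big))"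
  obtain \<delta>' where \<delta>': "derivation_on (\<lambda>x. x) ?Q \<delta>'" "\<And>c. \<delta>' (big_const c) = \<delta> c"
    using derivation_extend_big[OF p der] by blast
  have Q: "subfield_set ?Q" by (rule subfield_set_fractions[OF subring_big_eval[OF p]])
  note Q' = subfield_setD(1)[OF Q]
  have incl: "range (big_eval :: _ \<Rightarrow> 'a big) \<subseteq> ?Q" by (rule fractions_incl[OF subring_big_eval[OF p]])
  have const: "range (big_const :: 'a \<Rightarrow> _) \<subseteq> ?Q" using incl by (auto simp flip: big_eval_simps(7))
  have var: "big_var i j \<in> ?Q" for i j using incl by (auto simp only: big_eval_simps(8)[symmetric])
  have wT: "T_elem m a i \<in> ?Q" "\<delta>' (T_elem m a i) = w i \<delta>" for i
    using derivation_T_elem[OF p Q const var \<delta>'(1), where m = m and i = i and a = a] \<delta>'(2) by auto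
  \<comment> \<open>\<open>Z\<close> is the field of constants and \<open>Y\<close> its field of
    p-th roots. Working with \<open>Y\<close> avoids extending the derivation to the roots.\<close>
  define Z where "Z = {x \<in> ?Q. \<delta>' x = 0}"
  define Y where "Y = {x :: 'a big. x ^ CHAR('a big) \<in> Z}"
  have d0: "\<delta>' 0 = 0" and d1: "\<delta>' 1 = 0"
    using derivation_0[OF embedding_id Q' \<delta>'(1)] derivation_1[OF embedding_id Q' \<delta>'(1)] by auto
  have Z: "subfield_set Z"
  proof -
    have "x + y \<in> Z \<and> x - y \<in> Z \<and> x * y \<in> Z" if xy: "x \<in> Z" "y \<in> Z" for x y
    proof -
      have q: "x \<in> ?Q" "y \<in> ?Q" "\<delta>' x = 0" "\<delta>' y = 0" using xy by (auto simp: Z_def)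
      have "\<delta>' ((x - y) + y) = \<delta>' (x - y) + \<delta>' y"
        by (rule derivation_on_add[OF \<delta>'(1)]) (use q subfield_setD[OF Q] in auto)
      thus ?thesis
        using q derivation_on_add[OF \<delta>'(1) q(1,2)] derivation_on_mult[OF \<delta>'(1) q(1,2)] subfield_setD(4,5,6)[OF Q q(1,2)]
        by (simp add: Z_def)
    qed
    moreover have "inverse x \<in> Z" if x: "x \<in> Z" for x
    proof (cases "x = 0")
      case False
      have q: "x \<in> ?Q" "inverse x \<in> ?Q" "\<delta>' x = 0" using x subfield_setD(7)[OF Q] by (auto simp: Z_def)
      have "x * \<delta>' (inverse x) = 0" using derivation_on_mult[OF \<delta>'(1) q(1,2)] q(3) False d1 by simp
      thus ?thesis using q False by (simp add: Z_def)
    qed (use x in simp)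
    moreover have "0 \<in> Z" "1 \<in> Z" using subfield_setD(2,3)[OF Q] d0 d1 by (auto simp: Z_def)
    ultimately show ?thesis by (auto simp: subfield_set_def subring_set_def)
  qed
  have Y: "subfield_set Y"
  proof -
    let ?p = "CHAR('a big)"
    have add: "(x + y) ^ ?p = x ^ ?p + y ^ ?p" for x y :: "'a big"
      by (rule freshmans_dream[OF prime_CHAR_semidom[OF p_big[OF p]] refl])
    have diff: "(x - y) ^ ?p = x ^ ?p - y ^ ?p" for x y :: "'a big"
      using add[of "x - y" y] by (simp only: diff_add_cancel) simp
    have pos: "?p > 0" by (rule p_big[OF p])
    have "0 ^ ?p = (0 :: 'a big)" using pos by (intro zero_power)
    thus ?thesis
      unfolding subfield_set_def subring_set_def Y_def mem_Collect_eq Ball_def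
      by (simp only: add diff power_mult_distrib power_inverse power_one)
         (auto intro: subfield_setD[OF Z])
  qed
  have pow: "x \<in> Y" if "x \<in> ?Q" for x
    using derivation_pth_power[OF embedding_id Q' \<delta>'(1) p_big[OF p] that] subring_set_power[OF Q' that]
    by (simp only: Y_def Z_def mem_Collect_eq)
  have "MT s \<subseteq> Y"
    unfolding MT_field_def
  proof (rule generate_field_least[OF Y], rule Un_least)
    have "M_field r m \<subseteq> ?Q"
      unfolding M_field_def by (rule generate_field_least[OF Q]) (use const var in auto)
    thus "M_field r m \<subseteq> Y" using pow by blast
    show "rtT ` {1..s} \<subseteq> Y"
      using wT w0 unfolding Y_def Z_def by (auto simp only: root_power mem_Collect_eq)
  qed
  moreover have "rtT i \<in> MT s" using root_in_MT[of i r] i MT_eq by auto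
  ultimately have "rtT i ^ CHAR('a big) \<in> Z" unfolding Y_def by blast
  hence "T_elem m a i \<in> Z" by (simp only: root_power)
  thus ?thesis using wT(2)[of i] by (simp add: Z_def)
qed

text \<open>The functional of index i vanishes on the common kernel of the first s, so the wedge of
  all s + 1 vanishes; the expansion then splits it into the individual products of
  differentials.\<close>

theorem d_product_vanish:
  assumes i: "i \<in> {s<..r}" and j: "\<forall>i\<in>{1..s}. j i \<in> {1..m i}" and j': "j' \<in> {1..m i}"
  shows "d_product a j s * D (a i j') = 0"
proof -
  \<comment> \<open>Row i is renumbered as row s + 1, which puts the s + 1 functionals into the
    shape of one chain.\<close>
  define \<sigma> where "\<sigma> = (\<lambda>t. if t = Suc s then i else t)"
  have \<sigma>: "inj_on \<sigma> {1..Suc s}" using i by (auto simp: inj_on_def \<sigma>_def)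
  let ?w = "comb_functional (\<lambda>t. m (\<sigma> t)) (\<lambda>t. big_coeff (\<sigma> t)) (\<lambda>t. a (\<sigma> t))"
  have wi: "?w t = w (\<sigma> t)" for t by (simp add: comb_functional_def fun_eq_iff)
  have list: "map ?w [1..<Suc (Suc s)] = map w [1..<Suc s] @ [w i]"
  proof -
    have "map ?w [1..<Suc s] = map w [1..<Suc s]"
    proof (rule map_cong[OF refl])
      fix t assume "t \<in> set [1..<Suc s]"
      hence "\<sigma> t = t" by (auto simp: \<sigma>_def)
      thus "?w t = w t" unfolding wi by simp
    qed
    moreover have "?w (Suc s) = w i" unfolding wi by (simp add: \<sigma>_def)
    ultimately show ?thesis by simp
  qed
  have "\<forall>\<delta>s. set \<delta>s \<subseteq> common_kernel big_const (set (map w [1..<Suc s])) \<longrightarrow>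
      wedge1 (w i) (ev big_const (1 :: 'a dform)) \<delta>s = 0"
  proof (intro allI impI)
    fix \<delta>s assume "set \<delta>s \<subseteq> common_kernel big_const (set (map w [1..<Suc s]))"
    hence "wedge1 (w i) (ev big_const (1 :: 'a dform)) \<delta>s = wedge1 (\<lambda>_. 0) (ev big_const 1) \<delta>s"
      using w_vanish[OF i] by (intro wedge1_cong refl) blast
    thus "wedge1 (w i) (ev big_const (1 :: 'a dform)) \<delta>s = 0" by simp
  qed
  hence "\<forall>\<delta>s. set \<delta>s \<subseteq> Collect (derivation big_const) \<longrightarrow>
      foldr wedge1 (map w [1..<Suc s]) (wedge1 (w i) (ev big_const (1 :: 'a dform))) \<delta>s = 0"
    using vanish_common_kernel_iff[OF alternating_wedge1[OF alternating_ev[OF embedding_big_const] functional_comb]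
        functional_w indep_big[OF order.refl]] by blast
  hence "\<forall>\<delta>s. set \<delta>s \<subseteq> Collect (derivation big_const) \<longrightarrow>
      foldr wedge1 (map ?w [1..<Suc (Suc s)]) (ev big_const (1 :: 'a dform)) \<delta>s = 0"
    unfolding list by simp
  hence all: "\<forall>j. (\<forall>t\<in>{1..Suc s}. j t \<in> {1..m (\<sigma> t)}) \<longrightarrow> d_product (\<lambda>t. a (\<sigma> t)) j (Suc s) * 1 = 0"
    using foldr_comb_vanish_iff[OF embedding_big_const coeff_chain_big[OF p \<sigma>, of "\<lambda>t. m (\<sigma> t)"],
        of "\<lambda>t. a (\<sigma> t)" 1] by blast
  have "d_product (\<lambda>t. a (\<sigma> t)) (j(Suc s := j')) (Suc s) = d_product a j s * D (a i j')"
  proof -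
    have "d_product (\<lambda>t. a (\<sigma> t)) (j(Suc s := j')) s = d_product a j s"
      unfolding d_product_def by (intro arg_cong[of _ _ prod_list] map_cong) (auto simp: \<sigma>_def)
    thus ?thesis by (simp add: d_product_Suc) (simp add: \<sigma>_def)
  qed
  moreover have "\<forall>t\<in>{1..Suc s}. (j(Suc s := j')) t \<in> {1..m (\<sigma> t)}"
    using j j' by (auto simp: \<sigma>_def le_Suc_eq)
  ultimately show ?thesis using all[rule_format, of "j(Suc s := j')"] by simp
qed

end

section \<open>Kernels of iterated function fields\<close>

lemma map_normalized_pform:
  "\<iota> 1 = 1 \<Longrightarrow> map \<iota> (normalized_pform n c) = normalized_pform n (\<lambda>j. \<iota> (c j))"
  by (simp add: normalized_pform_def comp_def)

text \<open>Glues the floors of the tower together. Each condition involves a derivation only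
  through its values on F, so the choices made in extending it over the lower floors do not
  matter.\<close>

lemma iterated_function_field_chain:
  fixes \<kappa> :: "'a::field \<Rightarrow> 'k::field"
  assumes p: "CHAR('a) > 0" and it: "is_iterated_function_field \<kappa> (normalized_pforms t m a)"
  obtains z L where "coeff_chain \<kappa> t m z L"
    "\<And>\<delta>. derivation (\<lambda>x. x) \<delta> \<Longrightarrow>
      (\<lambda>c. \<delta> (\<kappa> c)) \<in> common_kernel \<kappa> (set (map (comb_functional m z a) [1..<Suc t]))"
    "\<And>\<delta>. \<delta> \<in> common_kernel \<kappa> (set (map (comb_functional m z a) [1..<Suc t])) \<Longrightarrow>
      \<exists>\<delta>'. derivation (\<lambda>x. x) \<delta>' \<and> (\<forall>c. \<delta>' (\<kappa> c) = \<delta> c)"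
proof -
  have emb: "field_embedding \<kappa>" using it by (simp add: is_iterated_function_field_def)
  have pk: "CHAR('k) > 0" using p CHAR_field_embedding[OF emb] by simp
  define c where "c = (\<lambda>i j. \<kappa> (a i j))"
  obtain L where L: "L 0 = range \<kappa>" "L t = UNIV"
    "\<And>i. i < t \<Longrightarrow> is_function_field (L i) (normalized_pform (m (Suc i)) (c (Suc i))) (L (Suc i))"
  proof -
    have len: "length (normalized_pforms t m a) = t" by (simp add: normalized_pforms_def)
    have nth: "map \<kappa> (normalized_pforms t m a ! i) = normalized_pform (m (Suc i)) (c (Suc i))" if "i < t" for i
      using that by (simp add: normalized_pforms_def map_normalized_pform field_embeddingD[OF emb] c_def
          del: upt_Suc)
    show ?thesis using that it nth unfolding is_iterated_function_field_def len by force
  qed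
  \<comment> \<open>The conclusions of \<open>function_field_step\<close> for the passage from
    \<open>L i\<close> to \<open>L (Suc i)\<close>, packed into one predicate so that the
    coefficients of all floors can be chosen simultaneously.\<close>
  define good where "good = (\<lambda>i z. subfield_set (L (Suc i)) \<and> L i \<subseteq> L (Suc i) \<and>
    (\<forall>j\<in>{1..m (Suc i)}. z j \<in> L (Suc i)) \<and>
    (\<forall>b. (\<forall>j\<in>{1..m (Suc i)}. b j \<in> L i) \<longrightarrow> (\<Sum>j=1..m (Suc i). b j * z j) = 0 \<longrightarrow>
      (\<forall>j\<in>{1..m (Suc i)}. b j = 0)) \<and>
    (\<forall>\<delta>. derivation_on (\<lambda>x. x) (L (Suc i)) \<delta> \<longrightarrow> (\<Sum>j=1..m (Suc i). z j * \<delta> (c (Suc i) j)) = 0) \<and>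
    (\<forall>\<delta>. derivation_on (\<lambda>x. x) (L i) \<delta> \<longrightarrow> (\<Sum>j=1..m (Suc i). z j * \<delta> (c (Suc i) j)) = 0 \<longrightarrow>
      (\<exists>\<delta>'. derivation_on (\<lambda>x. x) (L (Suc i)) \<delta>' \<and> (\<forall>x\<in>L i. \<delta>' x = \<delta> x))))"
  have range: "subfield_set (range \<kappa>)"
  proof -
    have minus: "\<kappa> (x - y) = \<kappa> x - \<kappa> y" for x y using field_embeddingD(1)[OF emb, of "x - y" y] by simp
    have inv: "\<kappa> (inverse x) = inverse (\<kappa> x)" for x
    proof (cases "x = 0")
      case False
      hence "\<kappa> x * \<kappa> (inverse x) = 1" using field_embeddingD(2,3)[OF emb] by (metis right_inverse)
      thus ?thesis by (simp add: inverse_unique)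
    qed (simp add: field_embeddingD[OF emb])
    have I: "x = \<kappa> y \<Longrightarrow> x \<in> range \<kappa>" for x y by simp
    show ?thesis
      unfolding subfield_set_def subring_set_def
    proof (intro conjI ballI)
      show "0 \<in> range \<kappa>" "1 \<in> range \<kappa>"
        by (rule I[of _ 0], simp add: field_embeddingD[OF emb]) (rule I[of _ 1], simp add: field_embeddingD[OF emb])
      fix x assume "x \<in> range \<kappa>"
      then obtain u where u: "x = \<kappa> u" by blast
      show "inverse x \<in> range \<kappa>" by (rule I[of _ "inverse u"]) (simp only: u inv)
      fix y assume "y \<in> range \<kappa>"
      then obtain v where v: "y = \<kappa> v" by blast
      show "x + y \<in> range \<kappa>" by (rule I[of _ "u + v"]) (simp only: u v field_embeddingD(1)[OF emb])
      show "x - y \<in> range \<kappa>" by (rule I[of _ "u - v"]) (simp only: u v minus)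
      show "x * y \<in> range \<kappa>" by (rule I[of _ "u * v"]) (simp only: u v field_embeddingD(2)[OF emb])
    qed
  qed
  have step: "\<exists>z. good i z" if E: "subfield_set (L i)" "range \<kappa> \<subseteq> L i" and i: "i < t" for i
  proof -
    have cE: "c (Suc i) j \<in> L i" for j using E(2) by (auto simp: c_def)
    obtain z where z: "subfield_set (L (Suc i))" "L i \<subseteq> L (Suc i)" "\<And>j. j \<in> {1..m (Suc i)} \<Longrightarrow> z j \<in> L (Suc i)"
      "\<And>b. (\<forall>j\<in>{1..m (Suc i)}. b j \<in> L i) \<Longrightarrow> (\<Sum>j=1..m (Suc i). b j * z j) = 0 \<Longrightarrow>
        \<forall>j\<in>{1..m (Suc i)}. b j = 0"
      "\<And>\<delta>. derivation_on (\<lambda>x. x) (L (Suc i)) \<delta> \<Longrightarrow> (\<Sum>j=1..m (Suc i). z j * \<delta> (c (Suc i) j)) = 0"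
      "\<And>\<delta>. derivation_on (\<lambda>x. x) (L i) \<delta> \<Longrightarrow> (\<Sum>j=1..m (Suc i). z j * \<delta> (c (Suc i) j)) = 0 \<Longrightarrow>
         \<exists>\<delta>'. derivation_on (\<lambda>x. x) (L (Suc i)) \<delta>' \<and> (\<forall>x\<in>L i. \<delta>' x = \<delta> x)"
    proof (rule function_field_step[OF pk E(1) _ L(3)[OF i]])
      show "c (Suc i) j \<in> L i" for j by (rule cE)
      show "\<forall>j\<in>{1..m (Suc i)}. c (Suc i) j \<in> pth_powers (L i)"
        if "norm_degree (L i) (normalized_pform (m (Suc i)) (c (Suc i))) \<le> 1"
        by (rule norm_field_normalized(2)[OF pk E(1) cE that])
    qed (rule that)
    have "good i z"
      unfolding good_def
    proof (intro conjI)
      show "\<forall>b. (\<forall>j\<in>{1..m (Suc i)}. b j \<in> L i) \<longrightarrow> (\<Sum>j=1..m (Suc i). b j * z j) = 0 \<longrightarrow>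
        (\<forall>j\<in>{1..m (Suc i)}. b j = 0)" by (intro allI impI, rule z(4))
      show "\<forall>\<delta>. derivation_on (\<lambda>x. x) (L (Suc i)) \<delta> \<longrightarrow> (\<Sum>j=1..m (Suc i). z j * \<delta> (c (Suc i) j)) = 0"
        by (intro allI impI, rule z(5))
      show "\<forall>\<delta>. derivation_on (\<lambda>x. x) (L i) \<delta> \<longrightarrow> (\<Sum>j=1..m (Suc i). z j * \<delta> (c (Suc i) j)) = 0 \<longrightarrow>
        (\<exists>\<delta>'. derivation_on (\<lambda>x. x) (L (Suc i)) \<delta>' \<and> (\<forall>x\<in>L i. \<delta>' x = \<delta> x))"
        by (intro allI impI, rule z(6))
    qed (use z(1,2,3) in auto)
    thus ?thesis by (rule exI[of "good i" z])
  qed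
  have sub: "subfield_set (L i) \<and> range \<kappa> \<subseteq> L i" if "i \<le> t" for i
    using that
  proof (induction i)
    case 0
    show ?case using range L(1) by simp
  next
    case (Suc i)
    then obtain z where "good i z" using step[of i] by auto
    hence "subfield_set (L (Suc i))" "L i \<subseteq> L (Suc i)" by (simp_all add: good_def)
    thus ?case using Suc by auto
  qed
  hence "\<forall>i\<in>{..<t}. \<exists>z. good i z" using step by auto
  from bchoice[OF this] obtain y where y: "\<forall>i\<in>{..<t}. good i (y i)" ..
  \<comment> \<open>The choice above is indexed by the lower field, from 0; the forms are counted
    from 1.\<close>
  define z where "z = (\<lambda>i. y (i - 1))"
  have goodz: "good i (z (Suc i))" if "i < t" for i using y that by (simp add: z_def)
  have comb: "comb_functional m z a i \<delta> = (\<Sum>j=1..m i. z i j * \<delta> (a i j))" for i \<delta>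
    by (simp add: comb_functional_def)
  \<comment> \<open>Above t the sets \<open>L i\<close> are unconstrained; \<open>min\<close> makes
    the chain stationary there.\<close>
  have "coeff_chain \<kappa> t m z (\<lambda>i. L (min i t))"
    unfolding coeff_chain_def
  proof (intro conjI allI ballI impI)
    show "range \<kappa> \<subseteq> L (min 0 t)" using L(1) by simp
    show "subring_set (L (min i t))" for i using sub[of "min i t"] by (intro subfield_setD(1)) simp
    fix i assume "i \<in> {1..t}"
    then obtain i' where i': "i = Suc i'" "i' < t" by (cases i) auto
    note g = goodz[OF i'(2), unfolded good_def]
    have min: "min i t = Suc i'" "min (i - 1) t = i'" using i' by auto
    show "L (min (i - 1) t) \<subseteq> L (min i t)" unfolding min using g by blast
    show "z i j \<in> L (min i t)" if "j \<in> {1..m i}" for j unfolding min using g that i' by blast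
    show "b j = 0" if "\<forall>j\<in>{1..m i}. b j \<in> L (min (i - 1) t)" "(\<Sum>j=1..m i. b j * z i j) = 0" "j \<in> {1..m i}" for b j
      using g that unfolding min unfolding i' by blast
  qed
  moreover have "(\<lambda>c. \<delta> (\<kappa> c)) \<in> common_kernel \<kappa> (set (map (comb_functional m z a) [1..<Suc t]))"
    if der: "derivation (\<lambda>x. x) \<delta>" for \<delta>
  proof -
    have "derivation \<kappa> (\<lambda>c. \<delta> (\<kappa> c))" by (rule derivation_restrict[OF der _ emb]) simp
    moreover have "comb_functional m z a i (\<lambda>c. \<delta> (\<kappa> c)) = 0" if i: "i \<in> {1..t}" for i
    proof -
      obtain i' where i': "i = Suc i'" "i' < t" using i by (cases i) auto
      have "derivation_on (\<lambda>x. x) (L (Suc i')) \<delta>" by (rule derivation_subset[OF der]) simp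
      thus ?thesis using goodz[OF i'(2)] by (simp add: good_def comb i' c_def)
    qed
    ultimately show ?thesis by (auto simp: common_kernel_def)
  qed
  moreover have "\<exists>\<delta>'. derivation (\<lambda>x. x) \<delta>' \<and> (\<forall>c. \<delta>' (\<kappa> c) = \<delta> c)"
    if \<delta>: "\<delta> \<in> common_kernel \<kappa> (set (map (comb_functional m z a) [1..<Suc t]))" for \<delta>
  proof -
    have der: "derivation \<kappa> \<delta>" and w0: "\<And>i. i \<in> {1..t} \<Longrightarrow> comb_functional m z a i \<delta> = 0"
      using \<delta> by (auto simp: common_kernel_def)
    have "\<exists>\<delta>'. derivation_on (\<lambda>x. x) (L i) \<delta>' \<and> (\<forall>c. \<delta>' (\<kappa> c) = \<delta> c)" if "i \<le> t" for i
      using that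
    proof (induction i)
      case 0
      \<comment> \<open>The derivation is transported to the bottom field
        \<open>range \<kappa>\<close> through the inverse of the injection.\<close>
      define \<delta>' where "\<delta>' = (\<lambda>x. \<delta> (inv_into UNIV \<kappa> x))"
      have inv: "\<delta>' (\<kappa> c) = \<delta> c" for c using field_embedding_inj[OF emb] by (simp add: \<delta>'_def)
      have "derivation_on (\<lambda>x. x) (range \<kappa>) \<delta>'"
        unfolding derivation_on_def
        using derivation_on_add[OF der] derivation_on_mult[OF der]
        by (auto simp: inv simp flip: field_embeddingD(1,2)[OF emb])
      thus ?case using inv L(1) by auto
    next
      case (Suc i)
      then obtain \<delta>' where \<delta>': "derivation_on (\<lambda>x. x) (L i) \<delta>'" "\<forall>c. \<delta>' (\<kappa> c) = \<delta> c" by auto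
      have "(\<Sum>j=1..m (Suc i). z (Suc i) j * \<delta>' (c (Suc i) j)) = 0"
        using w0[of "Suc i"] Suc.prems \<delta>'(2) by (simp add: comb c_def)
      then obtain \<delta>'' where \<delta>'': "derivation_on (\<lambda>x. x) (L (Suc i)) \<delta>''" "\<forall>x\<in>L i. \<delta>'' x = \<delta>' x"
        using goodz[of i] Suc.prems \<delta>'(1) unfolding good_def by (meson Suc_le_lessD)
      have "\<delta>'' (\<kappa> c) = \<delta> c" for c using \<delta>''(2) \<delta>'(2) sub[of i] Suc.prems by (metis Suc_leD rangeI subsetD)
      thus ?case using \<delta>''(1) by blast
    qed
    from this[of t] show ?thesis using L(2) by simp
  qed
  ultimately show ?thesis by (rule that)
qed

section \<open>The kernel of scalar extension\<close>

lemma ev_D_single: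
  assumes "field_embedding \<iota>" "derivation \<iota> \<delta>"
  shows "ev \<iota> (D b) [\<delta>] = \<delta> b"
  using ev_D[OF assms(1), of "[\<delta>]" b 1] ev_1[OF assms(1), of "[]"] assms(2) by simp

text \<open>\<open>I1\<close> and \<open>I2\<close> are statements in Omega(F), to be supplied by
  the generic tower. By the expansion over the present tower, \<open>I1\<close> makes the first s
  functionals independent, and \<open>I2\<close> makes the remaining ones vanish on their common
  kernel.\<close>

lemma dform_map_eq_0_iff:
  fixes \<kappa> :: "'a::field \<Rightarrow> 'k::field"
  assumes p: "CHAR('a) > 0" and it: "is_iterated_function_field \<kappa> (normalized_pforms t m a)" and st: "s \<le> t"
    and I1: "\<exists>j. (\<forall>i\<in>{1..s}. j i \<in> {1..m i}) \<and> d_product a j s \<noteq> 0"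
    and I2: "\<And>i j j'. i \<in> {s<..t} \<Longrightarrow> \<forall>i\<in>{1..s}. j i \<in> {1..m i} \<Longrightarrow> j' \<in> {1..m i} \<Longrightarrow>
      d_product a j s * D (a i j') = 0"
  shows "dform_map \<kappa> \<omega> = 0 \<longleftrightarrow> (\<forall>j. (\<forall>i\<in>{1..s}. j i \<in> {1..m i}) \<longrightarrow> d_product a j s * \<omega> = 0)"
proof -
  have emb: "field_embedding \<kappa>" using it by (simp add: is_iterated_function_field_def)
  obtain z L where chain_t: "coeff_chain \<kappa> t m z L"
    and res: "\<And>\<delta>. derivation (\<lambda>x. x) \<delta> \<Longrightarrow>
      (\<lambda>c. \<delta> (\<kappa> c)) \<in> common_kernel \<kappa> (set (map (comb_functional m z a) [1..<Suc t]))"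
    and ext: "\<And>\<delta>. \<delta> \<in> common_kernel \<kappa> (set (map (comb_functional m z a) [1..<Suc t])) \<Longrightarrow>
      \<exists>\<delta>'. derivation (\<lambda>x. x) \<delta>' \<and> (\<forall>c. \<delta>' (\<kappa> c) = \<delta> c)"
    by (rule iterated_function_field_chain[OF p it]) (rule that)
  have chain: "coeff_chain \<kappa> s m z L" by (rule coeff_chain_mono[OF chain_t st])
  define ws where "ws = map (comb_functional m z a) [1..<Suc s]"
  have lin: "\<forall>w\<in>set ws. functional w" by (auto simp: ws_def intro!: functional_comb[rule_format])
  have expand: "(\<forall>\<delta>s. set \<delta>s \<subseteq> Collect (derivation \<kappa>) \<longrightarrow> foldr wedge1 ws (ev \<kappa> \<eta>) \<delta>s = 0) \<longleftrightarrow>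
      (\<forall>j. (\<forall>i\<in>{1..s}. j i \<in> {1..m i}) \<longrightarrow> d_product a j s * \<eta> = 0)" for \<eta>
    unfolding ws_def by (rule foldr_comb_vanish_iff[OF emb chain])
  obtain \<delta>s where "set \<delta>s \<subseteq> Collect (derivation \<kappa>)" "foldr wedge1 ws (ev \<kappa> 1) \<delta>s \<noteq> 0"
    using expand[of 1] I1 unfolding mult_1_right by blast
  hence ind: "indep_functionals \<kappa> ws" by (rule wedge_nonzero_imp_indep[OF alternating_ev[OF emb] lin])
  have ker: "(\<forall>\<delta>s. set \<delta>s \<subseteq> common_kernel \<kappa> (set ws) \<longrightarrow> ev \<kappa> \<eta> \<delta>s = 0) \<longleftrightarrow>
      (\<forall>j. (\<forall>i\<in>{1..s}. j i \<in> {1..m i}) \<longrightarrow> d_product a j s * \<eta> = 0)" for \<eta>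
    using vanish_common_kernel_iff[OF alternating_ev[OF emb] lin ind, of \<eta>] expand[of \<eta>] by (rule trans)
  \<comment> \<open>This is \<open>I2\<close> read through the criterion \<open>ker\<close> for the
    1-form \<open>D (a i j')\<close>, evaluated at the single derivation \<delta>.\<close>
  have zero: "\<delta> (a i j') = 0" if \<delta>: "\<delta> \<in> common_kernel \<kappa> (set ws)" and i: "i \<in> {s<..t}" "j' \<in> {1..m i}" for \<delta> i j'
  proof -
    have "\<forall>j. (\<forall>i\<in>{1..s}. j i \<in> {1..m i}) \<longrightarrow> d_product a j s * D (a i j') = 0" using I2[OF i(1) _ i(2)] by simp
    hence "ev \<kappa> (D (a i j')) [\<delta>] = 0" using ker[of "D (a i j')"] \<delta> by simp
    thus ?thesis using ev_D_single[OF emb, of \<delta> "a i j'"] \<delta> by (simp add: common_kernel_def)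
  qed
  have sub: "common_kernel \<kappa> (set ws) \<subseteq> common_kernel \<kappa> (set (map (comb_functional m z a) [1..<Suc t]))"
  proof
    fix \<delta> assume \<delta>: "\<delta> \<in> common_kernel \<kappa> (set ws)"
    have "comb_functional m z a i \<delta> = 0" if "i \<in> {1..t}" for i
    proof (cases "i \<le> s")
      case True
      hence "i \<in> set [1..<Suc s]" using that by (simp del: upt_Suc)
      hence "comb_functional m z a i \<in> set ws" unfolding ws_def set_map by (rule imageI)
      thus ?thesis using \<delta> by (simp add: common_kernel_def)
    next
      case False
      thus ?thesis using zero[OF \<delta>] that by (simp add: comb_functional_def)
    qed
    thus "\<delta> \<in> common_kernel \<kappa> (set (map (comb_functional m z a) [1..<Suc t]))"
      using \<delta> by (auto simp: common_kernel_def)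
  qed
  have sup: "common_kernel \<kappa> (set (map (comb_functional m z a) [1..<Suc t])) \<subseteq> common_kernel \<kappa> (set ws)"
    using st by (auto simp: common_kernel_def ws_def)
  have "dform_map \<kappa> \<omega> = 0 \<longleftrightarrow> (\<forall>\<delta>s. set \<delta>s \<subseteq> Collect (derivation (\<lambda>x. x)) \<longrightarrow> ev (\<lambda>x. x) (dform_map \<kappa> \<omega>) \<delta>s = 0)"
    using ev_eq_0_imp[of "dform_map \<kappa> \<omega>"] ev_0[OF embedding_id] by auto
  also have "\<dots> \<longleftrightarrow> (\<forall>\<delta>s. set \<delta>s \<subseteq> Collect (derivation (\<lambda>x. x)) \<longrightarrow> ev \<kappa> \<omega> (map (\<lambda>\<delta> c. \<delta> (\<kappa> c)) \<delta>s) = 0)"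
    using ev_dform_map[OF emb] by simp
  also have "\<dots> \<longleftrightarrow> (\<forall>\<delta>s. set \<delta>s \<subseteq> common_kernel \<kappa> (set ws) \<longrightarrow> ev \<kappa> \<omega> \<delta>s = 0)" (is "?A \<longleftrightarrow> ?B")
  proof
    assume ?A
    show ?B
    proof (intro allI impI)
      fix \<delta>s assume "set \<delta>s \<subseteq> common_kernel \<kappa> (set ws)"
      hence "\<forall>\<delta>\<in>set \<delta>s. \<exists>\<delta>'. derivation (\<lambda>x. x) \<delta>' \<and> (\<forall>c. \<delta>' (\<kappa> c) = \<delta> c)" using sub ext by auto
      from bchoice[OF this] obtain g where g: "\<forall>\<delta>\<in>set \<delta>s. derivation (\<lambda>x. x) (g \<delta>) \<and> (\<forall>c. g \<delta> (\<kappa> c) = \<delta> c)" ..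
      have "map (\<lambda>\<delta> c. \<delta> (\<kappa> c)) (map g \<delta>s) = \<delta>s"
        using g by (auto simp: fun_eq_iff intro!: map_idI)
      moreover have "set (map g \<delta>s) \<subseteq> Collect (derivation (\<lambda>x. x))" using g by auto
      ultimately show "ev \<kappa> \<omega> \<delta>s = 0" using \<open>?A\<close> by metis
    qed
  next
    assume B: ?B
    show ?A
    proof (intro allI impI)
      fix \<delta>s :: "('k \<Rightarrow> 'k) list" assume "set \<delta>s \<subseteq> Collect (derivation (\<lambda>x. x))"
      hence "set (map (\<lambda>\<delta> c. \<delta> (\<kappa> c)) \<delta>s) \<subseteq> common_kernel \<kappa> (set ws)" using res sup by auto
      thus "ev \<kappa> \<omega> (map (\<lambda>\<delta> c. \<delta> (\<kappa> c)) \<delta>s) = 0" using B by blast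
    qed
  qed
  also have "\<dots> \<longleftrightarrow> (\<forall>j. (\<forall>i\<in>{1..s}. j i \<in> {1..m i}) \<longrightarrow> d_product a j s * \<omega> = 0)" by (rule ker)
  finally show ?thesis .
qed

section \<open>Annihilators\<close>

lemma form_degree_commute:
  assumes "\<omega> \<in> Omega n"
  shows "D b * \<omega> = (if even n then \<omega> * D b else - (\<omega> * D b))"
proof -
  have wedge: "D b * wedge_list us = (if even (length us) then wedge_list us * D b else - (wedge_list us * D b))" for us
  proof (induction us)
    case (Cons u us)
    have "D b * wedge_list (u # us) = - (form1 u * (D b * wedge_list us))"
      by (simp add: wedge_list_Cons form1_D' )
    thus ?case by (simp add: Cons wedge_list_Cons mult.assoc)
  qed (simp add: wedge_list_def)
  obtain f where f: "\<forall>us\<in>Poly_Mapping.keys f. length us = n" "\<omega> = abs_dform f"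
    using assms by (auto simp: Omega_def)
  have "D b * (form0 c * wedge_list us) = (if even n then form0 c * wedge_list us * D b else - (form0 c * wedge_list us * D b))"
    if "us \<in> Poly_Mapping.keys f" for us c
  proof -
    have "length us = n" using f(1) that by blast
    thus ?thesis by (simp add: form0_commute'[of "D b"] wedge mult.assoc)
  qed
  thus ?thesis
    unfolding f(2) abs_dform_conv_pm_sum pm_sum_def
    by (simp add: sum_distrib_left sum_distrib_right sum_negf)
qed

text \<open>Graded commutativity changes only the sign. Annihilators multiply on the right, while
  the expansion produces the product of differentials on the left.\<close>

lemma D_product_commute_eq_0:
  assumes "\<omega> \<in> Omega n"
  shows "prod_list (map D as) * \<omega> = 0 \<longleftrightarrow> \<omega> * prod_list (map D as) = 0"
proof -
  have "prod_list (map D as) * \<omega> = \<omega> * prod_list (map D as) \<or> prod_list (map D as) * \<omega> = - (\<omega> * prod_list (map D as))"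
  proof (induction as)
    case (Cons b as)
    have "prod_list (map D (b # as)) * \<omega> = D b * (prod_list (map D as) * \<omega>)" by (simp add: mult.assoc)
    also have "\<dots> = D b * \<omega> * prod_list (map D as) \<or> \<dots> = - (D b * \<omega> * prod_list (map D as))"
      using Cons by (auto simp: mult.assoc)
    finally show ?case unfolding form_degree_commute[OF assms] by (auto simp: mult.assoc split: if_splits)
  qed simp
  thus ?thesis by auto
qed

text \<open>\<open>dx\<close> lies in the span of \<open>{dy | y \<in> S}\<close>, in the form in which it is used.\<close>

definition d_spanned :: "'a::field set \<Rightarrow> 'a \<Rightarrow> bool"
  where "d_spanned S x \<longleftrightarrow> (\<forall>\<eta> \<zeta>. (\<forall>y\<in>S. \<eta> * (D y * \<zeta>) = 0) \<longrightarrow> \<eta> * (D x * \<zeta>) = 0)"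

lemma D_power: "D (x ^ Suc n) = form0 (of_nat (Suc n) * x ^ n) * D (x :: 'a::field)"
proof (induction n)
  case (Suc n)
  have "D (x ^ Suc (Suc n)) = form0 x * D (x ^ Suc n) + form0 (x ^ Suc n) * D x"
    using D_mult[of x "x ^ Suc n"] by simp
  also have "\<dots> = (form0 (x * (of_nat (Suc n) * x ^ n)) + form0 (x ^ Suc n)) * D x"
    unfolding Suc by (simp only: form0_mult distrib_right mult.assoc)
  also have "\<dots> = form0 (of_nat (Suc (Suc n)) * x ^ Suc n) * D x"
    by (simp add: algebra_simps flip: form0_add)
  finally show ?case .
qed simp

lemma D_pth_power: "CHAR('a) > 0 \<Longrightarrow> D (x ^ CHAR('a)) = (0 :: 'a::field dform)"
proof -
  assume "CHAR('a) > 0"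
  then obtain n where n: "CHAR('a) = Suc n" using gr0_implies_Suc by blast
  have "of_nat (Suc n) = (0 :: 'a)" unfolding n[symmetric] by simp
  thus ?thesis unfolding n D_power by simp
qed

text \<open>The p-th powers have differential 0, and the field operations preserve the property by
  additivity and the Leibniz rule.\<close>

lemma d_spanned_generate_field:
  assumes p: "CHAR('a) > 0" and x: "x \<in> generate_field type_ring (pth_powers UNIV \<union> (S :: 'a::field set))"
  shows "d_spanned S x"
proof -
  have lin: "\<eta> * (form0 c * \<theta> * \<zeta>) = form0 c * (\<eta> * (\<theta> * \<zeta>))" for \<eta> \<theta> \<zeta> :: "'a dform" and c
    by (simp add: mult.assoc form0_commute'[of \<eta>])
  show ?thesis
    using x
  proof (induction rule: generate_field.induct)
    case one
    show ?case by (simp add: d_spanned_def)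
  next
    case (incl h)
    thus ?case using D_pth_power[OF p] by (auto simp: d_spanned_def pth_powers_def)
  next
    case (a_inv h)
    have "D (- h) = - D h" using D_add[of h "- h"] by (simp add: eq_neg_iff_add_eq_0 add.commute)
    thus ?case using a_inv.IH by (simp add: d_spanned_def)
  next
    case (m_inv h)
    hence h: "h \<noteq> 0" by simp
    \<comment> \<open>Differentiating the product of h and 1/h yields d(1/h) = - dh / h^2.\<close>
    have "form0 h * D (inverse h) + form0 (inverse h) * D h = 0"
      using D_mult[of h "inverse h"] h by simp
    hence 1: "form0 (inverse h) * (form0 h * D (inverse h)) = - (form0 (inverse h) * (form0 (inverse h) * D h))"
      by (simp add: eq_neg_iff_add_eq_0 flip: distrib_left)
    have 2: "form0 (inverse h) * (form0 h * D (inverse h)) = D (inverse h)"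
      using h by (simp flip: mult.assoc form0_mult)
    have "form0 (- c) = - form0 c" for c :: 'a
      using form0_add[of c "- c"] by (simp add: eq_neg_iff_add_eq_0 add.commute)
    hence "D (inverse h) = form0 (- (inverse h * inverse h)) * D h"
      using 1 unfolding 2 by (simp add: form0_mult mult.assoc)
    thus ?case using m_inv.IH h by (simp add: d_spanned_def type_ring_inv lin)
  next
    case (eng_add g h)
    thus ?case by (simp add: d_spanned_def D_add distrib_left distrib_right)
  next
    case (eng_mult g h)
    thus ?case by (simp add: d_spanned_def D_mult distrib_left distrib_right lin)
  qed
qed

lemma d_wedge_sets_mono:
  "(\<And>i. i \<in> {1..s} \<Longrightarrow> S i \<subseteq> S' i) \<Longrightarrow> d_wedge_sets s S \<subseteq> d_wedge_sets s S'"
  unfolding d_wedge_sets_def by blast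

lemma d_wedge_sets_cong:
  "(\<And>i. i \<in> {1..s} \<Longrightarrow> S i = S' i) \<Longrightarrow> d_wedge_sets s S = d_wedge_sets s S'"
  by (intro equalityI d_wedge_sets_mono) auto

text \<open>A wedge is linear in each factor, so factors spanned by the dS_i may be exchanged for
  elements of dS'_i one at a time.\<close>

lemma annihilates_spanned:
  assumes span: "\<And>i x. i \<in> {1..s} \<Longrightarrow> x \<in> S' i \<Longrightarrow> d_spanned (S i) x"
    and ann: "\<And>u. u \<in> d_wedge_sets s S \<Longrightarrow> \<omega> * u = 0" and u: "u \<in> d_wedge_sets s S'"
  shows "\<omega> * u = 0"
proof -
  let ?P = "\<lambda>t l. prod_list (map (\<lambda>i. D (t i)) l)"
  have "\<omega> * ?P t [1..<Suc s] = 0"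
    if "k \<le> s" "\<forall>i\<in>{1..k}. t i \<in> S' i" "\<forall>i\<in>{Suc k..s}. t i \<in> S i" for k t
    using that
  proof (induction k arbitrary: t)
    case 0
    hence "?P t [1..<Suc s] \<in> d_wedge_sets s S" unfolding d_wedge_sets_def by auto
    thus ?case by (rule ann)
  next
    case (Suc k)
    have "[1..<Suc s] = [1..<Suc k] @ [Suc k..<Suc s]"
      using upt_add_eq_append[of 1 "Suc k" "s - k"] Suc.prems(1) by simp
    also have "[Suc k..<Suc s] = Suc k # [Suc (Suc k)..<Suc s]"
      using Suc.prems(1) by (intro upt_conv_Cons) simp
    finally have split: "[1..<Suc s] = [1..<Suc k] @ Suc k # [Suc (Suc k)..<Suc s]" .
    define \<eta> where "\<eta> = \<omega> * ?P t [1..<Suc k]"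
    define \<zeta> where "\<zeta> = ?P t [Suc (Suc k)..<Suc s]"
    have upd: "\<omega> * ?P (t(Suc k := y)) [1..<Suc s] = \<eta> * (D y * \<zeta>)" for y
    proof -
      have "?P (t(Suc k := y)) [1..<Suc k] = ?P t [1..<Suc k]"
        "?P (t(Suc k := y)) [Suc (Suc k)..<Suc s] = ?P t [Suc (Suc k)..<Suc s]"
        by (intro arg_cong[of _ _ prod_list] map_cong; auto)+
      thus ?thesis unfolding split \<eta>_def \<zeta>_def by (simp add: mult.assoc del: upt_Suc)
    qed
    have "\<eta> * (D y * \<zeta>) = 0" if "y \<in> S (Suc k)" for y
      unfolding upd[symmetric] by (rule Suc.IH) (use Suc.prems that in auto)
    moreover have "d_spanned (S (Suc k)) (t (Suc k))" using Suc.prems by (intro span) auto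
    ultimately have "\<eta> * (D (t (Suc k)) * \<zeta>) = 0" unfolding d_spanned_def by blast
    thus ?case using upd[of "t (Suc k)"] by simp
  qed
  from this[of s] u show ?thesis by (auto simp: d_wedge_sets_def)
qed

lemma d_wedge_sets_image:
  "u \<in> d_wedge_sets s (\<lambda>i. a i ` {1..m i}) \<longleftrightarrow> (\<exists>j. (\<forall>i\<in>{1..s}. j i \<in> {1..m i}) \<and> u = d_product a j s)"
proof
  assume "u \<in> d_wedge_sets s (\<lambda>i. a i ` {1..m i})"
  then obtain t where t: "\<forall>i\<in>{1..s}. t i \<in> a i ` {1..m i}" "u = prod_list (map (\<lambda>i. D (t i)) [1..<Suc s])"
    unfolding d_wedge_sets_def by blast
  hence "\<forall>i\<in>{1..s}. \<exists>j. j \<in> {1..m i} \<and> t i = a i j" by blast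
  from bchoice[OF this] obtain j where j: "\<forall>i\<in>{1..s}. j i \<in> {1..m i} \<and> t i = a i (j i)" ..
  have "u = d_product a j s"
    unfolding t(2) d_product_def by (intro arg_cong[of _ _ prod_list] map_cong) (use j in auto)
  thus "\<exists>j. (\<forall>i\<in>{1..s}. j i \<in> {1..m i}) \<and> u = d_product a j s" using j by blast
next
  assume "\<exists>j. (\<forall>i\<in>{1..s}. j i \<in> {1..m i}) \<and> u = d_product a j s"
  then obtain j where j: "\<forall>i\<in>{1..s}. j i \<in> {1..m i}" "u = d_product a j s" by blast
  thus "u \<in> d_wedge_sets s (\<lambda>i. a i ` {1..m i})"
    unfolding d_wedge_sets_def d_product_def
    by (intro CollectI exI[of _ "\<lambda>i. a i (j i)"]) auto
qed

section \<open>Annihilators for a normalized system\<close>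

context
  fixes r s :: nat and m k :: "nat \<Rightarrow> nat" and a :: "nat \<Rightarrow> nat \<Rightarrow> 'a::field"
  assumes p: "CHAR('a) > 0" and system: "normalized_system r m a k s"
begin

private abbreviation (input) "N \<equiv> \<lambda>i. norm_field UNIV (normalized_pform (m i) (a i))"
private abbreviation (input) "A \<equiv> \<lambda>i. a i ` {1..k i}"
private abbreviation (input) "B \<equiv> \<lambda>i. a i ` {1..m i}"

lemma system_facts:
  shows "s \<le> r" "ext_degree (M_field r m) (MT_field r m a r) = CHAR('a) ^ s"
    "MT_field r m a r = MT_field r m a s"
    "i \<in> {1..s} \<Longrightarrow> A i \<subseteq> B i" "B i \<subseteq> N i"
    "i \<in> {1..s} \<Longrightarrow> N i = generate_field type_ring (pth_powers UNIV \<union> A i)"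
proof -
  show "s \<le> r" "ext_degree (M_field r m) (MT_field r m a r) = CHAR('a) ^ s"
    "MT_field r m a r = MT_field r m a s"
    using system unfolding normalized_system_def by blast+
  show "B i \<subseteq> N i" by (rule norm_field_normalized(1)[OF p subfield_set_UNIV]) simp
  assume "i \<in> {1..s}"
  hence "i \<in> {1..r}" using \<open>s \<le> r\<close> by simp
  hence "k i \<le> m i \<and> N i = generate_field type_ring (pth_powers UNIV \<union> A i)"
    using system unfolding normalized_system_def by blast
  thus "A i \<subseteq> B i" "N i = generate_field type_ring (pth_powers UNIV \<union> A i)"
    by (auto intro!: image_mono)
qed

text \<open>\<open>B\<close> is what the expansion yields, \<open>A\<close> and \<open>N\<close> are
  what the theorem speaks of. As \<open>A i\<close> is contained in \<open>B i\<close> and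
  \<open>B i\<close> in \<open>N i\<close>, it suffices to pass from \<open>A\<close> to
  \<open>N\<close>, which is \<open>annihilates_spanned\<close>.\<close>

lemma annihilator_equivalences:
  "(\<forall>u\<in>d_wedge_sets s A. \<omega> * u = 0) \<longleftrightarrow> (\<forall>u\<in>d_wedge_sets s N. \<omega> * u = 0)"
  "(\<forall>u\<in>d_wedge_sets s A. \<omega> * u = 0) \<longleftrightarrow> (\<forall>u\<in>d_wedge_sets s B. \<omega> * u = 0)"
proof -
  have "\<forall>u\<in>d_wedge_sets s N. \<omega> * u = 0" if "\<forall>u\<in>d_wedge_sets s A. \<omega> * u = 0"
  proof
    fix u assume "u \<in> d_wedge_sets s N"
    thus "\<omega> * u = 0"
      by (rule annihilates_spanned[of s N A, rotated 2])
         (use that in \<open>auto intro!: d_spanned_generate_field[OF p] simp: system_facts(6)\<close>)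
  qed
  moreover have "d_wedge_sets s A \<subseteq> d_wedge_sets s B" "d_wedge_sets s B \<subseteq> d_wedge_sets s N"
    by (rule d_wedge_sets_mono[OF system_facts(4)], assumption) (rule d_wedge_sets_mono[OF system_facts(5)])
  ultimately show "(\<forall>u\<in>d_wedge_sets s A. \<omega> * u = 0) \<longleftrightarrow> (\<forall>u\<in>d_wedge_sets s N. \<omega> * u = 0)"
    "(\<forall>u\<in>d_wedge_sets s A. \<omega> * u = 0) \<longleftrightarrow> (\<forall>u\<in>d_wedge_sets s B. \<omega> * u = 0)" by blast+
qed

text \<open>Some product is non-zero iff the form 1 is not an annihilator, so the equivalence of
  annihilators transfers this from all n_i coefficients to the first k_i.\<close>

lemma d_wedge_nonzero: "\<exists>u\<in>d_wedge_sets s A. u \<noteq> 0"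
proof (rule ccontr)
  assume "\<not> ?thesis"
  hence "\<forall>u\<in>d_wedge_sets s A. 1 * u = 0" by simp
  hence "\<forall>u\<in>d_wedge_sets s B. 1 * u = 0" by (simp only: annihilator_equivalences(2))
  moreover obtain j where "\<forall>i\<in>{1..s}. j i \<in> {1..m i}" "d_product a j s \<noteq> 0"
    using d_product_nonzero[OF p system_facts(1-3)] by blast
  ultimately show False using d_wedge_sets_image[of "d_product a j s" s a m] by auto
qed

lemma Ann_Omega_eq: "Ann_Omega n (d_wedge_sets s A) = Ann_Omega n (d_wedge_sets s N)"
  by (simp only: Ann_Omega_def annihilator_equivalences(1))

text \<open>The function fields of all r forms and of the first s forms are the instances t = r and
  t = s; their kernels agree because the right-hand side does not mention t.\<close>

lemma Omega_ker_eq_Ann: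
  fixes \<kappa> :: "'a \<Rightarrow> 'k::field"
  assumes it: "is_iterated_function_field \<kappa> (normalized_pforms t m a)" and t: "s \<le> t" "t \<le> r"
  shows "Omega_ker n \<kappa> = Ann_Omega n (d_wedge_sets s A)"
proof -
  have *: "dform_map \<kappa> \<omega> = 0 \<longleftrightarrow> (\<forall>u\<in>d_wedge_sets s A. \<omega> * u = 0)" if \<omega>: "\<omega> \<in> Omega n" for \<omega>
  proof -
    have "dform_map \<kappa> \<omega> = 0 \<longleftrightarrow> (\<forall>j. (\<forall>i\<in>{1..s}. j i \<in> {1..m i}) \<longrightarrow> d_product a j s * \<omega> = 0)"
      by (rule dform_map_eq_0_iff[OF p it t(1) d_product_nonzero[OF p system_facts(1-3)]])
         (rule d_product_vanish[OF p system_facts(1-3)], use t in auto)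
    also have "\<dots> \<longleftrightarrow> (\<forall>j. (\<forall>i\<in>{1..s}. j i \<in> {1..m i}) \<longrightarrow> \<omega> * d_product a j s = 0)"
    proof -
      have "d_product a j s * \<omega> = 0 \<longleftrightarrow> \<omega> * d_product a j s = 0" for j
        using D_product_commute_eq_0[OF \<omega>, of "map (\<lambda>i. a i (j i)) [1..<Suc s]"]
        by (simp add: d_product_def comp_def del: upt_Suc)
      thus ?thesis by simp
    qed
    also have "\<dots> \<longleftrightarrow> (\<forall>u\<in>d_wedge_sets s B. \<omega> * u = 0)"
      unfolding Ball_def d_wedge_sets_image by blast
    finally show ?thesis by (simp only: annihilator_equivalences(2))
  qed
  thus ?thesis by (auto simp: Omega_ker_def Ann_Omega_def)
qed

end

text \<open>\<iota> and \<kappa> are arbitrary realizations of the two function fields, in arbitrary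
  types. The last conjunct makes the dependence on norm fields precise: the second system has its
  own length and its own forms over F, and shares with the first one s and the norm fields of the
  first s forms.\<close>

theorem theorem4p5:
  fixes a :: "nat \<Rightarrow> nat \<Rightarrow> 'a::field"
    and m k :: "nat \<Rightarrow> nat"
    and r s n :: nat
    and \<iota> :: "'a \<Rightarrow> 'k::field"
    and \<kappa> :: "'a \<Rightarrow> 'l::field"
  assumes char: "CHAR('a) > 0"
    and system: "normalized_system r m a k s"
    and K: "is_iterated_function_field \<iota> (normalized_pforms r m a)"
    and L: "is_iterated_function_field \<kappa> (normalized_pforms s m a)"
  defines "N \<equiv> (\<lambda>i. norm_field UNIV (normalized_pform (m i) (a i)))"
    and "A \<equiv> (\<lambda>i. a i ` {1..k i})"
  shows "(\<exists>u\<in>d_wedge_sets s A. u \<noteq> 0) \<and>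
    Omega_ker n \<iota> = Omega_ker n \<kappa> \<and>
    Omega_ker n \<kappa> = Ann_Omega n (d_wedge_sets s A) \<and>
    Ann_Omega n (d_wedge_sets s A) = Ann_Omega n (d_wedge_sets s N) \<and>
    nu_ker n \<iota> = nu_ker n \<kappa> \<and>
    nu_ker n \<kappa> = Ann_nu n (d_wedge_sets s A) \<and>
    Ann_nu n (d_wedge_sets s A) = Ann_nu n (d_wedge_sets s N) \<and>
    (\<forall>r' m' (a' :: nat \<Rightarrow> nat \<Rightarrow> 'a) k' (\<iota>' :: 'a \<Rightarrow> 'k'::field).
       normalized_system r' m' a' k' s \<longrightarrow>
       is_iterated_function_field \<iota>' (normalized_pforms r' m' a') \<longrightarrow>
       (\<forall>i\<in>{1..s}. norm_field UNIV (normalized_pform (m' i) (a' i)) = N i) \<longrightarrow>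
       Omega_ker n \<iota>' = Omega_ker n \<iota> \<and> nu_ker n \<iota>' = nu_ker n \<iota>)"
proof -
  note sr = system_facts(1)[OF char system]
  have 1: "\<exists>u\<in>d_wedge_sets s A. u \<noteq> 0"
    unfolding A_def by (rule d_wedge_nonzero[OF char system])
  have 2: "Omega_ker n \<iota> = Ann_Omega n (d_wedge_sets s A)"
    unfolding A_def by (rule Omega_ker_eq_Ann[OF char system K sr order.refl])
  have 3: "Omega_ker n \<kappa> = Ann_Omega n (d_wedge_sets s A)"
    unfolding A_def by (rule Omega_ker_eq_Ann[OF char system L order.refl sr])
  have 4: "Ann_Omega n (d_wedge_sets s A) = Ann_Omega n (d_wedge_sets s N)"
    unfolding A_def N_def by (rule Ann_Omega_eq[OF char system])
  have 5: "Omega_ker n \<iota>' = Omega_ker n \<iota>"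
    if sys': "normalized_system r' m' a' k' s"
      and it': "is_iterated_function_field \<iota>' (normalized_pforms r' m' a')"
      and N': "\<forall>i\<in>{1..s}. norm_field UNIV (normalized_pform (m' i) (a' i)) = N i"
    for r' m' k' and a' :: "nat \<Rightarrow> nat \<Rightarrow> 'a" and \<iota>' :: "'a \<Rightarrow> 'k'"
  proof -
    \<comment> \<open>The annihilator of the wedge of the dN_i sees a system only through the norm
      fields of its first s forms.\<close>
    have "Omega_ker n \<iota>' = Ann_Omega n (d_wedge_sets s (\<lambda>i. norm_field UNIV (normalized_pform (m' i) (a' i))))"
      using Omega_ker_eq_Ann[OF char sys' it' system_facts(1)[OF char sys'] order.refl]
        Ann_Omega_eq[OF char sys'] by simp
    also have "d_wedge_sets s (\<lambda>i. norm_field UNIV (normalized_pform (m' i) (a' i))) = d_wedge_sets s N"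
      by (rule d_wedge_sets_cong) (use N' in blast)
    finally show ?thesis using 2 4 by simp
  qed
  show ?thesis
    using 1 2 3 4 5 by (simp add: nu_ker_def Ann_nu_def)
qed

end
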